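(* Let $\alpha,\beta\in(0,1)$, let $m\ge 1$ be an integer, let $T>0$, and let $g:[0,1]\to[0,1]$ be a measurable function. For each $\kappa>0$, let $\rho^\kappa:[0,T]\times[0,1]\to[0,1]$ be the unique weak solution of the porous medium equation with Robin boundary conditions with parameter $\kappa$ and initial condition $g$. Then $$\lim_{\kappa\to 0}\rho^\kappa=\rho^0\qquad\text{and}\qquad \lim_{\kappa\to\infty}\rho^\kappa=\rho^\infty$$ in $L^2([0,T]\times[0,1])$, where $\rho^0$ is the unique weak solution of the porous medium equation with Neumann boundary conditions and $\rho^\infty$ is the unique weak solution of the porous medium equation with Dirichlet boundary conditions, both with initial condition $g$.
   Context: Notation. $\langle\cdot,\cdot\rangle$ is the inner product of $L^2([0,1])$, with norm $\|\cdot\|_2$. $\mathcal H^1$ is the set of locally summable $\varphi:(0,1)\to\mathbb R$ having a weak derivative $\partial_u\varphi\in L^2([0,1])$, with $\|\varphi\|_{\mathcal H^1}^2=\|\varphi\|_2^2+\|\partial_u\varphi\|_2^2$; a function $\varphi\in\mathcal H^1$ is extended to $[0,1]$ by $\varphi(0):=\varphi(0^+)$, $\varphi(1):=\varphi(1^-)$ (continuous representative). $L^2(0,T;\mathcal H^1)$ is the set of measurable $\zeta:[0,T]\to\mathcal H^1$ with $\int_0^T\|\zeta_t\|_{\mathcal H^1}^2\,dt<\infty$. For $\rho\ge 0$ with $\rho^m\in L^2(0,T;\mathcal H^1)$, boundary values such as $\rho_s(0)$, $(\rho_s)^m(0)$ are understood through this extension of $(\rho_s)^m\in\mathcal H^1$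 (so $\rho_s(0)$ is the nonnegative $m$-th root of $(\rho_s)^m(0)$), for almost every $s$. $C^{1,2}([0,T]\times[0,1])$ is the set of functions once continuously differentiable in time and twice in space; $C^{1,2}_0([0,T]\times[0,1])$ is the subset of $G$ with $G_s(0)=G_s(1)=0$ for all $s\in[0,T]$. $\Delta=\partial_u^2$. Weak solution, Robin, $\kappa>0$ (formally $\partial_t\rho_t=\Delta(\rho_t)^m$, $\partial_u(\rho_t)^m(0)=\kappa(\rho_t(0)-\alpha)$, $\partial_u(\rho_t)^m(1)=\kappa(\beta-\rho_t(1))$, $\rho_0=g$): a function $\rho:[0,T]\times[0,1]\to[0,1]$ with (1) $\rho^m\in L^2(0,T;\mathcal H^1)$; (2) for all $t\in[0,T]$ and $G\in C^{1,2}([0,T]\times[0,1])$, $$\langle\rho_t,G_t\rangle-\langle g,G_0\rangle-\int_0^t\langle\rho_s,\partial_sG_s+(\rho_s)^{m-1}\Delta G_s\rangle ds+\int_0^t\{(\rho_s)^m(1)\partial_uG_s(1)-(\rho_s)^m(0)\partial_uG_s(0)\}ds-\kappa\int_0^t\{G_s(0)(\alpha-\rho_s(0))+G_s(1)(\beta-\rho_s(1))\}ds=0.$$ Weak solution, Neumann (formally $\partial_t\rho_t=\Delta(\rho_t)^m$, $\partial_u(\rho_t)^m(0)=\partial_u(\rho_t)^m(1)=0$, $\rho_0=g$): $\rho:[0,T]\times[0,1]\to[0,1]$ with $\rho^m\in L^2(0,T;\mathcal H^1)$ satisfying the preceding integral equation with $\kappa=0$, for all $t\in[0,T]$ and $G\in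 C^{1,2}([0,T]\times[0,1])$. Weak solution, Dirichlet (formally $\partial_t\rho_t=\Delta(\rho_t)^m$, $\rho_t(0)=\alpha$, $\rho_t(1)=\beta$, $\rho_0=g$): $\rho:[0,T]\times[0,1]\to[0,1]$ with (1) $\rho^m\in L^2(0,T;\mathcal H^1)$; (2) for all $t\in[0,T]$ and $G\in C^{1,2}_0([0,T]\times[0,1])$, $$\langle\rho_t,G_t\rangle-\langle g,G_0\rangle-\int_0^t\langle\rho_s,\partial_sG_s+(\rho_s)^{m-1}\Delta G_s\rangle ds+\int_0^t\{\beta^m\partial_uG_s(1)-\alpha^m\partial_uG_s(0)\}ds=0;$$ (3) for almost every $t\in(0,T]$, $\rho_t(0)=\alpha$ and $\rho_t(1)=\beta$. Existence and uniqueness of each of these weak solutions is taken as known. *)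

theory Defs
  imports "HOL-Analysis.Analysis"
begin

section \<open>The spaces \<open>L\<^sup>2([0,1])\<close> and \<open>H\<^sup>1\<close>\<close>

text \<open>
  Functions on \<open>[0,1]\<close> are total functions on the reals of which only the values on \<open>[0,1]\<close>
  matter; elements of \<open>L\<^sup>2\<close> and \<open>H\<^sup>1\<close> are represented by functions and not by almost-everywhere
  equivalence classes.  Measurability is Lebesgue measurability throughout.
\<close>

definition L2 :: "(real \<Rightarrow> real) set" where
  "L2 = {f \<in> borel_measurable (lebesgue_on {0..1}).
           integrable (lebesgue_on {0..1}) (\<lambda>u. (f u)\<^sup>2)}"

definition L2_inner :: "(real \<Rightarrow> real) \<Rightarrow> (real \<Rightarrow> real) \<Rightarrow> real" where
  "L2_inner f h = (LINT u|lebesgue_on {0..1}. f u * h u)"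

definition L2_norm :: "(real \<Rightarrow> real) \<Rightarrow> real" where
  "L2_norm f = sqrt (L2_inner f f)"

definition locally_summable :: "(real \<Rightarrow> real) \<Rightarrow> bool" where
  "locally_summable \<phi> \<longleftrightarrow>
     (\<forall>K. compact K \<and> K \<subseteq> {0<..<1} \<longrightarrow> integrable (lebesgue_on K) \<phi>)"

text \<open>The test functions \<open>C\<^sub>c\<^sup>\<infinity>((0,1))\<close>, extended by zero to the real line.\<close>

definition test_functions :: "(real \<Rightarrow> real) set" where
  "test_functions =
     {\<eta>. (\<forall>k x. (deriv ^^ k) \<eta> differentiable (at x)) \<and>
          (\<exists>K. compact K \<and> K \<subseteq> {0<..<1} \<and> (\<forall>x. x \<notin> K \<longrightarrow> \<eta> x = 0))}"

definition has_weak_derivative :: "(real \<Rightarrow> real) \<Rightarrow> (real \<Rightarrow> real) \<Rightarrow> bool" where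
  "has_weak_derivative \<phi> \<psi> \<longleftrightarrow> locally_summable \<phi> \<and> locally_summable \<psi> \<and>
     (\<forall>\<eta>\<in>test_functions.
        (LINT u|lebesgue_on {0<..<1}. \<phi> u * deriv \<eta> u) =
        - (LINT u|lebesgue_on {0<..<1}. \<psi> u * \<eta> u))"

definition H1 :: "(real \<Rightarrow> real) set" where
  "H1 = {\<phi>. \<exists>\<psi>\<in>L2. has_weak_derivative \<phi> \<psi>}"

text \<open>Weak derivatives are unique almost everywhere, so the choice below is immaterial.\<close>

definition weak_derivative :: "(real \<Rightarrow> real) \<Rightarrow> real \<Rightarrow> real" where
  "weak_derivative \<phi> = (SOME \<psi>. \<psi> \<in> L2 \<and> has_weak_derivative \<phi> \<psi>)"

definition H1_norm :: "(real \<Rightarrow> real) \<Rightarrow> real" where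
  "H1_norm \<phi> = sqrt ((L2_norm \<phi>)\<^sup>2 + (L2_norm (weak_derivative \<phi>))\<^sup>2)"

text \<open>
  The continuous representative of an element of \<open>H\<^sup>1\<close>, extended to the closed interval by its
  one-sided limits; its values on \<open>[0,1]\<close> are uniquely determined.
\<close>

definition H1_rep :: "(real \<Rightarrow> real) \<Rightarrow> real \<Rightarrow> real" where
  "H1_rep \<phi> = (SOME c. continuous_on {0..1} c \<and> (AE u in lebesgue_on {0..1}. \<phi> u = c u))"

section \<open>The space \<open>L\<^sup>2(0,T;H\<^sup>1)\<close>\<close>

definition H1_borel :: "(real \<Rightarrow> real) measure" where
  "H1_borel = sigma H1
     {U. U \<subseteq> H1 \<and>
         (\<forall>\<phi>\<in>U. \<exists>\<epsilon>>0. \<forall>\<eta>\<in>H1. H1_norm (\<lambda>u. \<eta> u - \<phi> u) < \<epsilon> \<longrightarrow> \<eta> \<in> U)}"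

text \<open>
  Elements of \<open>L\<^sup>2(0,T;H\<^sup>1)\<close> are identified when they agree for almost every time.  It would be wrong
  to ask for \<open>f t \<in> H1\<close> at every \<open>t\<close>: a weak solution equals the initial datum, which is merely
  measurable, at time 0.
\<close>

definition L2_time_H1 :: "real \<Rightarrow> (real \<Rightarrow> real \<Rightarrow> real) set" where
  "L2_time_H1 T = {f. \<exists>\<zeta>. \<zeta> \<in> lebesgue_on {0..T} \<rightarrow>\<^sub>M H1_borel \<and>
     integrable (lebesgue_on {0..T}) (\<lambda>t. (H1_norm (\<zeta> t))\<^sup>2) \<and>
     (AE t in lebesgue_on {0..T}. AE u in lebesgue_on {0..1}. f t u = \<zeta> t u)}"

section \<open>Space-time test functions\<close>

text \<open>
  \<open>C12 T G Gs Gu Guu\<close>: \<open>G\<close> is of class \<open>C\<^sup>1\<^sup>,\<^sup>2\<close> on \<open>[0,T] \<times> [0,1]\<close> with time derivative \<open>Gs\<close> and space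
  derivatives \<open>Gu\<close>, \<open>Guu\<close>.  Derivatives at the boundary are one-sided, and on the rectangle the
  three derivatives are determined by \<open>G\<close>.
\<close>

definition C12 ::
  "real \<Rightarrow> (real \<Rightarrow> real \<Rightarrow> real) \<Rightarrow> (real \<Rightarrow> real \<Rightarrow> real) \<Rightarrow>
   (real \<Rightarrow> real \<Rightarrow> real) \<Rightarrow> (real \<Rightarrow> real \<Rightarrow> real) \<Rightarrow> bool" where
  "C12 T G Gs Gu Guu \<longleftrightarrow>
     (\<forall>s\<in>{0..T}. \<forall>u\<in>{0..1}.
        ((\<lambda>r. G r u) has_real_derivative Gs s u) (at s within {0..T}) \<and>
        ((\<lambda>v. G s v) has_real_derivative Gu s u) (at u within {0..1}) \<and>
        ((\<lambda>v. Gu s v) has_real_derivative Guu s u) (at u within {0..1})) \<and>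
     continuous_on ({0..T} \<times> {0..1}) (\<lambda>(s, u). G s u) \<and>
     continuous_on ({0..T} \<times> {0..1}) (\<lambda>(s, u). Gs s u) \<and>
     continuous_on ({0..T} \<times> {0..1}) (\<lambda>(s, u). Gu s u) \<and>
     continuous_on ({0..T} \<times> {0..1}) (\<lambda>(s, u). Guu s u)"

definition C12_0 ::
  "real \<Rightarrow> (real \<Rightarrow> real \<Rightarrow> real) \<Rightarrow> (real \<Rightarrow> real \<Rightarrow> real) \<Rightarrow>
   (real \<Rightarrow> real \<Rightarrow> real) \<Rightarrow> (real \<Rightarrow> real \<Rightarrow> real) \<Rightarrow> bool" where
  "C12_0 T G Gs Gu Guu \<longleftrightarrow>
     C12 T G Gs Gu Guu \<and> (\<forall>s\<in>{0..T}. G s 0 = 0 \<and> G s 1 = 0)"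

section \<open>Weak solutions of the porous medium equation\<close>

text \<open>
  Boundary values (\<open>u = 0\<close> or \<open>u = 1\<close>) of a profile \<open>r\<close> with \<open>r\<^sup>m \<in> H\<^sup>1\<close>: \<open>bdry_pow m r u\<close> stands for
  \<open>r\<^sup>m(u)\<close> and \<open>bdry m r u\<close> for \<open>r(u)\<close>.
\<close>

definition bdry_pow :: "nat \<Rightarrow> (real \<Rightarrow> real) \<Rightarrow> real \<Rightarrow> real" where
  "bdry_pow m r u = H1_rep (\<lambda>v. r v ^ m) u"

definition bdry :: "nat \<Rightarrow> (real \<Rightarrow> real) \<Rightarrow> real \<Rightarrow> real" where
  "bdry m r u = root m (bdry_pow m r u)"

text \<open>
  The measurability conditions make the inner products \<open>\<langle>\<rho>\<^sub>t, G\<^sub>t\<rangle>\<close> (for every \<open>t\<close>) and the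
  \<open>L\<^sup>2([0,T] \<times> [0,1])\<close> norm meaningful; all integrals below are then integrals of integrable
  functions.
\<close>

definition pme_admissible :: "nat \<Rightarrow> real \<Rightarrow> (real \<Rightarrow> real \<Rightarrow> real) \<Rightarrow> bool" where
  "pme_admissible m T \<rho> \<longleftrightarrow>
     (\<forall>t\<in>{0..T}. \<forall>u\<in>{0..1}. \<rho> t u \<in> {0..1}) \<and>
     (\<lambda>(t, u). \<rho> t u) \<in> borel_measurable (lebesgue_on ({0..T} \<times> {0..1})) \<and>
     (\<forall>t\<in>{0..T}. \<rho> t \<in> borel_measurable (lebesgue_on {0..1})) \<and>
     (\<lambda>t u. \<rho> t u ^ m) \<in> L2_time_H1 T"

definition pme_bulk ::
  "nat \<Rightarrow> (real \<Rightarrow> real) \<Rightarrow> (real \<Rightarrow> real \<Rightarrow> real) \<Rightarrow> (real \<Rightarrow> real \<Rightarrow> real) \<Rightarrow>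
   (real \<Rightarrow> real \<Rightarrow> real) \<Rightarrow> (real \<Rightarrow> real \<Rightarrow> real) \<Rightarrow> real \<Rightarrow> real" where
  "pme_bulk m g \<rho> G Gs Guu t =
     L2_inner (\<rho> t) (G t) - L2_inner g (G 0)
     - (LINT s|lebesgue_on {0..t}. L2_inner (\<rho> s) (\<lambda>u. Gs s u + \<rho> s u ^ (m - 1) * Guu s u))"

definition robin_weak_solution ::
  "nat \<Rightarrow> real \<Rightarrow> real \<Rightarrow> real \<Rightarrow> real \<Rightarrow> (real \<Rightarrow> real) \<Rightarrow> (real \<Rightarrow> real \<Rightarrow> real) \<Rightarrow> bool" where
  "robin_weak_solution m T \<alpha> \<beta> \<kappa> g \<rho> \<longleftrightarrow> pme_admissible m T \<rho> \<and>
     (\<forall>t\<in>{0..T}. \<forall>G Gs Gu Guu. C12 T G Gs Gu Guu \<longrightarrow>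
        pme_bulk m g \<rho> G Gs Guu t
        + (LINT s|lebesgue_on {0..t}. bdry_pow m (\<rho> s) 1 * Gu s 1 - bdry_pow m (\<rho> s) 0 * Gu s 0)
        - \<kappa> * (LINT s|lebesgue_on {0..t}.
                 G s 0 * (\<alpha> - bdry m (\<rho> s) 0) + G s 1 * (\<beta> - bdry m (\<rho> s) 1)) = 0)"

definition neumann_weak_solution ::
  "nat \<Rightarrow> real \<Rightarrow> (real \<Rightarrow> real) \<Rightarrow> (real \<Rightarrow> real \<Rightarrow> real) \<Rightarrow> bool" where
  "neumann_weak_solution m T g \<rho> \<longleftrightarrow> pme_admissible m T \<rho> \<and>
     (\<forall>t\<in>{0..T}. \<forall>G Gs Gu Guu. C12 T G Gs Gu Guu \<longrightarrow>
        pme_bulk m g \<rho> G Gs Guu t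
        + (LINT s|lebesgue_on {0..t}. bdry_pow m (\<rho> s) 1 * Gu s 1 - bdry_pow m (\<rho> s) 0 * Gu s 0)
        = 0)"

definition dirichlet_weak_solution ::
  "nat \<Rightarrow> real \<Rightarrow> real \<Rightarrow> real \<Rightarrow> (real \<Rightarrow> real) \<Rightarrow> (real \<Rightarrow> real \<Rightarrow> real) \<Rightarrow> bool" where
  "dirichlet_weak_solution m T \<alpha> \<beta> g \<rho> \<longleftrightarrow> pme_admissible m T \<rho> \<and>
     (\<forall>t\<in>{0..T}. \<forall>G Gs Gu Guu. C12_0 T G Gs Gu Guu \<longrightarrow>
        pme_bulk m g \<rho> G Gs Guu t
        + (LINT s|lebesgue_on {0..t}. \<beta> ^ m * Gu s 1 - \<alpha> ^ m * Gu s 0) = 0) \<and>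
     (AE t in lebesgue_on {0<..T}. bdry m (\<rho> t) 0 = \<alpha> \<and> bdry m (\<rho> t) 1 = \<beta>)"

definition L2_spacetime_dist ::
  "real \<Rightarrow> (real \<Rightarrow> real \<Rightarrow> real) \<Rightarrow> (real \<Rightarrow> real \<Rightarrow> real) \<Rightarrow> real" where
  "L2_spacetime_dist T f h =
     sqrt (LINT (t, u)|lebesgue_on ({0..T} \<times> {0..1}). (f t u - h t u)\<^sup>2)"

end

theory Submission
  imports Defs "HOL-Real_Asymp.Real_Asymp"
begin

text \<open>
  Each weak formulation is read only against the time-independent test functions
  \<open>cos (k \<pi> u)\<close> and \<open>sin (k \<pi> u)\<close>.  A weak solution thereby becomes a family of scalar functions
  of time, its Fourier coefficients, and each of them is a primitive of an explicit bounded
  function.  Estimates for single modes are added up with the weights of the Fejer kernel: these are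
  nonnegative, and the resulting means of a continuous function converge up to the boundary for
  cosines and in the interior for sines (\<open>fejer_parseval\<close>, \<open>cos_mean_tendsto\<close>).

  Let \<open>v\<close> be the difference of two solutions and \<open>W\<close> the difference of their \<open>m\<close>-th powers.  The
  pairing \<open>\<integral>\<integral> v W\<close> controls the \<open>L\<^sup>2\<close> distance, because \<open>v W \<ge> \<bar>v\<bar>\<^bsup>m+1\<^esup>\<close>.  To bound it from above one
  would like to use Oleinik's test function \<open>\<integral>\<^sub>t\<^sup>T W\<^sub>s ds\<close>.  On a single mode this test amounts to the
  identity \<open>\<integral> F F' = F(T)\<^sup>2/2 \<ge> 0\<close> for the coefficient \<open>F\<close> of \<open>v\<close>, whose derivative is
  \<open>- (k \<pi>)\<^sup>2\<close> times the coefficient of \<open>W\<close> plus boundary terms.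

  For \<open>\<kappa> \<rightarrow> 0\<close> cosines are used.  The boundary terms are then the Robin fluxes, which are
  \<open>O(\<kappa>)\<close>, and the \<open>k\<close>-th mode contributes \<open>O(\<kappa> / k\<^sup>2)\<close>, so that \<open>\<integral>\<integral> v W = O(\<kappa>)\<close>
  (\<open>robin_neumann_pairing_le\<close>).

  For \<open>\<kappa> \<rightarrow> \<infinity>\<close> sines are used.  They do not see the fluxes, and the boundary values of \<open>W\<close> are
  absorbed by subtracting from \<open>W\<close> its affine interpolation; hence \<open>\<integral>\<integral> v W\<close> is at most the \<open>L\<^sup>1\<close> norm
  in time of the boundary values of \<open>W\<close> (\<open>robin_dirichlet_pairing_le\<close>).  It remains to see that the
  boundary values of the Robin solution converge to \<open>\<alpha>\<close> and \<open>\<beta>\<close> in \<open>L\<^sup>1(0,T)\<close>.  Formally, testing the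
  equation with \<open>\<rho>\<^sup>m - h\<close>, where \<open>h\<close> is the affine function with \<open>h(0) = \<alpha>\<^sup>m\<close> and \<open>h(1) = \<beta>\<^sup>m\<close>, gives
  \<open>\<kappa> \<integral> (\<rho>\<^sub>t(0) - \<alpha>) (\<rho>\<^sub>t\<^sup>m(0) - \<alpha>\<^sup>m) dt \<le> C\<close> and the same at \<open>1\<close>, with \<open>C\<close> independent of \<open>\<kappa>\<close>.  Since
  \<open>\<rho>\<^sup>m\<close> has no regularity in time, the test is carried out with an exponential memory
  kernel; convexity of \<open>x\<^bsup>m+1\<^esup>\<close> replaces the chain rule for the time derivative, and positivity of the
  kernel \<open>exp (- l \<bar>r - s\<bar>)\<close> makes the gradient term harmless (\<open>robin_energy\<close>).

  All of this speaks about boundary values, so it must first be known that the choice behind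
  \<open>H1_rep\<close> is a choice of an actual continuous representative.  This follows from a du Bois-Reymond
  argument on cosine coefficients (\<open>H1_bounded_continuous_representative\<close>).
\<close>

section \<open>Integration on a compact interval\<close>

text \<open>
  Time intervals and the space interval both start at 0, so one abbreviation serves for both.
\<close>

abbreviation (input) leb :: "real \<Rightarrow> real measure" where
  "leb t \<equiv> lebesgue_on {0..t}"

lemma integrable_bounded_Icc:
  fixes f :: "real \<Rightarrow> real"
  assumes "f \<in> borel_measurable (lebesgue_on {a..b})"
    and "AE x in lebesgue_on {a..b}. \<bar>f x\<bar> \<le> B"
  shows "integrable (lebesgue_on {a..b}) f"
proof -
  interpret finite_measure "lebesgue_on {a..b}"
    by (rule finite_measure_lebesgue_on) simp
  show ?thesis
    using assms by (intro integrable_const_bound[where B = B]) auto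
qed

lemma continuous_on_Icc_bounded:
  fixes f :: "real \<Rightarrow> real"
  assumes "continuous_on {a..b} f"
  obtains B where "\<And>x. x \<in> {a..b} \<Longrightarrow> \<bar>f x\<bar> \<le> B" "0 \<le> B"
proof -
  obtain B where "\<forall>x\<in>{a..b}. \<bar>f x\<bar> \<le> B"
    using compact_imp_bounded[OF compact_continuous_image[OF assms compact_Icc]]
    by (auto simp: bounded_iff)
  then show ?thesis by (intro that[of "\<bar>B\<bar>"]) force+
qed

lemma LINT_const_Icc:
  fixes a b c :: real
  assumes "a \<le> b"
  shows "(LINT x|lebesgue_on {a..b}. c) = (b - a) * c"
  using assms by (simp add: measure_restrict_space)

lemma integrable_const_Icc: "integrable (lebesgue_on {a..b}) (\<lambda>_::real. c :: real)"
  by (intro continuous_imp_integrable_real continuous_on_const)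

lemma LINT_abs_le_Icc:
  fixes f :: "real \<Rightarrow> real"
  assumes ab: "a \<le> b" and bnd: "AE x in lebesgue_on {a..b}. \<bar>f x\<bar> \<le> B" and B: "0 \<le> B"
  shows "\<bar>LINT x|lebesgue_on {a..b}. f x\<bar> \<le> (b - a) * B"
proof (cases "integrable (lebesgue_on {a..b}) f")
  case True
  have i: "integrable (lebesgue_on {a..b}) (\<lambda>x. B)"
    by (rule integrable_bounded_Icc[where B = "\<bar>B\<bar>"]) auto
  have "\<bar>LINT x|lebesgue_on {a..b}. f x\<bar> \<le> (LINT x|lebesgue_on {a..b}. \<bar>f x\<bar>)"
    by (rule integral_abs_bound)
  also have "\<dots> \<le> (LINT x|lebesgue_on {a..b}. B)"
    using True bnd i by (intro integral_mono_AE) auto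
  finally show ?thesis
    unfolding LINT_const_Icc[OF ab] .
next
  case False
  then show ?thesis
    using ab B by (simp add: not_integrable_integral_eq)
qed

lemma measurable_Icc_subset:
  fixes f :: "real \<Rightarrow> real"
  assumes "f \<in> borel_measurable (lebesgue_on {a..b})" "{c..d} \<subseteq> {a..b}"
  shows "f \<in> borel_measurable (lebesgue_on {c..d})"
  using assms by (rule measurable_restrict_mono)

lemma AE_Icc_subset:
  fixes P :: "real \<Rightarrow> bool"
  assumes "AE x in lebesgue_on {a..b}. P x" "{c..d} \<subseteq> {a..b}"
  shows "AE x in lebesgue_on {c..d}. P x"
proof -
  have "AE x in lebesgue. x \<in> {a..b} \<longrightarrow> P x"
    using assms(1) by (simp add: AE_restrict_space_iff)
  then have "AE x in lebesgue. x \<in> {c..d} \<longrightarrow> P x"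
    by (rule eventually_mono) (use assms(2) in blast)
  then show ?thesis by (simp add: AE_restrict_space_iff)
qed

lemma LINT_sub_Icc:
  fixes f :: "real \<Rightarrow> real"
  assumes "{c..d} \<subseteq> {a..b}"
  shows "(LINT x|lebesgue_on {a..b}. indicator {c..d} x * f x) = (LINT x|lebesgue_on {c..d}. f x)"
  using integral_restrict[OF assms, of f] by (simp add: indicator_times_eq_if)

lemma measurable_AE_lebesgue_on:
  fixes f g :: "real \<Rightarrow> real"
  assumes f: "f \<in> borel_measurable (lebesgue_on S)" and S: "S \<in> sets lebesgue"
    and ae: "AE x in lebesgue_on S. f x = g x"
  shows "g \<in> borel_measurable (lebesgue_on S)"
proof -
  have "(\<lambda>x. if x \<in> S then f x else 0) \<in> borel_measurable lebesgue"
    using f S by (simp add: borel_measurable_if)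
  moreover have "AE x in lebesgue. (if x \<in> S then f x else 0) = (if x \<in> S then g x else 0)"
    using ae S by (auto simp: AE_restrict_space_iff)
  ultimately have "(\<lambda>x. if x \<in> S then g x else 0) \<in> borel_measurable lebesgue"
    by (rule borel_measurable_AE)
  then show ?thesis using S by (simp add: borel_measurable_if)
qed

lemma measurable_continuous_Icc:
  fixes f :: "real \<Rightarrow> real"
  shows "continuous_on {a..b} f \<Longrightarrow> f \<in> borel_measurable (lebesgue_on {a..b})"
  by (rule continuous_imp_measurable_on_sets_lebesgue) simp_all

lemma integrable_bounded_times_continuous:
  fixes f h :: "real \<Rightarrow> real"
  assumes f: "f \<in> borel_measurable (lebesgue_on {a..b})" "AE u in lebesgue_on {a..b}. \<bar>f u\<bar> \<le> B"
    and h: "continuous_on {a..b} h"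
  shows "integrable (lebesgue_on {a..b}) (\<lambda>u. f u * h u)"
proof -
  obtain C where C: "\<And>u. u \<in> {a..b} \<Longrightarrow> \<bar>h u\<bar> \<le> C"
    using continuous_on_Icc_bounded[OF h] by blast
  have hm: "h \<in> borel_measurable (lebesgue_on {a..b})"
    using h by (rule continuous_imp_measurable_on_sets_lebesgue) simp
  have "AE u in lebesgue_on {a..b}. \<bar>f u * h u\<bar> \<le> \<bar>B\<bar> * \<bar>C\<bar>"
    by (rule lebesgue_on_mono[OF f(2)])
       (use C in \<open>force simp: abs_mult intro!: mult_mono\<close>)
  then show ?thesis
    using f(1) hm by (intro integrable_bounded_Icc) auto
qed

lemma integrable_times_continuous:
  fixes f h :: "real \<Rightarrow> real"
  assumes f: "integrable (lebesgue_on {a..b}) f" and h: "continuous_on {a..b} h"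
  shows "integrable (lebesgue_on {a..b}) (\<lambda>x. h x * f x)"
proof -
  obtain B where B: "\<And>x. x \<in> {a..b} \<Longrightarrow> \<bar>h x\<bar> \<le> B" "0 \<le> B"
    using continuous_on_Icc_bounded[OF h] by blast
  have "integrable (lebesgue_on {a..b}) (\<lambda>x. B * f x)" using f by simp
  then show ?thesis
  proof (rule Bochner_Integration.integrable_bound)
    show "(\<lambda>x. h x * f x) \<in> borel_measurable (lebesgue_on {a..b})"
      by (intro borel_measurable_times measurable_continuous_Icc h borel_measurable_integrable f)
    show "AE x in lebesgue_on {a..b}. norm (h x * f x) \<le> norm (B * f x)"
      by (rule AE_I2) (use B in \<open>auto simp: abs_mult intro!: mult_right_mono\<close>)
  qed
qed

lemma measurable_AE_limit:
  fixes f :: "nat \<Rightarrow> real \<Rightarrow> real"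
  assumes f: "\<And>n. f n \<in> borel_measurable (lebesgue_on S)" and S: "S \<in> sets lebesgue"
    and lim: "AE x in lebesgue_on S. (\<lambda>n. f n x) \<longlonglongrightarrow> g x"
  shows "g \<in> borel_measurable (lebesgue_on S)"
proof (rule measurable_AE_lebesgue_on[OF _ S])
  show "(\<lambda>x. lim (\<lambda>n. f n x)) \<in> borel_measurable (lebesgue_on S)"
    using f by measurable
  show "AE x in lebesgue_on S. lim (\<lambda>n. f n x) = g x"
    using lim by (auto elim!: eventually_mono dest: limI)
qed

lemma bounded_convergence_Icc:
  fixes f :: "nat \<Rightarrow> real \<Rightarrow> real"
  assumes f: "\<And>n. f n \<in> borel_measurable (lebesgue_on {a..b})"
    and bnd: "\<And>n. AE x in lebesgue_on {a..b}. \<bar>f n x\<bar> \<le> B"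
    and lim: "AE x in lebesgue_on {a..b}. (\<lambda>n. f n x) \<longlonglongrightarrow> g x"
  shows "(\<lambda>n. LINT x|lebesgue_on {a..b}. f n x) \<longlonglongrightarrow> (LINT x|lebesgue_on {a..b}. g x)"
proof (rule integral_dominated_convergence[where w = "\<lambda>x. B"])
  show "g \<in> borel_measurable (lebesgue_on {a..b})"
    using measurable_AE_limit[OF f _ lim] by simp
  show "integrable (lebesgue_on {a..b}) (\<lambda>x. B)"
    by (rule integrable_bounded_Icc[where B = "\<bar>B\<bar>"]) auto
qed (use f bnd lim in auto)

lemma LINT_FTC_Icc:
  fixes F f :: "real \<Rightarrow> real"
  assumes ab: "a \<le> b" and cont: "continuous_on {a..b} f"
    and der: "\<And>x. x \<in> {a..b} \<Longrightarrow> (F has_real_derivative f x) (at x within {a..b})"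
  shows "(LINT x|lebesgue_on {a..b}. f x) = F b - F a"
proof -
  have "integrable (lebesgue_on {a..b}) f"
    using cont by (rule continuous_imp_integrable_real)
  then have "(LINT x|lebesgue_on {a..b}. f x) = integral {a..b} f"
    by (rule lebesgue_integral_eq_integral) simp
  also have "\<dots> = F b - F a"
    using fundamental_theorem_of_calculus[OF ab, of F f] der
    by (intro integral_unique) (auto simp: has_real_derivative_iff_has_vector_derivative)
  finally show ?thesis .
qed

lemma LINT_square_eq_0_imp_AE:
  fixes f :: "real \<Rightarrow> real"
  assumes "integrable (lebesgue_on {a..b}) (\<lambda>u. (f u)\<^sup>2)" "(LINT u|lebesgue_on {a..b}. (f u)\<^sup>2) = 0"
  shows "AE u in lebesgue_on {a..b}. f u = 0"
  using integral_nonneg_eq_0_iff_AE[OF assms(1)] assms(2) by auto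

lemma continuous_on_LINT_upper:
  fixes f :: "real \<Rightarrow> real"
  assumes "integrable (lebesgue_on {a..b}) f"
  shows "continuous_on {a..b} (\<lambda>x. LINT s|lebesgue_on {a..x}. f s)"
proof -
  have i: "integrable (lebesgue_on {a..x}) f" if "x \<in> {a..b}" for x
    using integrable_subinterval[OF assms, of a x] that by auto
  have "f integrable_on {a..b}"
    using assms by (intro integrable_on_lebesgue_on) auto
  then have "continuous_on {a..b} (\<lambda>x. integral {a..x} f)"
    by (rule indefinite_integral_continuous_1)
  then show ?thesis
    by (rule continuous_on_eq) (rule lebesgue_integral_eq_integral[symmetric], rule i, simp_all)
qed

text \<open>
  Fubini's theorem: the two terms are the integrals of \<open>f s * g t\<close> over the triangles \<open>s \<le> t\<close> and
  \<open>t \<le> s\<close> of the square.  The rates of Fourier modes are only integrable in time, so a rule for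
  differentiable functions would not apply to them.
\<close>

lemma integration_by_parts_Icc:
  fixes f g :: "real \<Rightarrow> real"
  assumes T: "0 \<le> T" and f: "integrable (leb T) f" and g: "integrable (leb T) g"
  shows "(LINT t|leb T. (LINT s|leb t. f s) * g t)
       + (LINT t|leb T. f t * (LINT s|leb t. g s))
       = (LINT t|leb T. f t) * (LINT t|leb T. g t)"
    (is "?L1 + ?L2 = _")
    and "integrable (leb T) (\<lambda>t. (LINT s|leb t. f s) * g t)"
proof -
  let ?M = "leb T"
  interpret finite_measure ?M by (rule finite_measure_lebesgue_on) simp
  interpret P: pair_sigma_finite ?M ?M ..
  have fm[measurable]: "f \<in> borel_measurable ?M" and gm[measurable]: "g \<in> borel_measurable ?M"
    using f g by auto
  have id[measurable]: "(\<lambda>x::real. x) \<in> borel_measurable ?M"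
    using id_borel_measurable_lebesgue_on[of "{0..T}"] by (simp add: id_def)
  have fg: "integrable (?M \<Otimes>\<^sub>M ?M) (\<lambda>(s, t). f s * g t)"
  proof (rule P.Fubini_integrable)
    show "integrable ?M (\<lambda>x. LINT y|?M. norm (case (x, y) of (s, t) \<Rightarrow> f s * g t))"
      using f g by (simp add: abs_mult)
    show "AE x in ?M. integrable ?M (\<lambda>y. case (x, y) of (s, t) \<Rightarrow> f s * g t)"
      using g by simp
  qed measurable
  have F: "integrable (?M \<Otimes>\<^sub>M ?M) (\<lambda>(s, t). (if s \<le> t then f s * g t else 0))"
    by (rule Bochner_Integration.integrable_bound[OF fg]) (auto, measurable)
  have in_s: "(LINT s|?M. (if s \<le> t then f s * g t else 0)) = (LINT s|leb t. f s) * g t"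
    if "t \<in> {0..T}" for t
  proof -
    have "(LINT s|?M. (if s \<le> t then f s * g t else 0)) = (LINT s|?M. (indicator {0..t} s * f s) * g t)"
      by (intro Bochner_Integration.integral_cong) auto
    also have "\<dots> = (LINT s|?M. indicator {0..t} s * f s) * g t"
      by simp
    also have "(LINT s|?M. indicator {0..t} s * f s) = (LINT s|leb t. f s)"
      using that by (intro LINT_sub_Icc) auto
    finally show ?thesis .
  qed
  have in_t: "(LINT t|?M. (if s \<le> t then f s * g t else 0))
      = f s * ((LINT t|?M. g t) - (LINT t|leb s. g t))"
    if s: "s \<in> {0..T}" for s
  proof -
    have "AE t in ?M. t \<noteq> s"
      by (rule AE_I'[of "{s}"]) (use s in \<open>auto simp: null_sets_restrict_space\<close>)
    then have ae: "AE t in ?M. (if s \<le> t then f s * g t else 0) = f s * (g t - indicator {0..s} t * g t)"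
      by (rule lebesgue_on_mono) (auto simp: indicator_def)
    have m1: "(\<lambda>t. if s \<le> t then f s * g t else 0) \<in> borel_measurable ?M"
      by measurable
    have "(LINT t|?M. (if s \<le> t then f s * g t else 0)) = (LINT t|?M. f s * (g t - indicator {0..s} t * g t))"
      by (rule integral_cong_AE[OF m1 measurable_AE_lebesgue_on[OF m1 _ ae] ae]) simp
    also have "\<dots> = f s * ((LINT t|?M. g t) - (LINT t|?M. indicator {0..s} t * g t))"
    proof -
      have "integrable ?M (\<lambda>t. indicator {0..s} t * g t)"
        by (rule Bochner_Integration.integrable_bound[OF g]) (auto simp: indicator_def)
      then show ?thesis using g by simp
    qed
    also have "(LINT t|?M. indicator {0..s} t * g t) = (LINT t|leb s. g t)"
      using s by (intro LINT_sub_Icc) auto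
    finally show ?thesis .
  qed
  have "?L1 = (LINT t|?M. (LINT s|?M. (if s \<le> t then f s * g t else 0)))"
    by (intro Bochner_Integration.integral_cong) (auto simp: in_s)
  also have "\<dots> = (LINT s|?M. (LINT t|?M. (if s \<le> t then f s * g t else 0)))"
    using F by (rule P.Fubini_integral)
  also have "\<dots> = (LINT s|?M. f s * ((LINT t|?M. g t) - (LINT t|leb s. g t)))"
    by (intro Bochner_Integration.integral_cong) (auto simp: in_t)
  finally have L1: "?L1 = (LINT s|?M. f s * ((LINT t|?M. g t) - (LINT t|leb s. g t)))" .
  have "integrable ?M (\<lambda>s. (LINT t|?M. (if s \<le> t then f s * g t else 0)))"
    using P.integrable_fst[OF F] .
  then have "integrable ?M (\<lambda>s. f s * ((LINT t|?M. g t) - (LINT t|leb s. g t)))"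
    by (rule Bochner_Integration.integrable_cong[THEN iffD1, rotated 2]) (auto simp: in_t)
  note i1 = this
  have i2: "integrable ?M (\<lambda>s. f s * (LINT t|?M. g t))" using f by simp
  have "integrable ?M (\<lambda>s. f s * (LINT t|leb s. g t))"
    using Bochner_Integration.integrable_diff[OF i2 i1] by (simp add: algebra_simps)
  note i3 = this
  have "?L1 + ?L2 = (LINT s|?M. f s * ((LINT t|?M. g t) - (LINT t|leb s. g t)) + f s * (LINT t|leb s. g t))"
    unfolding L1 using i1 i3 by simp
  also have "\<dots> = (LINT s|?M. f s * (LINT t|?M. g t))"
    by (simp add: algebra_simps)
  finally show "?L1 + ?L2 = (LINT t|?M. f t) * (LINT t|?M. g t)" by simp
  have "integrable ?M (\<lambda>t. (LINT s|?M. (if s \<le> t then f s * g t else 0)))"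
    using P.integrable_snd[OF F] .
  then show "integrable ?M (\<lambda>t. (LINT s|leb t. f s) * g t)"
    by (rule Bochner_Integration.integrable_cong[THEN iffD1, rotated 2]) (auto simp: in_s)
qed

text \<open>
  A substitute for the chain rule \<open>F F' = (F\<^sup>2/2)'\<close>; every comparison of solutions below rests on the
  sign of the right-hand side.
\<close>

lemma LINT_primitive_times_self:
  fixes f :: "real \<Rightarrow> real"
  assumes T: "0 \<le> T" and f: "integrable (leb T) f"
  shows "(LINT t|leb T. (LINT s|leb t. f s) * f t)
       = (LINT t|leb T. f t)\<^sup>2 / 2"
  using integration_by_parts_Icc(1)[OF T f f] by (simp add: power2_eq_square mult.commute)

text \<open>
  Lebesgue measure on the plane is only the completion of the product measure.  Fubini's theorem is
  therefore applied to a Borel function that agrees with \<open>F\<close> almost everywhere.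
\<close>

lemma fubini_rectangle:
  fixes F :: "real \<Rightarrow> real \<Rightarrow> real"
  assumes F: "(\<lambda>(t, u). F t u) \<in> borel_measurable (lebesgue_on ({a..b} \<times> {c..d}))"
    and bnd: "\<And>t u. t \<in> {a..b} \<Longrightarrow> u \<in> {c..d} \<Longrightarrow> \<bar>F t u\<bar> \<le> B"
  shows "(\<lambda>t. LINT u|lebesgue_on {c..d}. F t u) \<in> borel_measurable (lebesgue_on {a..b})"
    and "(LINT (t, u)|lebesgue_on ({a..b} \<times> {c..d}). F t u)
       = (LINT t|lebesgue_on {a..b}. LINT u|lebesgue_on {c..d}. F t u)"
proof -
  let ?R = "{a..b} \<times> {c..d}"
  have R: "?R \<in> sets lebesgue"
    by (simp add: lborel.sigma_finite_countable borel_closed closed_Times)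
  have Rc: "?R = cbox (a, c) (b, d)" by (auto simp: cbox_Pair_eq)
  define F0 where "F0 = (\<lambda>p. if p \<in> ?R then (case p of (t, u) \<Rightarrow> F t u) else 0)"
  have F0: "F0 \<in> borel_measurable lebesgue"
    unfolding F0_def using F R by (subst borel_measurable_if) auto
  obtain F1 where F1: "F1 \<in> borel_measurable lborel" and eq: "AE p in lborel. F0 p = F1 p"
    using completion_ex_borel_measurable_real[OF F0] by auto
  have F1': "F1 \<in> borel_measurable (lborel \<Otimes>\<^sub>M lborel)"
    using F1 by (simp add: lborel_prod)
  have eq': "AE p in lborel \<Otimes>\<^sub>M lborel. F0 p = F1 p"
    using eq unfolding lborel_prod .
  have eqx: "AE t in lborel. AE u in lborel. F0 (t, u) = F1 (t, u)"
    using lborel_pair.AE_pair[OF eq'] .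
  have F0bnd: "\<bar>F0 p\<bar> \<le> \<bar>B\<bar> * indicator ?R p" for p
    using bnd by (force simp: F0_def indicator_def split: prod.splits)
  have intF0: "integrable lebesgue F0"
  proof (rule Bochner_Integration.integrable_bound)
    show "integrable lebesgue (\<lambda>p. \<bar>B\<bar> * indicator ?R p)"
      unfolding Rc by (intro integrable_mult_right lmeasurable_iff_integrable[THEN iffD1]) auto
  qed (use F0 F0bnd in auto)
  have intF1: "integrable lborel F1"
  proof -
    have "integrable lebesgue F1"
      using F1 F0 eq intF0
      by (subst integrable_cong_AE[where g = F0]) (auto intro: measurable_completion AE_completion elim: eventually_mono)
    then show ?thesis using F1 by (simp add: integrable_completion)
  qed
  have intF1': "integrable (lborel \<Otimes>\<^sub>M lborel) F1"
    using intF1 by (simp add: lborel_prod)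
  have inner: "AE t in lebesgue. (if t \<in> {a..b} then (LINT u|lebesgue_on {c..d}. F t u) else 0) = (LINT u|lborel. F1 (t, u))"
  proof (rule AE_completion, use eqx in eventually_elim)
    case (elim t)
    have m: "(\<lambda>u. F1 (t, u)) \<in> borel_measurable lborel"
      using F1' by measurable
    have ae: "AE u in lebesgue. F1 (t, u) = F0 (t, u)"
      using AE_completion[OF elim] by (auto elim: eventually_mono)
    have m1: "(\<lambda>u. F1 (t, u)) \<in> borel_measurable lebesgue"
      using m by (rule measurable_completion)
    have "(LINT u|lborel. F1 (t, u)) = (LINT u|lebesgue. F1 (t, u))"
      using m by (simp add: integral_completion)
    also have "\<dots> = (LINT u|lebesgue. F0 (t, u))"
      by (rule integral_cong_AE[OF m1 borel_measurable_AE[OF m1 ae] ae])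
    also have "\<dots> = (if t \<in> {a..b} then (LINT u|lebesgue. (if u \<in> {c..d} then F t u else 0)) else 0)"
      by (auto simp: F0_def)
    also have "(LINT u|lebesgue. (if u \<in> {c..d} then F t u else 0)) = (LINT u|lebesgue_on {c..d}. F t u)"
      by (rule Lebesgue_Measure.integral_restrict_UNIV) simp
    finally show ?case by simp
  qed
  have m2: "(\<lambda>t. LINT u|lborel. F1 (t, u)) \<in> borel_measurable lborel"
    using F1' by measurable
  have m3: "(\<lambda>t. if t \<in> {a..b} then (LINT u|lebesgue_on {c..d}. F t u) else 0) \<in> borel_measurable lebesgue"
    by (rule borel_measurable_AE[OF measurable_completion[OF m2]]) (use inner in \<open>auto elim: eventually_mono\<close>)
  then show "(\<lambda>t. LINT u|lebesgue_on {c..d}. F t u) \<in> borel_measurable (lebesgue_on {a..b})"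
    by (rule borel_measurable_if_D)
  have "(LINT (t, u)|lebesgue_on ?R. F t u) = (LINT p|lebesgue. F0 p)"
    unfolding F0_def by (rule Lebesgue_Measure.integral_restrict_UNIV[OF R, symmetric])
  also have "\<dots> = (LINT p|lebesgue. F1 p)"
    using F0 F1 eq by (intro integral_cong_AE) (auto intro: measurable_completion AE_completion)
  also have "\<dots> = integral\<^sup>L (lborel \<Otimes>\<^sub>M lborel) F1"
    using F1 by (simp add: integral_completion lborel_prod)
  also have "\<dots> = (LINT t|lborel. LINT u|lborel. F1 (t, u))"
    using lborel_pair.integral_fst'[OF intF1'] by simp
  also have "\<dots> = (LINT t|lebesgue. LINT u|lborel. F1 (t, u))"
    using m2 by (simp add: integral_completion)
  also have "\<dots> = (LINT t|lebesgue. (if t \<in> {a..b} then (LINT u|lebesgue_on {c..d}. F t u) else 0))"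
    using m3 measurable_completion[OF m2] inner by (intro integral_cong_AE) (auto elim: eventually_mono)
  also have "\<dots> = (LINT t|lebesgue_on {a..b}. LINT u|lebesgue_on {c..d}. F t u)"
    by (rule Lebesgue_Measure.integral_restrict_UNIV) simp
  finally show "(LINT (t, u)|lebesgue_on ?R. F t u)
       = (LINT t|lebesgue_on {a..b}. LINT u|lebesgue_on {c..d}. F t u)" .
qed

text \<open>
  Measurability in the Henstock-Kurzweil sense provides continuous approximations; clipping them at
  \<open>\<plusminus>B\<close> makes bounded convergence available.
\<close>

lemma bounded_measurable_approx_continuous:
  fixes f :: "real \<Rightarrow> real"
  assumes f: "f \<in> borel_measurable (lebesgue_on {a..b})"
    and B: "\<And>x. x \<in> {a..b} \<Longrightarrow> \<bar>f x\<bar> \<le> B" "0 \<le> B"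
  obtains g where "\<And>n::nat. continuous_on UNIV (g n)" "\<And>n x. \<bar>g n x\<bar> \<le> B"
    "AE x in lebesgue_on {a..b}. (\<lambda>n. g n x) \<longlonglongrightarrow> f x"
proof -
  have "f measurable_on {a..b}"
    using f by (simp add: measurable_on_iff_borel_measurable)
  then obtain N g where N: "negligible N" and g: "\<And>n. continuous_on UNIV (g n)"
    and lim: "\<And>x. x \<notin> N \<Longrightarrow> (\<lambda>n. g n x) \<longlonglongrightarrow> (if x \<in> {a..b} then f x else 0)"
    unfolding measurable_on_def by blast
  define h where "h = (\<lambda>n x. max (- B) (min B (g n x)))"
  have "AE x in lebesgue. x \<notin> N"
    using N by (simp add: negligible_iff_null_sets AE_not_in)
  then have "AE x in lebesgue_on {a..b}. x \<notin> N"
    by (auto simp: AE_restrict_space_iff)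
  then have lim': "AE x in lebesgue_on {a..b}. (\<lambda>n. h n x) \<longlonglongrightarrow> f x"
  proof (rule lebesgue_on_mono)
    fix x assume x: "x \<notin> N" "x \<in> {a..b}"
    have "(\<lambda>n. h n x) \<longlonglongrightarrow> max (- B) (min B (f x))"
      unfolding h_def using lim[OF x(1)] x(2) by (intro tendsto_intros) auto
    moreover have "max (- B) (min B (f x)) = f x"
      using B(1)[OF x(2)] by auto
    ultimately show "(\<lambda>n. h n x) \<longlonglongrightarrow> f x" by simp
  qed
  show ?thesis
    by (rule that[of h, OF _ _ lim'])
       (use B(2) g in \<open>auto simp: h_def intro!: continuous_intros\<close>)
qed

section \<open>Fejer means of cosine and sine series\<close>

text \<open>
  The Fejer kernel, written so that its sign is manifest.
\<close>

definition fejer :: "nat \<Rightarrow> real \<Rightarrow> real" where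
  "fejer N \<theta> = (cmod (\<Sum>j<N. cis (real j * \<theta>)))\<^sup>2 / real N"

text \<open>
  The frequencies \<open>k\<close> and \<open>-k\<close> are merged into one cosine, whence the factor 2 for \<open>k > 0\<close>.
\<close>

definition fejer_coeff :: "nat \<Rightarrow> nat \<Rightarrow> real" where
  "fejer_coeff N k = (if k = 0 then 1 else 2 * (1 - real k / real N))"

lemma fejer_coeff_nonneg: "k < N \<Longrightarrow> 0 \<le> fejer_coeff N k"
  by (auto simp: fejer_coeff_def field_simps)

lemma fejer_coeff_le_2: "fejer_coeff N k \<le> 2"
  by (simp add: fejer_coeff_def)

text \<open>
  Multiplying the new term \<open>j = N\<close> by the conjugates of the old ones adds
  \<open>1 + 2 (cos \<theta> + \<dots> + cos (N \<theta>))\<close> to the square of the modulus.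
\<close>

lemma cmod_geometric_cis_eq:
  "(cmod (\<Sum>j<N. cis (real j * \<theta>)))\<^sup>2
     = (\<Sum>k\<le>N. (if k = 0 then real N else 2 * (real N - real k)) * cos (real k * \<theta>))"
proof (induction N)
  case 0
  then show ?case by simp
next
  case (Suc N)
  let ?S = "\<Sum>j<N. cis (real j * \<theta>)"
  have "Re (?S * cnj (cis (real N * \<theta>))) = (\<Sum>j<N. cos (real N * \<theta> - real j * \<theta>))"
    unfolding sum_distrib_right Re_sum by (simp add: cos_diff mult.commute)
  also have "\<dots> = (\<Sum>j<N. cos (real (N - j) * \<theta>))"
    by (intro sum.cong) (auto simp: of_nat_diff algebra_simps)
  also have "\<dots> = (\<Sum>k\<in>{1..N}. cos (real k * \<theta>))"
    by (rule sum.reindex_bij_witness[of _ "\<lambda>k. N - k" "\<lambda>j. N - j"]) auto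
  finally have R: "Re (?S * cnj (cis (real N * \<theta>))) = (\<Sum>k\<in>{1..N}. cos (real k * \<theta>))" .
  have sq: "(cmod (a + b))\<^sup>2 = (cmod a)\<^sup>2 + (cmod b)\<^sup>2 + 2 * Re (a * cnj b)" for a b
    unfolding cmod_power2 by (simp add: power2_eq_square algebra_simps)
  have "(cmod (?S + cis (real N * \<theta>)))\<^sup>2 = (cmod ?S)\<^sup>2 + 1 + 2 * Re (?S * cnj (cis (real N * \<theta>)))"
    unfolding sq by simp
  also have "\<dots> = (\<Sum>k\<le>N. (if k = 0 then real N else 2 * (real N - real k)) * cos (real k * \<theta>))
      + (\<Sum>k\<le>N. (if k = 0 then 1 else 2) * cos (real k * \<theta>))"
  proof -
    have "{..N} = insert 0 {1..N}" by auto
    then have "(\<Sum>k\<le>N. (if k = 0 then 1 else 2) * cos (real k * \<theta>))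
        = 1 + 2 * (\<Sum>k\<in>{1..N}. cos (real k * \<theta>))"
      by (simp add: sum_distrib_left)
    then show ?thesis using Suc.IH R by simp
  qed
  also have "\<dots> = (\<Sum>k\<le>N. (if k = 0 then real (Suc N) else 2 * (real (Suc N) - real k)) * cos (real k * \<theta>))"
    unfolding sum.distrib[symmetric] by (intro sum.cong) (auto simp: algebra_simps)
  finally show ?case by simp
qed

lemma fejer_eq_sum_cos:
  assumes "0 < N"
  shows "fejer N \<theta> = (\<Sum>k<N. fejer_coeff N k * cos (real k * \<theta>))"
proof -
  have "fejer N \<theta> = (\<Sum>k\<le>N. ((if k = 0 then real N else 2 * (real N - real k)) * cos (real k * \<theta>)) / real N)"
    by (simp add: fejer_def cmod_geometric_cis_eq sum_divide_distrib)
  also have "\<dots> = (\<Sum>k\<le>N. fejer_coeff N k * cos (real k * \<theta>))"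
    using assms by (intro sum.cong) (auto simp: fejer_coeff_def field_simps)
  also have "\<dots> = (\<Sum>k<N. fejer_coeff N k * cos (real k * \<theta>))"
    using assms by (simp add: lessThan_Suc_atMost[symmetric] fejer_coeff_def)
  finally show ?thesis .
qed

lemma fejer_nonneg: "0 \<le> fejer N \<theta>"
  by (simp add: fejer_def)

lemma fejer_minus: "fejer N (- \<theta>) = fejer N \<theta>"
  by (cases "N = 0") (simp_all add: fejer_eq_sum_cos, simp add: fejer_def)

text \<open>
  The geometric sum times \<open>1 - cis \<theta>\<close> is \<open>1 - cis (N \<theta>)\<close>, whose modulus is at most 2.
\<close>

lemma fejer_le:
  assumes N: "0 < N" and \<theta>: "cos \<theta> < 1"
  shows "fejer N \<theta> \<le> 2 / (real N * (1 - cos \<theta>))"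
proof -
  let ?z = "cis \<theta>"
  have d: "(cmod (1 - cis x))\<^sup>2 = 2 - 2 * cos x" for x
    using sin_cos_squared_add[of x] by (simp add: cmod_def power2_eq_square algebra_simps)
  have "(\<Sum>j<N. cis (real j * \<theta>)) = (\<Sum>j<N. ?z ^ j)"
    by (intro sum.cong) (auto simp: Complex.DeMoivre)
  then have "(1 - ?z) * (\<Sum>j<N. cis (real j * \<theta>)) = 1 - ?z ^ N"
    by (simp only: one_diff_power_eq)
  also have "\<dots> = 1 - cis (real N * \<theta>)"
    by (simp only: Complex.DeMoivre)
  finally have "(1 - ?z) * (\<Sum>j<N. cis (real j * \<theta>)) = 1 - cis (real N * \<theta>)" .
  then have "(cmod (1 - ?z))\<^sup>2 * (cmod (\<Sum>j<N. cis (real j * \<theta>)))\<^sup>2 = (cmod (1 - cis (real N * \<theta>)))\<^sup>2"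
    by (metis norm_mult power_mult_distrib)
  then have "(2 - 2 * cos \<theta>) * (cmod (\<Sum>j<N. cis (real j * \<theta>)))\<^sup>2 = 2 - 2 * cos (real N * \<theta>)"
    by (simp add: d)
  also have "\<dots> \<le> 4"
    using cos_ge_minus_one[of "real N * \<theta>"] by linarith
  finally have "(cmod (\<Sum>j<N. cis (real j * \<theta>)))\<^sup>2 * (1 - cos \<theta>) \<le> 2"
    by (simp add: algebra_simps)
  then have "(cmod (\<Sum>j<N. cis (real j * \<theta>)))\<^sup>2 \<le> 2 / (1 - cos \<theta>)"
    using \<theta> by (simp add: pos_le_divide_eq)
  then have "fejer N \<theta> \<le> 2 / (1 - cos \<theta>) / real N"
    unfolding fejer_def by (rule divide_right_mono) simp
  then show ?thesis by (simp add: mult.commute)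
qed

lemma fejer_le_away:
  assumes N: "0 < N" and d: "0 < d" "d \<le> 1" and x: "d \<le> x" "x \<le> 2 - d"
  shows "fejer N (pi * x) \<le> 2 / (real N * (1 - cos (pi * d)))"
proof -
  have cd: "cos (pi * d) < 1"
    using cos_monotone_0_pi[of 0 "pi * d"] d by simp
  have "cos (pi * x) \<le> cos (pi * d)"
  proof (cases "x \<le> 1")
    case True
    then show ?thesis using d x by (intro cos_monotone_0_pi_le) auto
  next
    case False
    have "cos (pi * x) = cos (2 * pi - pi * x)" by (simp add: cos_diff)
    also have "\<dots> = cos (pi * (2 - x))" by (simp add: algebra_simps)
    also have "\<dots> \<le> cos (pi * d)"
      using d x False by (intro cos_monotone_0_pi_le) auto
    finally show ?thesis .
  qed
  then have "2 / (real N * (1 - cos (pi * x))) \<le> 2 / (real N * (1 - cos (pi * d)))"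
    using N cd by (intro divide_left_mono mult_left_mono mult_pos_pos) auto
  moreover have "fejer N (pi * x) \<le> 2 / (real N * (1 - cos (pi * x)))"
    using N \<open>cos (pi * x) \<le> cos (pi * d)\<close> cd by (intro fejer_le) auto
  ultimately show ?thesis by simp
qed

definition cos_coeff :: "nat \<Rightarrow> (real \<Rightarrow> real) \<Rightarrow> real" where
  "cos_coeff k f = L2_inner f (\<lambda>u. cos (real k * pi * u))"

definition sin_coeff :: "nat \<Rightarrow> (real \<Rightarrow> real) \<Rightarrow> real" where
  "sin_coeff k f = L2_inner f (\<lambda>u. sin (real k * pi * u))"

definition cos_mean :: "nat \<Rightarrow> (real \<Rightarrow> real) \<Rightarrow> real \<Rightarrow> real" where
  "cos_mean N f u = (\<Sum>k<N. fejer_coeff N k * cos_coeff k f * cos (real k * pi * u))"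

definition sin_mean :: "nat \<Rightarrow> (real \<Rightarrow> real) \<Rightarrow> real \<Rightarrow> real" where
  "sin_mean N f u = (\<Sum>k<N. fejer_coeff N k * sin_coeff k f * sin (real k * pi * u))"

text \<open>
  The integral kernels of \<open>cos_mean\<close> and \<open>sin_mean\<close>: the Fejer kernel of period 2, folded onto \<open>[0,1]\<close> by
  even and by odd reflection.
\<close>

definition cos_kernel :: "nat \<Rightarrow> real \<Rightarrow> real \<Rightarrow> real" where
  "cos_kernel N u y = (fejer N (pi * (u - y)) + fejer N (pi * (u + y))) / 2"

definition sin_kernel :: "nat \<Rightarrow> real \<Rightarrow> real \<Rightarrow> real" where
  "sin_kernel N u y = (fejer N (pi * (u - y)) - fejer N (pi * (u + y))) / 2"

lemma cos_kernel_eq: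
  "0 < N \<Longrightarrow> cos_kernel N u y = (\<Sum>k<N. fejer_coeff N k * cos (real k * pi * u) * cos (real k * pi * y))"
  unfolding cos_kernel_def
  by (simp add: fejer_eq_sum_cos sum.distrib[symmetric] sum_divide_distrib)
     (intro sum.cong, simp_all add: distrib_left right_diff_distrib cos_add cos_diff mult_ac)

lemma sin_kernel_eq:
  "0 < N \<Longrightarrow> sin_kernel N u y = (\<Sum>k<N. fejer_coeff N k * sin (real k * pi * u) * sin (real k * pi * y))"
  unfolding sin_kernel_def
  by (simp add: fejer_eq_sum_cos sum_subtractf[symmetric] sum_divide_distrib)
     (intro sum.cong, simp_all add: distrib_left right_diff_distrib cos_add cos_diff mult_ac)

lemma cos_kernel_nonneg: "0 \<le> cos_kernel N u y"
  by (simp add: cos_kernel_def fejer_nonneg)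

lemma abs_sin_kernel_le: "\<bar>sin_kernel N u y\<bar> \<le> cos_kernel N u y"
  using fejer_nonneg[of N "pi * (u - y)"] fejer_nonneg[of N "pi * (u + y)"]
  by (simp add: sin_kernel_def cos_kernel_def)

text \<open>
  Folding does no harm: for \<open>u, y \<in> [0,1]\<close> both \<open>u + y\<close> and \<open>2 - (u + y)\<close> are at least \<open>\<bar>u - y\<bar>\<close>, so the
  reflected argument is as far from the even integers as the direct one.
\<close>

lemma cos_kernel_le_away:
  assumes N: "0 < N" and d: "0 < d" "d \<le> 1" and u: "u \<in> {0..1}" and y: "y \<in> {0..1}" and uy: "d \<le> \<bar>u - y\<bar>"
  shows "cos_kernel N u y \<le> 2 / (real N * (1 - cos (pi * d)))"
proof -
  have "fejer N (pi * (u - y)) = fejer N (pi * \<bar>u - y\<bar>)"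
    using fejer_minus[of N "pi * (u - y)"] by (cases "u \<ge> y") (auto simp: algebra_simps)
  moreover have "fejer N (pi * \<bar>u - y\<bar>) \<le> 2 / (real N * (1 - cos (pi * d)))"
    using assms by (intro fejer_le_away) auto
  moreover have "fejer N (pi * (u + y)) \<le> 2 / (real N * (1 - cos (pi * d)))"
    using assms by (intro fejer_le_away) auto
  ultimately show ?thesis by (simp add: cos_kernel_def)
qed

lemma LINT_cos: "(LINT u|leb 1. cos (real k * pi * u)) = (if k = 0 then 1 else 0)"
proof (cases "k = 0")
  case True
  then show ?thesis using LINT_const_Icc[of 0 1 1] by simp
next
  case False
  then have "(LINT u|leb 1. cos (real k * pi * u))
      = sin (real k * pi * 1) / (real k * pi) - sin (real k * pi * 0) / (real k * pi)"
    by (intro LINT_FTC_Icc) (auto intro!: derivative_eq_intros continuous_intros)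
  then show ?thesis using False by simp
qed

lemma mean_eq_LINT_kernel:
  assumes f: "f \<in> borel_measurable (leb 1)" "AE u in leb 1. \<bar>f u\<bar> \<le> B" and N: "0 < N"
  shows "cos_mean N f u = (LINT y|leb 1. cos_kernel N u y * f y)"
    and "sin_mean N f u = (LINT y|leb 1. sin_kernel N u y * f y)"
proof -
  have i: "integrable (leb 1) (\<lambda>y. f y * cos (real k * pi * y))"
          "integrable (leb 1) (\<lambda>y. f y * sin (real k * pi * y))" for k
    by (intro integrable_bounded_times_continuous[OF f] continuous_intros)+
  have "(LINT y|leb 1. cos_kernel N u y * f y)
      = (LINT y|leb 1. (\<Sum>k<N. fejer_coeff N k * cos (real k * pi * u) * (f y * cos (real k * pi * y))))"
    by (simp add: cos_kernel_eq[OF N] sum_distrib_right sum_distrib_left mult_ac)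
  also have "\<dots> = (\<Sum>k<N. fejer_coeff N k * cos (real k * pi * u) * (LINT y|leb 1. f y * cos (real k * pi * y)))"
    using i by (subst Bochner_Integration.integral_sum) auto
  finally show "cos_mean N f u = (LINT y|leb 1. cos_kernel N u y * f y)"
    by (simp add: cos_mean_def cos_coeff_def L2_inner_def mult_ac)
  have "(LINT y|leb 1. sin_kernel N u y * f y)
      = (LINT y|leb 1. (\<Sum>k<N. fejer_coeff N k * sin (real k * pi * u) * (f y * sin (real k * pi * y))))"
    by (simp add: sin_kernel_eq[OF N] sum_distrib_right sum_distrib_left mult_ac)
  also have "\<dots> = (\<Sum>k<N. fejer_coeff N k * sin (real k * pi * u) * (LINT y|leb 1. f y * sin (real k * pi * y)))"
    using i by (subst Bochner_Integration.integral_sum) auto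
  finally show "sin_mean N f u = (LINT y|leb 1. sin_kernel N u y * f y)"
    by (simp add: sin_mean_def sin_coeff_def L2_inner_def mult_ac)
qed

lemma continuous_fejer [continuous_intros]:
  "continuous_on S h \<Longrightarrow> continuous_on S (\<lambda>x. fejer N (h x))"
  unfolding fejer_def by (cases "N = 0") (auto intro!: continuous_intros)

lemma continuous_cos_kernel: "continuous_on S (\<lambda>y. cos_kernel N u y)"
  unfolding cos_kernel_def by (intro continuous_intros) auto

lemma continuous_sin_kernel: "continuous_on S (\<lambda>y. sin_kernel N u y)"
  unfolding sin_kernel_def by (intro continuous_intros) auto

lemma LINT_cos_kernel:
  assumes N: "0 < N"
  shows "(LINT y|leb 1. cos_kernel N u y) = 1"
proof -
  have "(LINT y|leb 1. cos_kernel N u y) = cos_mean N (\<lambda>y. 1) u"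
    using mean_eq_LINT_kernel(1)[of "\<lambda>y. 1" 1 N u] N by simp
  also have "\<dots> = (\<Sum>k<N. if k = 0 then 1 else 0)"
    unfolding cos_mean_def cos_coeff_def L2_inner_def
    by (intro sum.cong) (auto simp: LINT_cos fejer_coeff_def)
  also have "\<dots> = 1" using N by simp
  finally show ?thesis .
qed

lemma abs_LINT_kernel_le:
  assumes f: "f \<in> borel_measurable (leb 1)" "AE u in leb 1. \<bar>f u\<bar> \<le> B"
    and N: "0 < N" and K: "continuous_on {0..1} K" "\<And>y. \<bar>K y\<bar> \<le> cos_kernel N u y"
  shows "\<bar>LINT y|leb 1. K y * f y\<bar> \<le> B"
proof -
  have iK: "integrable (leb 1) (\<lambda>y. cos_kernel N u y)"
    by (intro continuous_imp_integrable_real continuous_cos_kernel)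
  have i: "integrable (leb 1) (\<lambda>y. K y * f y)"
    using integrable_bounded_times_continuous[OF f K(1)] by (simp add: mult.commute)
  have "\<bar>LINT y|leb 1. K y * f y\<bar> \<le> (LINT y|leb 1. \<bar>K y * f y\<bar>)"
    by (rule integral_abs_bound)
  also have "\<dots> \<le> (LINT y|leb 1. cos_kernel N u y * B)"
  proof (rule integral_mono_AE)
    show "AE y in leb 1. \<bar>K y * f y\<bar> \<le> cos_kernel N u y * B"
      using f(2) by eventually_elim (auto simp: abs_mult intro!: mult_mono K(2) cos_kernel_nonneg)
  qed (use i iK in auto)
  also have "\<dots> = B" by (simp add: LINT_cos_kernel[OF N])
  finally show ?thesis .
qed

lemma abs_mean_le:
  assumes f: "f \<in> borel_measurable (leb 1)" "AE u in leb 1. \<bar>f u\<bar> \<le> B" and B: "0 \<le> B"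
  shows "\<bar>cos_mean N f u\<bar> \<le> B" "\<bar>sin_mean N f u\<bar> \<le> B"
proof -
  show "\<bar>cos_mean N f u\<bar> \<le> B"
  proof (cases "N = 0")
    case False
    then show ?thesis
      using abs_LINT_kernel_le[OF f, of N "cos_kernel N u" u] cos_kernel_nonneg[of N u]
      by (simp add: mean_eq_LINT_kernel[OF f] continuous_cos_kernel)
  qed (use B in \<open>simp add: cos_mean_def\<close>)
  show "\<bar>sin_mean N f u\<bar> \<le> B"
  proof (cases "N = 0")
    case False
    then show ?thesis
      using abs_LINT_kernel_le[OF f, of N "sin_kernel N u" u] abs_sin_kernel_le[of N u]
      by (simp add: mean_eq_LINT_kernel[OF f] continuous_sin_kernel)
  qed (use B in \<open>simp add: sin_mean_def\<close>)
qed

text \<open>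
  The kernel is an approximate identity on all of \<open>[0,1]\<close>.  Convergence at the end points, where the
  even reflection is continuous, is what gives access to boundary values.
\<close>

lemma cos_mean_tendsto:
  assumes f: "continuous_on {0..1} f" and u: "u \<in> {0..1}"
  shows "(\<lambda>N. cos_mean N f u) \<longlonglongrightarrow> f u"
proof (rule LIMSEQ_I)
  fix r :: real assume r: "0 < r"
  obtain B where B: "\<And>y. y \<in> {0..1} \<Longrightarrow> \<bar>f y\<bar> \<le> B"
    using continuous_on_Icc_bounded[OF f] by blast
  have B0: "0 \<le> B" using B[of 0] by auto
  have fm: "f \<in> borel_measurable (leb 1)"
    using f by (rule continuous_imp_measurable_on_sets_lebesgue) simp
  have fB: "AE y in leb 1. \<bar>f y\<bar> \<le> B"
    by (rule AE_I2) (use B in auto)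
  obtain d0 where d0: "0 < d0" "\<And>y. y \<in> {0..1} \<Longrightarrow> dist y u < d0 \<Longrightarrow> dist (f y) (f u) < r / 2"
    using f u r unfolding continuous_on_iff by (metis half_gt_zero)
  define d where "d = min d0 1"
  have d: "0 < d" "d \<le> 1" "d \<le> d0" using d0 by (auto simp: d_def)
  have cd: "cos (pi * d) < 1"
    using cos_monotone_0_pi[of 0 "pi * d"] d by simp
  let ?c = "2 / (1 - cos (pi * d))"
  have cpos: "?c > 0" using cd by simp
  \<comment> \<open>The factor \<open>2 B\<close> bounds the oscillation of \<open>f\<close>; the part of the kernel outside \<open>(u - d, u + d)\<close> is
    below \<open>c / N\<close>.\<close>
  obtain n0 :: nat where n0: "real n0 > 2 * B * ?c / (r / 2)" using reals_Archimedean2 by blast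
  show "\<exists>no. \<forall>n\<ge>no. norm (cos_mean n f u - f u) < r"
  proof (intro exI[of _ "Suc n0"] allI impI)
    fix N assume "Suc n0 \<le> N"
    then have N: "0 < N" and Nn: "real N > real n0" by auto
    have iK: "integrable (leb 1) (\<lambda>y. cos_kernel N u y)"
      by (intro continuous_imp_integrable_real continuous_cos_kernel)
    have iKf: "integrable (leb 1) (\<lambda>y. cos_kernel N u y * f y)"
      using integrable_bounded_times_continuous[OF fm fB continuous_cos_kernel] by (simp add: mult.commute)
    have "cos_mean N f u - f u = (LINT y|leb 1. cos_kernel N u y * f y) - (LINT y|leb 1. cos_kernel N u y * f u)"
      using LINT_cos_kernel[OF N] by (simp add: mean_eq_LINT_kernel[OF fm fB N])
    also have "\<dots> = (LINT y|leb 1. cos_kernel N u y * (f y - f u))"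
      using iK iKf by (simp add: algebra_simps)
    finally have "\<bar>cos_mean N f u - f u\<bar> \<le> (LINT y|leb 1. \<bar>cos_kernel N u y * (f y - f u)\<bar>)"
      using integral_abs_bound by metis
    also have "\<dots> \<le> (LINT y|leb 1. cos_kernel N u y * (r / 2) + ?c / real N * (2 * B))"
    proof (rule Bochner_Integration.integral_mono)
      show "integrable (leb 1) (\<lambda>y. \<bar>cos_kernel N u y * (f y - f u)\<bar>)"
        using Bochner_Integration.integrable_diff[OF iKf Bochner_Integration.integrable_mult_left[OF iK, of "f u"]]
        by (intro integrable_abs) (simp add: algebra_simps)
      show "integrable (leb 1) (\<lambda>y. cos_kernel N u y * (r / 2) + ?c / real N * (2 * B))"
        using iK by (intro continuous_imp_integrable_real continuous_intros continuous_cos_kernel)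
      fix y :: real assume "y \<in> space (leb 1)"
      then have y: "y \<in> {0..1}" by simp
      have k0: "0 \<le> cos_kernel N u y" by (rule cos_kernel_nonneg)
      have c0: "0 \<le> ?c / real N * (2 * B)" using cpos B0 by simp
      show "\<bar>cos_kernel N u y * (f y - f u)\<bar> \<le> cos_kernel N u y * (r / 2) + ?c / real N * (2 * B)"
      proof (cases "\<bar>u - y\<bar> < d")
        case True
        then have "\<bar>f y - f u\<bar> \<le> r / 2"
          using d0(2)[OF y] d by (force simp: dist_real_def abs_minus_commute)
        then have "\<bar>cos_kernel N u y * (f y - f u)\<bar> \<le> cos_kernel N u y * (r / 2)"
          using mult_left_mono[OF _ k0] k0 by (simp only: abs_mult abs_of_nonneg)
        then show ?thesis using c0 by linarith
      next
        case False
        then have "cos_kernel N u y \<le> 2 / (real N * (1 - cos (pi * d)))"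
          using cos_kernel_le_away[OF N d(1,2) u y] by auto
        also have "\<dots> = ?c / real N" by simp
        finally have "cos_kernel N u y \<le> ?c / real N" .
        moreover have "\<bar>f y - f u\<bar> \<le> 2 * B" using B[OF y] B[OF u] by linarith
        ultimately have "\<bar>cos_kernel N u y * (f y - f u)\<bar> \<le> ?c / real N * (2 * B)"
          using k0 unfolding abs_mult by (intro mult_mono) auto
        then show ?thesis using k0 r by (smt (verit) mult_nonneg_nonneg half_gt_zero)
      qed
    qed
    also have "\<dots> = r / 2 + ?c / real N * (2 * B)"
    proof -
      have "(LINT y|leb 1. cos_kernel N u y * (r / 2) + ?c / real N * (2 * B))
          = (LINT y|leb 1. cos_kernel N u y * (r / 2)) + (LINT y|leb 1. ?c / real N * (2 * B))"
        using iK by (intro Bochner_Integration.integral_add integrable_mult_left continuous_imp_integrable_real)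
          (auto intro: continuous_cos_kernel)
      then show ?thesis
        unfolding LINT_const_Icc[OF zero_le_one] by (simp add: LINT_cos_kernel[OF N])
    qed
    also have "\<dots> < r"
    proof -
      have "2 * B * ?c / (r / 2) < real N" using n0 Nn by linarith
      then have "2 * B * ?c < real N * (r / 2)"
        using r by (simp only: pos_divide_less_eq half_gt_zero)
      then have "2 * B * ?c / real N < r / 2"
        using N by (simp only: pos_divide_less_eq of_nat_0_less_iff mult.commute)
      then have "?c / real N * (2 * B) < r / 2" by (simp add: mult_ac)
      then show ?thesis by linarith
    qed
    finally show "norm (cos_mean N f u - f u) < r" by simp
  qed
qed

text \<open>
  At an interior point the sine mean differs from the cosine mean by an integral against
  \<open>fejer N (\<pi> (u + y))\<close>, and \<open>u + y\<close> stays away from the even integers.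
\<close>

lemma sin_mean_tendsto:
  assumes f: "continuous_on {0..1} f" and u: "u \<in> {0<..<1}"
  shows "(\<lambda>N. sin_mean N f u) \<longlonglongrightarrow> f u"
proof -
  obtain B where B: "\<And>y. y \<in> {0..1} \<Longrightarrow> \<bar>f y\<bar> \<le> B"
    using continuous_on_Icc_bounded[OF f] by blast
  have B0: "0 \<le> B" using B[of 0] by auto
  have fm: "f \<in> borel_measurable (leb 1)"
    using f by (rule continuous_imp_measurable_on_sets_lebesgue) simp
  have fB: "AE y in leb 1. \<bar>f y\<bar> \<le> B"
    by (rule AE_I2) (use B in auto)
  define d where "d = min u (1 - u)"
  have d: "0 < d" "d \<le> 1" using u by (auto simp: d_def)
  let ?c = "2 / (1 - cos (pi * d))"
  have cd: "cos (pi * d) < 1"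
    using cos_monotone_0_pi[of 0 "pi * d"] d by simp
  have bd: "\<bar>cos_mean N f u - sin_mean N f u\<bar> \<le> ?c * B / real N" if N: "0 < N" for N
  proof -
    have iK: "integrable (leb 1) (\<lambda>y. cos_kernel N u y * f y)"
      "integrable (leb 1) (\<lambda>y. sin_kernel N u y * f y)"
      using integrable_bounded_times_continuous[OF fm fB continuous_cos_kernel, of N u]
        integrable_bounded_times_continuous[OF fm fB continuous_sin_kernel, of N u] by (simp_all add: mult.commute)
    have "cos_mean N f u - sin_mean N f u = (LINT y|leb 1. cos_kernel N u y * f y - sin_kernel N u y * f y)"
      using iK by (simp add: mean_eq_LINT_kernel[OF fm fB N])
    also have "\<bar>\<dots>\<bar> \<le> (1 - 0) * (?c / real N * B)"
    proof (rule LINT_abs_le_Icc)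
      show "AE y in leb 1. \<bar>cos_kernel N u y * f y - sin_kernel N u y * f y\<bar> \<le> ?c / real N * B"
      proof (rule AE_I2)
        fix y :: real assume "y \<in> space (leb 1)"
        then have y: "y \<in> {0..1}" by simp
        have "cos_kernel N u y * f y - sin_kernel N u y * f y = fejer N (pi * (u + y)) * f y"
          by (simp add: cos_kernel_def sin_kernel_def field_simps)
        moreover have "fejer N (pi * (u + y)) \<le> 2 / (real N * (1 - cos (pi * d)))"
          using y u d by (intro fejer_le_away N) (auto simp: d_def)
        ultimately show "\<bar>cos_kernel N u y * f y - sin_kernel N u y * f y\<bar> \<le> ?c / real N * B"
          using mult_mono[of "fejer N (pi * (u + y))" "2 / (real N * (1 - cos (pi * d)))" "\<bar>f y\<bar>" B]
            B[OF y] fejer_nonneg[of N "pi * (u + y)"] cd N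
          by (simp add: abs_mult mult.commute)
      qed
    qed (use cd B0 in auto)
    finally show ?thesis by simp
  qed
  have "(\<lambda>N. cos_mean N f u - sin_mean N f u) \<longlonglongrightarrow> 0"
  proof (rule Lim_null_comparison)
    show "\<forall>\<^sub>F N in sequentially. norm (cos_mean N f u - sin_mean N f u) \<le> ?c * B / real N"
      by (rule eventually_mono[OF eventually_gt_at_top[of "0::nat"]]) (use bd in auto)
    show "(\<lambda>N. ?c * B / real N) \<longlonglongrightarrow> 0"
      by (rule lim_const_over_n)
  qed
  from tendsto_diff[OF cos_mean_tendsto[OF f] this, of u]
  show ?thesis using u by simp
qed

lemma LINT_times_mean:
  assumes f: "f \<in> borel_measurable (leb 1)" "AE u in leb 1. \<bar>f u\<bar> \<le> B"
  shows "(LINT u|leb 1. f u * cos_mean N q u)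
       = (\<Sum>k<N. fejer_coeff N k * cos_coeff k f * cos_coeff k q)"
    and "(LINT u|leb 1. f u * sin_mean N q u)
       = (\<Sum>k<N. fejer_coeff N k * sin_coeff k f * sin_coeff k q)"
proof -
  have i: "integrable (leb 1) (\<lambda>y. f y * cos (real k * pi * y))"
          "integrable (leb 1) (\<lambda>y. f y * sin (real k * pi * y))" for k
    by (intro integrable_bounded_times_continuous[OF f] continuous_intros)+
  have "(LINT u|leb 1. f u * cos_mean N q u)
    = (LINT u|leb 1. (\<Sum>k<N. fejer_coeff N k * cos_coeff k q * (f u * cos (real k * pi * u))))"
    by (simp add: cos_mean_def sum_distrib_left mult_ac)
  also have "\<dots> = (\<Sum>k<N. fejer_coeff N k * cos_coeff k q * cos_coeff k f)"
    using i by (subst Bochner_Integration.integral_sum) (auto simp: cos_coeff_def L2_inner_def)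
  finally show "(LINT u|leb 1. f u * cos_mean N q u)
       = (\<Sum>k<N. fejer_coeff N k * cos_coeff k f * cos_coeff k q)" by (simp add: mult_ac)
  have "(LINT u|leb 1. f u * sin_mean N q u)
    = (LINT u|leb 1. (\<Sum>k<N. fejer_coeff N k * sin_coeff k q * (f u * sin (real k * pi * u))))"
    by (simp add: sin_mean_def sum_distrib_left mult_ac)
  also have "\<dots> = (\<Sum>k<N. fejer_coeff N k * sin_coeff k q * sin_coeff k f)"
    using i by (subst Bochner_Integration.integral_sum) (auto simp: sin_coeff_def L2_inner_def)
  finally show "(LINT u|leb 1. f u * sin_mean N q u)
       = (\<Sum>k<N. fejer_coeff N k * sin_coeff k f * sin_coeff k q)" by (simp add: mult_ac)
qed

lemma continuous_cos_mean: "continuous_on S (cos_mean N q)"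
  unfolding cos_mean_def[abs_def] by (intro continuous_intros)

lemma continuous_sin_mean: "continuous_on S (sin_mean N q)"
  unfolding sin_mean_def[abs_def] by (intro continuous_intros)

text \<open>
  Parseval's identity in Cesaro form.  As the weights are nonnegative, upper bounds for single modes
  can be summed.
\<close>

lemma fejer_parseval:
  assumes f: "f \<in> borel_measurable (leb 1)" "AE u in leb 1. \<bar>f u\<bar> \<le> B"
    and q: "continuous_on {0..1} q"
  shows "(\<lambda>N. \<Sum>k<N. fejer_coeff N k * cos_coeff k f * cos_coeff k q) \<longlonglongrightarrow> L2_inner f q"
    and "(\<lambda>N. \<Sum>k<N. fejer_coeff N k * sin_coeff k f * sin_coeff k q) \<longlonglongrightarrow> L2_inner f q"
proof -
  obtain C where C: "\<And>u. u \<in> {0..1} \<Longrightarrow> \<bar>q u\<bar> \<le> C" "0 \<le> C"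
    using continuous_on_Icc_bounded[OF q] by blast
  have qm: "q \<in> borel_measurable (leb 1)" "AE u in leb 1. \<bar>q u\<bar> \<le> C"
    using C by (auto intro!: measurable_continuous_Icc q AE_I2)
  have bd: "AE u in leb 1. \<bar>f u * cos_mean N q u\<bar> \<le> \<bar>B\<bar> * C"
    "AE u in leb 1. \<bar>f u * sin_mean N q u\<bar> \<le> \<bar>B\<bar> * C" for N
    unfolding abs_mult
    by (rule lebesgue_on_mono[OF f(2)], intro mult_mono abs_mean_le[OF qm C(2)]; simp)+
  have "(\<lambda>N. LINT u|leb 1. f u * cos_mean N q u) \<longlonglongrightarrow> (LINT u|leb 1. f u * q u)"
  proof (rule bounded_convergence_Icc[OF _ bd(1)])
    show "(\<lambda>u. f u * cos_mean N q u) \<in> borel_measurable (leb 1)" for N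
      by (intro borel_measurable_times f measurable_continuous_Icc continuous_cos_mean)
    show "AE u in leb 1. (\<lambda>N. f u * cos_mean N q u) \<longlonglongrightarrow> f u * q u"
      by (intro AE_I2 tendsto_mult tendsto_const cos_mean_tendsto q) simp
  qed
  then show "(\<lambda>N. \<Sum>k<N. fejer_coeff N k * cos_coeff k f * cos_coeff k q) \<longlonglongrightarrow> L2_inner f q"
    by (simp only: LINT_times_mean[OF f] L2_inner_def)
  have "AE u in leb 1. u \<in> {0<..<1}"
    by (rule AE_I'[of "{0, 1}"]) (auto simp: null_sets_restrict_space)
  then have lim: "AE u in leb 1. (\<lambda>N. f u * sin_mean N q u) \<longlonglongrightarrow> f u * q u"
    by eventually_elim (intro tendsto_mult tendsto_const sin_mean_tendsto q)
  have "(\<lambda>N. LINT u|leb 1. f u * sin_mean N q u) \<longlonglongrightarrow> (LINT u|leb 1. f u * q u)"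
    by (rule bounded_convergence_Icc[OF _ bd(2) lim])
       (intro borel_measurable_times f measurable_continuous_Icc continuous_sin_mean)
  then show "(\<lambda>N. \<Sum>k<N. fejer_coeff N k * sin_coeff k f * sin_coeff k q) \<longlonglongrightarrow> L2_inner f q"
    by (simp only: LINT_times_mean[OF f] L2_inner_def)
qed

text \<open>
  By \<open>fejer_parseval\<close> the function \<open>f\<close> minus its mean is orthogonal to every continuous function, hence
  to its own continuous approximations and so to itself.
\<close>

lemma AE_const_if_cos_coeff_eq_0:
  assumes f: "f \<in> borel_measurable (leb 1)" "AE u in leb 1. \<bar>f u\<bar> \<le> B"
    and c: "\<And>k. 0 < k \<Longrightarrow> cos_coeff k f = 0"
  shows "AE u in leb 1. f u = cos_coeff 0 f"
proof -
  let ?m = "cos_coeff 0 f"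
  have int: "integrable (leb 1) f" by (rule integrable_bounded_Icc[OF f])
  have ortho: "(LINT u|leb 1. (f u - ?m) * q u) = 0" if q: "continuous_on {0..1} q" for q
  proof -
    have "(\<Sum>k<Suc N. fejer_coeff (Suc N) k * cos_coeff k f * cos_coeff k q) = ?m * cos_coeff 0 q" for N
    proof -
      have "(\<Sum>k<Suc N. fejer_coeff (Suc N) k * cos_coeff k f * cos_coeff k q)
          = (\<Sum>k<Suc N. if k = 0 then ?m * cos_coeff 0 q else 0)"
        using c by (intro sum.cong) (auto simp: fejer_coeff_def)
      then show ?thesis by (simp add: sum.delta del: sum.lessThan_Suc)
    qed
    then have "(\<lambda>N. ?m * cos_coeff 0 q) \<longlonglongrightarrow> L2_inner f q"
      using LIMSEQ_Suc[OF fejer_parseval(1)[OF f q]] by simp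
    then have "L2_inner f q = ?m * cos_coeff 0 q"
      by (intro LIMSEQ_unique[OF _ tendsto_const]) (simp add: LIMSEQ_const_iff)
    then have "(LINT u|leb 1. f u * q u) = (LINT u|leb 1. ?m * q u)"
      by (simp add: L2_inner_def cos_coeff_def)
    moreover have "integrable (leb 1) (\<lambda>u. f u * q u)"
      by (rule integrable_bounded_times_continuous[OF f q])
    moreover have "integrable (leb 1) (\<lambda>u. ?m * q u)"
      using q by (intro continuous_imp_integrable_real continuous_intros)
    ultimately show ?thesis by (simp add: left_diff_distrib)
  qed
  define F where "F u = max (- \<bar>B\<bar>) (min \<bar>B\<bar> (f u)) - ?m" for u
  have F: "F \<in> borel_measurable (leb 1)" "\<And>u. \<bar>F u\<bar> \<le> \<bar>B\<bar> + \<bar>?m\<bar>"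
  proof -
    show "F \<in> borel_measurable (leb 1)"
      unfolding F_def[abs_def]
      by (intro borel_measurable_diff borel_measurable_max borel_measurable_min borel_measurable_const f)
    show "\<bar>F u\<bar> \<le> \<bar>B\<bar> + \<bar>?m\<bar>" for u
      unfolding F_def by linarith
  qed
  have Ff: "AE u in leb 1. F u = f u - ?m"
    using f(2) by eventually_elim (auto simp: F_def)
  obtain g where g: "\<And>n::nat. continuous_on UNIV (g n)" "\<And>n x. \<bar>g n x\<bar> \<le> \<bar>B\<bar> + \<bar>?m\<bar>"
    "AE x in leb 1. (\<lambda>n. g n x) \<longlonglongrightarrow> F x"
    using bounded_measurable_approx_continuous[OF F(1), of "\<bar>B\<bar> + \<bar>?m\<bar>"] F(2) by auto
  have gc: "continuous_on {0..1} (g n)" for n using g(1) continuous_on_subset by blast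
  have "(\<lambda>n. LINT u|leb 1. F u * g n u) \<longlonglongrightarrow> (LINT u|leb 1. F u * F u)"
  proof (rule bounded_convergence_Icc[where B = "(\<bar>B\<bar> + \<bar>?m\<bar>) * (\<bar>B\<bar> + \<bar>?m\<bar>)"])
    show "AE x in leb 1. \<bar>F x * g n x\<bar> \<le> (\<bar>B\<bar> + \<bar>?m\<bar>) * (\<bar>B\<bar> + \<bar>?m\<bar>)" for n
      unfolding abs_mult by (intro AE_I2 mult_mono F(2) g(2)) auto
    show "AE x in leb 1. (\<lambda>n. F x * g n x) \<longlonglongrightarrow> F x * F x"
      using g(3) by eventually_elim (intro tendsto_mult tendsto_const)
    show "(\<lambda>x. F x * g n x) \<in> borel_measurable (leb 1)" for n
      by (intro borel_measurable_times F measurable_continuous_Icc gc)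
  qed
  moreover have "(LINT u|leb 1. F u * g n u) = 0" for n
  proof -
    have "(LINT u|leb 1. F u * g n u) = (LINT u|leb 1. (f u - ?m) * g n u)"
    proof (rule integral_cong_AE)
      show "(\<lambda>u. F u * g n u) \<in> borel_measurable (leb 1)"
        by (intro borel_measurable_times F measurable_continuous_Icc gc)
      show "(\<lambda>u. (f u - ?m) * g n u) \<in> borel_measurable (leb 1)"
        by (intro borel_measurable_times borel_measurable_diff borel_measurable_const f measurable_continuous_Icc gc)
      show "AE u in leb 1. F u * g n u = (f u - ?m) * g n u"
        using Ff by eventually_elim simp
    qed
    then show ?thesis using ortho[OF gc] by simp
  qed
  ultimately have "(LINT u|leb 1. (F u)\<^sup>2) = 0"
    by (simp add: LIMSEQ_const_iff power2_eq_square)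
  moreover have "integrable (leb 1) (\<lambda>u. (F u)\<^sup>2)"
  proof (rule integrable_bounded_Icc[where B = "(\<bar>B\<bar> + \<bar>?m\<bar>) * (\<bar>B\<bar> + \<bar>?m\<bar>)"])
    show "AE u in leb 1. \<bar>(F u)\<^sup>2\<bar> \<le> (\<bar>B\<bar> + \<bar>?m\<bar>) * (\<bar>B\<bar> + \<bar>?m\<bar>)"
      unfolding power2_eq_square abs_mult by (intro AE_I2 mult_mono F(2)) auto
  qed (intro borel_measurable_power F)
  ultimately have "AE u in leb 1. F u = 0"
    by (intro LINT_square_eq_0_imp_AE)
  with Ff show ?thesis by eventually_elim auto
qed

text \<open>
  The negative part of \<open>c\<close> has vanishing cosine coefficients and is the limit of its Fejer means at
  every point of \<open>[0,1]\<close>, end points included.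
\<close>

lemma continuous_AE_ge_imp_ge:
  fixes c :: "real \<Rightarrow> real"
  assumes c: "continuous_on {0..1} c" and ae: "AE u in leb 1. 0 \<le> c u" and u: "u \<in> {0..1}"
  shows "0 \<le> c u"
proof -
  define n where "n x = max 0 (- c x)" for x
  have n: "continuous_on {0..1} n" unfolding n_def[abs_def] using c by (intro continuous_intros)
  have ae0: "AE u in leb 1. n u = 0"
    using ae by eventually_elim (auto simp: n_def)
  have cc: "cos_coeff k n = 0" for k
  proof -
    have "cos_coeff k n = (LINT u|leb 1. 0)"
      unfolding cos_coeff_def L2_inner_def
    proof (rule integral_cong_AE)
      show "(\<lambda>u. n u * cos (real k * pi * u)) \<in> borel_measurable (leb 1)"
        by (intro borel_measurable_times measurable_continuous_Icc n continuous_intros)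
      show "AE u in leb 1. n u * cos (real k * pi * u) = 0"
        using ae0 by eventually_elim simp
    qed simp
    then show ?thesis by simp
  qed
  have "(\<lambda>N. cos_mean N n u) \<longlonglongrightarrow> n u" by (rule cos_mean_tendsto[OF n u])
  then have "n u = 0" by (simp add: cos_mean_def cc LIMSEQ_const_iff)
  then show ?thesis by (auto simp: n_def max_def split: if_splits)
qed

lemma abs_L2_inner_le:
  assumes "AE u in leb 1. \<bar>f u * h u\<bar> \<le> B" "0 \<le> B"
  shows "\<bar>L2_inner f h\<bar> \<le> B"
  unfolding L2_inner_def using LINT_abs_le_Icc[OF zero_le_one assms] by simp

lemma abs_coeff_le:
  assumes f: "AE u in leb 1. \<bar>f u\<bar> \<le> B" and B: "0 \<le> B"
  shows "\<bar>cos_coeff k f\<bar> \<le> B" "\<bar>sin_coeff k f\<bar> \<le> B"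
proof -
  have le: "\<bar>x * y\<bar> \<le> B" if "\<bar>x\<bar> \<le> B" "\<bar>y\<bar> \<le> 1" for x y :: real
    using mult_mono[OF that B] by (simp add: abs_mult)
  show "\<bar>cos_coeff k f\<bar> \<le> B"
    unfolding cos_coeff_def
    by (rule abs_L2_inner_le[OF _ B], rule lebesgue_on_mono[OF f], rule le) simp_all
  show "\<bar>sin_coeff k f\<bar> \<le> B"
    unfolding sin_coeff_def
    by (rule abs_L2_inner_le[OF _ B], rule lebesgue_on_mono[OF f], rule le) simp_all
qed

lemma coeff_eq_L2_inner:
  assumes "C = cos_coeff \<or> C = sin_coeff"
  shows "\<exists>e. continuous_on {0..1} e \<and> (\<forall>f. C k f = L2_inner f e)"
  using assms
proof
  assume "C = cos_coeff"
  then show ?thesis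
    by (intro exI[of _ "\<lambda>u. cos (real k * pi * u)"]) (auto simp: cos_coeff_def intro!: continuous_intros)
next
  assume "C = sin_coeff"
  then show ?thesis
    by (intro exI[of _ "\<lambda>u. sin (real k * pi * u)"]) (auto simp: sin_coeff_def intro!: continuous_intros)
qed

lemma coeff_diff:
  assumes C: "C = cos_coeff \<or> C = sin_coeff"
    and f: "f \<in> borel_measurable (leb 1)" "AE u in leb 1. \<bar>f u\<bar> \<le> A"
    and h: "h \<in> borel_measurable (leb 1)" "AE u in leb 1. \<bar>h u\<bar> \<le> B"
  shows "C k (\<lambda>u. f u - h u) = C k f - C k h"
proof -
  obtain e where e: "continuous_on {0..1} e" "\<And>f. C k f = L2_inner f e"
    using coeff_eq_L2_inner[OF C, of k] by blast
  show ?thesis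
    using integrable_bounded_times_continuous[OF f e(1)] integrable_bounded_times_continuous[OF h e(1)]
    by (simp add: e(2) L2_inner_def left_diff_distrib)
qed

text \<open>
  Provides the dominating constant for letting \<open>N\<close> tend to infinity under an integral in time.
\<close>

lemma abs_fejer_sum_le:
  assumes C: "C = cos_coeff \<or> C = sin_coeff"
    and f: "f \<in> borel_measurable (leb 1)" "AE u in leb 1. \<bar>f u\<bar> \<le> A" "0 \<le> A"
    and q: "continuous_on {0..1} q" "\<And>u. u \<in> {0..1} \<Longrightarrow> \<bar>q u\<bar> \<le> B" "0 \<le> B"
  shows "\<bar>\<Sum>k<N. fejer_coeff N k * C k f * C k q\<bar> \<le> A * B"
proof -
  have qm: "q \<in> borel_measurable (leb 1)" "AE u in leb 1. \<bar>q u\<bar> \<le> B"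
    by (intro measurable_continuous_Icc q, intro AE_I2, simp add: q)
  have "AE u in leb 1. \<bar>f u * cos_mean N q u\<bar> \<le> A * B"
    unfolding abs_mult by (rule lebesgue_on_mono[OF f(2)], intro mult_mono abs_mean_le[OF qm q(3)]) (use f(3) in auto)
  then have 1: "\<bar>LINT u|leb 1. f u * cos_mean N q u\<bar> \<le> A * B"
    using abs_L2_inner_le[of f "cos_mean N q"] f(3) q(3) by (simp add: L2_inner_def)
  have "AE u in leb 1. \<bar>f u * sin_mean N q u\<bar> \<le> A * B"
    unfolding abs_mult by (rule lebesgue_on_mono[OF f(2)], intro mult_mono abs_mean_le[OF qm q(3)]) (use f(3) in auto)
  then have 2: "\<bar>LINT u|leb 1. f u * sin_mean N q u\<bar> \<le> A * B"
    using abs_L2_inner_le[of f "sin_mean N q"] f(3) q(3) by (simp add: L2_inner_def)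
  show ?thesis
    using C 1 2 by (auto simp: LINT_times_mean[OF f(1,2)])
qed

text \<open>
  The passage from single modes to the full pairing, by \<open>fejer_parseval\<close> at almost every time and
  bounded convergence in time.
\<close>

lemma LINT_L2_inner_le_by_coeffs:
  fixes f q :: "real \<Rightarrow> real \<Rightarrow> real"
  assumes C: "C = cos_coeff \<or> C = sin_coeff"
    and f: "AE t in leb T. f t \<in> borel_measurable (leb 1) \<and> (\<forall>u\<in>{0..1}. \<bar>f t u\<bar> \<le> A)" "0 \<le> A"
    and q: "AE t in leb T. continuous_on {0..1} (q t) \<and> (\<forall>u\<in>{0..1}. \<bar>q t u\<bar> \<le> B)" "0 \<le> B"
    and fm: "\<And>k. (\<lambda>t. C k (f t)) \<in> borel_measurable (leb T)"
    and qm: "\<And>k. (\<lambda>t. C k (q t)) \<in> borel_measurable (leb T)"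
    and le: "\<And>k. (LINT t|leb T. C k (f t) * C k (q t)) \<le> e k"
    and sum: "\<And>N. (\<Sum>k<N. fejer_coeff N k * e k) \<le> E"
  shows "(LINT t|leb T. L2_inner (f t) (q t)) \<le> E"
proof -
  let ?S = "\<lambda>N t. \<Sum>k<N. fejer_coeff N k * C k (f t) * C k (q t)"
  have fqB: "AE t in leb T. \<bar>C k (f t) * C k (q t)\<bar> \<le> A * B" for k
    using f(1) q(1)
  proof eventually_elim
    case (elim t)
    have "AE u in leb 1. \<bar>f t u\<bar> \<le> A" "AE u in leb 1. \<bar>q t u\<bar> \<le> B"
      by (rule AE_I2, use elim in simp)+
    then have "\<bar>C k (f t)\<bar> \<le> A" "\<bar>C k (q t)\<bar> \<le> B"
      using C abs_coeff_le[of "f t" A k] abs_coeff_le[of "q t" B k] f(2) q(2) by auto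
    then show ?case unfolding abs_mult using f(2) by (intro mult_mono) auto
  qed
  have int: "integrable (leb T) (\<lambda>t. C k (f t) * C k (q t))" for k
    by (rule integrable_bounded_Icc[OF _ fqB]) (intro borel_measurable_times fm qm)
  have "(\<lambda>N. LINT t|leb T. ?S N t) \<longlonglongrightarrow> (LINT t|leb T. L2_inner (f t) (q t))"
  proof (rule bounded_convergence_Icc[where B = "A * B"])
    show "?S N \<in> borel_measurable (leb T)" for N
      by (intro borel_measurable_sum borel_measurable_times fm qm borel_measurable_const)
    show "AE t in leb T. \<bar>?S N t\<bar> \<le> A * B" for N
      using f(1) q(1)
    proof eventually_elim
      case (elim t)
      show ?case
        by (rule abs_fejer_sum_le[OF C _ _ f(2) _ _ q(2)]) (use elim in \<open>auto intro!: AE_I2\<close>)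
    qed
    show "AE t in leb T. (\<lambda>N. ?S N t) \<longlonglongrightarrow> L2_inner (f t) (q t)"
      using f(1) q(1)
    proof eventually_elim
      case (elim t)
      have "AE u in leb 1. \<bar>f t u\<bar> \<le> A"
        by (rule AE_I2) (use elim in simp)
      then show ?case using C elim fejer_parseval[of "f t" A "q t"] by auto
    qed
  qed
  then show ?thesis
  proof (rule LIMSEQ_le_const2, intro exI allI impI)
    fix N
    have "(LINT t|leb T. ?S N t) = (\<Sum>k<N. fejer_coeff N k * (LINT t|leb T. C k (f t) * C k (q t)))"
      using int by (simp add: mult.assoc)
    also have "\<dots> \<le> (\<Sum>k<N. fejer_coeff N k * e k)"
      using le by (intro sum_mono mult_left_mono fejer_coeff_nonneg) auto
    also have "\<dots> \<le> E" by (rule sum)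
    finally show "(LINT t|leb T. ?S N t) \<le> E" .
  qed
qed

lemma cos_coeff_linear:
  "(real k * pi)\<^sup>2 * cos_coeff k (\<lambda>u. a + d * u) = d * ((- 1) ^ k - 1)"
proof -
  define c where "c = real k * pi"
  define F where "F u = (a + d * u) * sin (c * u) * c + d * cos (c * u)" for u
  have "(LINT u|leb 1. c\<^sup>2 * ((a + d * u) * cos (c * u))) = F 1 - F 0"
  proof (rule LINT_FTC_Icc)
    show "(F has_real_derivative c\<^sup>2 * ((a + d * x) * cos (c * x))) (at x within {0..1})" for x
      unfolding F_def by (auto intro!: derivative_eq_intros simp: algebra_simps power2_eq_square)
  qed (auto intro!: continuous_intros)
  also have "F 1 - F 0 = d * ((- 1) ^ k - 1)"
    by (simp add: F_def c_def algebra_simps)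
  finally show ?thesis
    by (simp add: cos_coeff_def L2_inner_def c_def)
qed

lemma sin_coeff_linear:
  "(real k * pi)\<^sup>2 * sin_coeff k (\<lambda>u. (1 - u) * a + u * b) = - (real k * pi * ((- 1) ^ k * b - a))"
proof (cases "k = 0")
  case False
  define c where "c = real k * pi"
  have c: "c \<noteq> 0" using False by (simp add: c_def)
  define F where "F u = - ((1 - u) * a + u * b) * cos (c * u) * c + (b - a) * sin (c * u)" for u
  have "(LINT u|leb 1. c\<^sup>2 * (((1 - u) * a + u * b) * sin (c * u))) = F 1 - F 0"
  proof (rule LINT_FTC_Icc)
    show "(F has_real_derivative c\<^sup>2 * (((1 - x) * a + x * b) * sin (c * x))) (at x within {0..1})" for x
      unfolding F_def by (auto intro!: derivative_eq_intros simp: algebra_simps power2_eq_square)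
  qed (auto intro!: continuous_intros)
  also have "F 1 - F 0 = - (c * ((- 1) ^ k * b - a))"
    by (simp add: F_def c_def algebra_simps)
  finally show ?thesis
    by (simp add: sin_coeff_def L2_inner_def c_def)
qed simp

section \<open>A smooth step function\<close>

text \<open>
  A recursive form of \<open>n\<close>-fold differentiability; products and quotients are handled by induction more
  easily than with iterates of \<open>deriv\<close>.
\<close>

fun times_differentiable :: "nat \<Rightarrow> (real \<Rightarrow> real) \<Rightarrow> bool" where
  "times_differentiable 0 f \<longleftrightarrow> True"
| "times_differentiable (Suc n) f \<longleftrightarrow> (\<forall>x. f differentiable (at x)) \<and> times_differentiable n (deriv f)"

lemma times_differentiable_funpow_deriv:
  "times_differentiable (n + k) f \<Longrightarrow> times_differentiable n ((deriv ^^ k) f)"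
proof (induction k arbitrary: f)
  case (Suc k)
  then have "times_differentiable (n + k) (deriv f)" by simp
  from Suc.IH[OF this] show ?case by (simp add: funpow_Suc_right del: funpow.simps)
qed simp

lemma smooth_if_times_differentiable:
  assumes "\<And>n. times_differentiable n f"
  shows "(deriv ^^ k) f differentiable (at x)"
  using times_differentiable_funpow_deriv[of "Suc 0" k f] assms by simp

lemma times_differentiable_SucI:
  assumes "\<And>x. (f has_real_derivative f' x) (at x)" "times_differentiable n f'"
  shows "times_differentiable (Suc n) f"
proof -
  have "deriv f = f'" using assms(1) by (auto intro!: ext DERIV_imp_deriv)
  then show ?thesis
    using assms by (auto simp: real_differentiable_def)
qed

lemma times_differentiable_Suc_DERIV:
  "times_differentiable (Suc n) f \<Longrightarrow> (f has_real_derivative deriv f x) (at x)"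
  by (simp add: DERIV_deriv_iff_real_differentiable)

lemma times_differentiable_mono: "times_differentiable (Suc n) f \<Longrightarrow> times_differentiable n f"
  by (induction n arbitrary: f) auto

lemma times_differentiable_const: "times_differentiable n (\<lambda>x. c)"
proof (induction n arbitrary: c)
  case (Suc n)
  show ?case by (rule times_differentiable_SucI[where f' = "\<lambda>x. 0"]) (auto simp: Suc)
qed simp

lemma times_differentiable_add:
  "times_differentiable n f \<Longrightarrow> times_differentiable n g \<Longrightarrow> times_differentiable n (\<lambda>x. f x + g x)"
proof (induction n arbitrary: f g)
  case (Suc n)
  show ?case
    by (rule times_differentiable_SucI[where f' = "\<lambda>x. deriv f x + deriv g x"])
       (use Suc in \<open>auto intro!: derivative_eq_intros times_differentiable_Suc_DERIV\<close>)
qed simp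

lemma times_differentiable_mult:
  "times_differentiable n f \<Longrightarrow> times_differentiable n g \<Longrightarrow> times_differentiable n (\<lambda>x. f x * g x)"
proof (induction n arbitrary: f g)
  case (Suc n)
  have "times_differentiable n f" "times_differentiable n g"
    using Suc.prems times_differentiable_mono by blast+
  then show ?case
    by (intro times_differentiable_SucI[where f' = "\<lambda>x. deriv f x * g x + f x * deriv g x"]
          times_differentiable_add Suc.IH)
       (use Suc.prems in \<open>auto intro!: derivative_eq_intros times_differentiable_Suc_DERIV\<close>)
qed simp

lemma times_differentiable_inverse:
  "times_differentiable n f \<Longrightarrow> (\<And>x. f x \<noteq> 0) \<Longrightarrow> times_differentiable n (\<lambda>x. inverse (f x))"
proof (induction n arbitrary: f)
  case (Suc n)
  have i: "times_differentiable n (\<lambda>x. inverse (f x))"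
    using Suc.prems times_differentiable_mono Suc.IH by blast
  have d: "(f has_real_derivative deriv f x) (at x)" for x
    using Suc.prems by (auto intro: times_differentiable_Suc_DERIV)
  have "((\<lambda>x. inverse (f x)) has_real_derivative (- 1) * (deriv f x * (inverse (f x) * inverse (f x)))) (at x)" for x
    using d Suc.prems(2) by (auto intro!: derivative_eq_intros)
  moreover have "times_differentiable n (\<lambda>x. (- 1) * (deriv f x * (inverse (f x) * inverse (f x))))"
    using Suc.prems i by (intro times_differentiable_mult times_differentiable_const) auto
  ultimately show ?case by (rule times_differentiable_SucI)
qed simp

lemma times_differentiable_affine:
  "times_differentiable n f \<Longrightarrow> times_differentiable n (\<lambda>x. f (a * x + b))"
proof (induction n arbitrary: f)
  case (Suc n)
  have d: "((\<lambda>x. f (a * x + b)) has_real_derivative a * deriv f (a * x + b)) (at x)" for x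
    by (rule DERIV_chain2[OF times_differentiable_Suc_DERIV[OF Suc.prems], THEN DERIV_cong])
       (auto intro!: derivative_eq_intros)
  show ?case
    by (rule times_differentiable_SucI[OF d])
       (use Suc in \<open>auto intro!: times_differentiable_mult times_differentiable_const\<close>)
qed simp

lemma times_differentiable_sin_cos:
  "times_differentiable n (\<lambda>x. sin (a * x))" "times_differentiable n (\<lambda>x. cos (a * x))"
proof (induction n)
  case (Suc n)
  {
    case 1
    have "((\<lambda>x. sin (a * x)) has_real_derivative a * cos (a * x)) (at x)" for x
      by (auto intro!: derivative_eq_intros)
    moreover have "times_differentiable n (\<lambda>x. a * cos (a * x))"
      by (intro times_differentiable_mult times_differentiable_const Suc)
    ultimately show ?case by (rule times_differentiable_SucI)
  next
    case 2
    have "((\<lambda>x. cos (a * x)) has_real_derivative (- a) * sin (a * x)) (at x)" for x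
      by (auto intro!: derivative_eq_intros)
    moreover have "times_differentiable n (\<lambda>x. (- a) * sin (a * x))"
      by (intro times_differentiable_mult times_differentiable_const Suc)
    ultimately show ?case by (rule times_differentiable_SucI)
  }
qed simp_all

text \<open>
  The functions \<open>P(1/x) exp (-1/x)\<close> on \<open>x > 0\<close>, extended by 0, form a family that is closed under
  differentiation.  The standard flat function is the case \<open>P = 1\<close>.
\<close>

definition flat_poly :: "real poly \<Rightarrow> real \<Rightarrow> real" where
  "flat_poly p x = (if x > 0 then poly p (1 / x) * exp (- (1 / x)) else 0)"

lemma poly_times_exp_minus_tendsto_0: "((\<lambda>y::real. poly p y * exp (- y)) \<longlongrightarrow> 0) at_top"
proof -
  have "((\<lambda>y::real. \<Sum>i\<le>degree p. coeff p i * (y ^ i / exp y)) \<longlongrightarrow> (\<Sum>i\<le>degree p. coeff p i * 0)) at_top"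
    by (intro tendsto_intros tendsto_power_div_exp_0)
  then show ?thesis
    by (simp add: poly_altdef sum_distrib_right sum_distrib_left exp_minus divide_inverse mult_ac)
qed

text \<open>
  At 0 the difference quotient from the right is a function of the same family, and in
  the variable \<open>y = 1/x\<close> the exponential beats every polynomial.
\<close>

lemma flat_poly_DERIV:
  "(flat_poly p has_real_derivative flat_poly ([:0, 0, 1:] * (p - pderiv p)) x) (at x)"
proof -
  consider "x > 0" | "x < 0" | "x = 0" by linarith
  then show ?thesis
  proof cases
    case 1
    have d: "((\<lambda>x. poly p (1 / x) * exp (- (1 / x))) has_real_derivative flat_poly ([:0, 0, 1:] * (p - pderiv p)) x) (at x)"
      using 1 by (auto intro!: derivative_eq_intros DERIV_chain2[OF poly_DERIV] simp: flat_poly_def field_simps power2_eq_square)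
    show ?thesis
      by (rule has_field_derivative_transform_within_open[OF d, of "{0<..}"]) (use 1 in \<open>auto simp: flat_poly_def\<close>)
  next
    case 2
    have d: "((\<lambda>x. 0) has_real_derivative flat_poly ([:0, 0, 1:] * (p - pderiv p)) x) (at x)"
      using 2 by (simp add: flat_poly_def)
    show ?thesis
      by (rule has_field_derivative_transform_within_open[OF d, of "{..<0}"]) (use 2 in \<open>auto simp: flat_poly_def\<close>)
  next
    case 3
    have "((\<lambda>y. poly (pCons 0 p) (inverse y) * exp (- inverse y)) \<longlongrightarrow> 0) (at_right (0::real))"
      by (rule filterlim_compose[OF poly_times_exp_minus_tendsto_0 filterlim_inverse_at_top_right])
    then have r: "((\<lambda>y. flat_poly p y / y) \<longlongrightarrow> 0) (at_right 0)"
      by (rule Lim_transform_eventually)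
         (auto simp: flat_poly_def eventually_at_filter field_simps)
    have l: "((\<lambda>y. flat_poly p y / y) \<longlongrightarrow> 0) (at_left 0)"
      by (rule Lim_transform_eventually[OF tendsto_const])
         (auto simp: flat_poly_def eventually_at_filter)
    show ?thesis
      using filterlim_split_at[OF l r] 3
      by (simp add: has_field_derivative_iff flat_poly_def)
  qed
qed

lemma times_differentiable_flat_poly: "times_differentiable n (flat_poly p)"
proof (induction n arbitrary: p)
  case (Suc n)
  show ?case by (rule times_differentiable_SucI[OF flat_poly_DERIV Suc])
qed simp

definition smooth_step :: "real \<Rightarrow> real" where
  "smooth_step x = flat_poly 1 x * inverse (flat_poly 1 x + flat_poly 1 (1 - x))"

lemma flat_poly_1_sum_pos: "0 < flat_poly 1 x + flat_poly 1 (1 - x)"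
  by (auto simp: flat_poly_def add_pos_pos)

lemma times_differentiable_smooth_step: "times_differentiable n smooth_step"
proof -
  have "times_differentiable n (\<lambda>x. flat_poly 1 ((- 1) * x + 1))"
    by (rule times_differentiable_affine[OF times_differentiable_flat_poly])
  moreover have "flat_poly 1 x + flat_poly 1 (1 - x) \<noteq> 0" for x
    using flat_poly_1_sum_pos[of x] by simp
  ultimately have "times_differentiable n (\<lambda>x. flat_poly 1 x * inverse (flat_poly 1 x + flat_poly 1 (1 - x)))"
    by (intro times_differentiable_mult times_differentiable_inverse times_differentiable_add
          times_differentiable_flat_poly) (auto simp: algebra_simps)
  then show ?thesis by (simp add: smooth_step_def[abs_def])
qed

lemma smooth_step_eq_0: "x \<le> 0 \<Longrightarrow> smooth_step x = 0"
  by (simp add: smooth_step_def flat_poly_def)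

lemma smooth_step_eq_1: "1 \<le> x \<Longrightarrow> smooth_step x = 1"
  by (simp add: smooth_step_def flat_poly_def)

lemma smooth_step_bounds: "0 \<le> smooth_step x" "smooth_step x \<le> 1"
proof -
  have p: "0 \<le> flat_poly 1 y" for y by (simp add: flat_poly_def)
  show "0 \<le> smooth_step x" "smooth_step x \<le> 1"
    using p[of x] p[of "1 - x"] flat_poly_1_sum_pos[of x] by (auto simp: smooth_step_def field_simps)
qed

lemma smooth_step_DERIV: "(smooth_step has_real_derivative deriv smooth_step x) (at x)"
  by (rule times_differentiable_Suc_DERIV[OF times_differentiable_smooth_step])

lemma deriv_smooth_step_eq_0:
  assumes "x < 0 \<or> 1 < x"
  shows "deriv smooth_step x = 0"
  using assms
proof
  assume x: "x < 0"
  have "(smooth_step has_real_derivative 0) (at x)"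
    by (rule has_field_derivative_transform_within_open[OF DERIV_const[of 0], of "{..<0}"]) (use x in \<open>auto simp: smooth_step_eq_0\<close>)
  then show ?thesis by (rule DERIV_imp_deriv)
next
  assume x: "1 < x"
  have "(smooth_step has_real_derivative 0) (at x)"
    by (rule has_field_derivative_transform_within_open[OF DERIV_const[of 1], of "{1<..}"]) (use x in \<open>auto simp: smooth_step_eq_1\<close>)
  then show ?thesis by (rule DERIV_imp_deriv)
qed

lemma deriv_smooth_step_bounded:
  obtains C where "\<And>x. \<bar>deriv smooth_step x\<bar> \<le> C" "0 \<le> C"
proof -
  have "times_differentiable 2 smooth_step" by (rule times_differentiable_smooth_step)
  then have "\<And>x. deriv smooth_step differentiable (at x)" by (simp add: numeral_2_eq_2)
  then have "continuous_on {0..1} (deriv smooth_step)"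
    by (intro continuous_at_imp_continuous_on ballI differentiable_imp_continuous_within) auto
  then obtain C where C: "\<And>x. x \<in> {0..1} \<Longrightarrow> \<bar>deriv smooth_step x\<bar> \<le> C" "0 \<le> C"
    using continuous_on_Icc_bounded by blast
  have "\<bar>deriv smooth_step x\<bar> \<le> C" for x
    using C deriv_smooth_step_eq_0[of x] by (cases "x \<in> {0..1}") auto
  then show ?thesis using that C(2) by blast
qed

section \<open>Continuous representatives of bounded functions in \<open>H\<^sup>1\<close>\<close>

lemma LINT_Ioo_eq_Icc:
  fixes f :: "real \<Rightarrow> real"
  assumes "f \<in> borel_measurable (leb 1)"
  shows "(LINT u|lebesgue_on {0<..<1}. f u) = (LINT u|leb 1. f u)"
proof -
  have m: "(\<lambda>x. if x \<in> {0..1} then f x else 0) \<in> borel_measurable lebesgue"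
    by (rule borel_measurable_if_I[OF assms]) simp
  have "AE x in lebesgue. x \<notin> {0, 1::real}"
    by (rule AE_not_in) (simp add: negligible_iff_null_sets[symmetric])
  then have ae: "AE x in lebesgue. (if x \<in> {0..1} then f x else 0) = (if x \<in> {0<..<1} then f x else 0)"
    by eventually_elim auto
  have "(LINT u|lebesgue. (if u \<in> {0..1} then f u else 0)) = (LINT u|lebesgue. (if u \<in> {0<..<1} then f u else 0))"
    by (rule integral_cong_AE[OF m borel_measurable_AE[OF m ae] ae])
  then show ?thesis
    using Lebesgue_Measure.integral_restrict_UNIV[of "{0..1::real}" f]
      Lebesgue_Measure.integral_restrict_UNIV[of "{0<..<1::real}" f] by simp
qed

text \<open>
  The function \<open>sin (k \<pi> x) / (k \<pi>)\<close> is not compactly supported in \<open>(0,1)\<close>, so it is multiplied by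
  cut-offs that vanish within distance \<open>1/n\<close> of the end points.  The derivatives of the cut-offs are
  \<open>O(n)\<close>, but they live within distance \<open>2/n\<close> of the end points, where the sine is \<open>O(1/n)\<close>.  The
  integrands therefore stay bounded and the cut-offs can be removed by dominated convergence.
\<close>

lemma weak_derivative_cos_coeff:
  fixes \<phi> \<psi> :: "real \<Rightarrow> real"
  assumes \<phi>: "\<phi> \<in> borel_measurable (leb 1)" "AE u in leb 1. \<bar>\<phi> u\<bar> \<le> B"
    and \<psi>: "integrable (leb 1) \<psi>"
    and weak: "has_weak_derivative \<phi> \<psi>" and k: "0 < k"
  shows "cos_coeff k \<phi> = - sin_coeff k \<psi> / (real k * pi)"
proof -
  define a where "a = real k * pi"
  have a: "a > 0" using k by (simp add: a_def)
  have sa: "sin a = 0" by (simp add: a_def)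
  obtain C where C: "\<And>x. \<bar>deriv smooth_step x\<bar> \<le> C" "0 \<le> C"
    using deriv_smooth_step_bounded by blast
  define \<sigma> where "\<sigma> x = (1 / a) * sin (a * x)" for x
  define s1 s2 where "s1 n x = smooth_step (real n * x + (- 1))"
    and "s2 n x = smooth_step ((- real n) * x + (real n - 1))" for n x
  define d1 d2 where "d1 n x = real n * deriv smooth_step (real n * x + (- 1))"
    and "d2 n x = (- real n) * deriv smooth_step ((- real n) * x + (real n - 1))" for n x
  define \<eta> where "\<eta> n x = \<sigma> x * (s1 n x * s2 n x)" for n x
  define \<eta>' where "\<eta>' n x = cos (a * x) * (s1 n x * s2 n x) + \<sigma> x * (d1 n x * s2 n x + s1 n x * d2 n x)" for n x
  have s1D: "(s1 n has_real_derivative d1 n x) (at x)" for n x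
    unfolding s1_def d1_def
    by (rule DERIV_chain2[OF smooth_step_DERIV, THEN DERIV_cong]) (auto intro!: derivative_eq_intros)
  have s2D: "(s2 n has_real_derivative d2 n x) (at x)" for n x
    unfolding s2_def d2_def
    by (rule DERIV_chain2[OF smooth_step_DERIV, THEN DERIV_cong]) (auto intro!: derivative_eq_intros)
  have \<sigma>D: "(\<sigma> has_real_derivative cos (a * x)) (at x)" for x
    unfolding \<sigma>_def using a by (auto intro!: derivative_eq_intros)
  have \<eta>D: "(\<eta> n has_real_derivative \<eta>' n x) (at x)" for n x
    unfolding \<eta>_def \<eta>'_def by (rule derivative_eq_intros s1D s2D \<sigma>D refl)+ (simp add: algebra_simps)
  then have deriv_\<eta>: "deriv (\<eta> n) = \<eta>' n" for n by (auto intro!: ext DERIV_imp_deriv)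
  have smooth: "times_differentiable j (\<eta> n)" for n j
    unfolding \<eta>_def \<sigma>_def s1_def s2_def
    by (intro times_differentiable_mult times_differentiable_const times_differentiable_sin_cos
          times_differentiable_affine times_differentiable_smooth_step)
  have test: "\<eta> (Suc n) \<in> test_functions" for n
    unfolding test_functions_def
  proof (intro CollectI conjI allI exI[of _ "{1 / real (Suc n) .. 1 - 1 / real (Suc n)}"] impI)
    show "(deriv ^^ k) (\<eta> (Suc n)) differentiable at x" for k x
      by (rule smooth_if_times_differentiable[OF smooth])
    have sub: "{e..1 - e} \<subseteq> {0<..<1}" if "0 < e" for e :: real
      using that by auto
    show "{1 / real (Suc n)..1 - 1 / real (Suc n)} \<subseteq> {0<..<1}"
      by (rule sub) simp
    fix x assume "x \<notin> {1 / real (Suc n)..1 - 1 / real (Suc n)}"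
    then have "real (Suc n) * x + (- 1) \<le> 0 \<or> (- real (Suc n)) * x + (real (Suc n) - 1) \<le> 0"
      by (auto simp: field_simps)
    then show "\<eta> (Suc n) x = 0"
      by (auto simp: \<eta>_def s1_def s2_def smooth_step_eq_0)
  qed simp
  have s_bd: "0 \<le> s1 n x" "s1 n x \<le> 1" "0 \<le> s2 n x" "s2 n x \<le> 1" for n x
    by (simp_all add: s1_def s2_def smooth_step_bounds)
  have s12: "\<bar>s1 n x * s2 n x\<bar> \<le> 1" for n x
    using s_bd[of n x] mult_mono[of "s1 n x" 1 "s2 n x" 1] by (simp add: abs_mult)
  have \<sigma>_bd1: "\<bar>\<sigma> x\<bar> \<le> x" if "0 \<le> x" for x
    using abs_sin_x_le_abs_x[of "a * x"] a that by (simp add: \<sigma>_def abs_mult field_simps)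
  have \<sigma>_bd2: "\<bar>\<sigma> x\<bar> \<le> 1 - x" if "x \<le> 1" for x
  proof -
    have "\<bar>sin (a * x)\<bar> = \<bar>sin (a * (1 - x))\<bar>"
      using sa sin_cos_squared_add[of a] by (simp add: right_diff_distrib sin_diff abs_mult power2_eq_1_iff) (auto)
    then show ?thesis
      using abs_sin_x_le_abs_x[of "a * (1 - x)"] a that by (simp add: \<sigma>_def abs_mult field_simps)
  qed
  \<comment> \<open>Where the derivative of a cut-off, of size \<open>n C\<close>, does not vanish, the distance to the end point
    is at most \<open>2/n\<close>, and \<open>\<sigma>\<close> is bounded by that distance.\<close>
  have d_bd: "\<bar>\<sigma> x * d1 n x\<bar> \<le> 2 * C" "\<bar>\<sigma> x * d2 n x\<bar> \<le> 2 * C" if x: "x \<in> {0..1}" for n x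
  proof -
    have "\<bar>\<sigma> x * d1 n x\<bar> \<le> x * (real n * \<bar>deriv smooth_step (real n * x + (- 1))\<bar>)"
      unfolding d1_def using \<sigma>_bd1[of x] x by (simp add: abs_mult mult_right_mono)
    also have "\<dots> \<le> 2 * C"
    proof (cases "real n * x + (- 1) > 1")
      case True
      then show ?thesis using C by (simp add: deriv_smooth_step_eq_0)
    next
      case False
      then have "(real n * x) * \<bar>deriv smooth_step (real n * x + (- 1))\<bar> \<le> 2 * C"
        using C x by (intro mult_mono) auto
      then show ?thesis by (simp add: mult_ac)
    qed
    finally show "\<bar>\<sigma> x * d1 n x\<bar> \<le> 2 * C" .
    have "\<bar>\<sigma> x * d2 n x\<bar> \<le> (1 - x) * (real n * \<bar>deriv smooth_step ((- real n) * x + (real n - 1))\<bar>)"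
      unfolding d2_def using \<sigma>_bd2[of x] x by (simp add: abs_mult mult_right_mono)
    also have "\<dots> \<le> 2 * C"
    proof (cases "(- real n) * x + (real n - 1) > 1")
      case True
      then show ?thesis using C by (simp add: deriv_smooth_step_eq_0)
    next
      case False
      then have "(real n * (1 - x)) * \<bar>deriv smooth_step ((- real n) * x + (real n - 1))\<bar> \<le> 2 * C"
        using C x by (intro mult_mono) (auto simp: algebra_simps)
      then show ?thesis by (simp add: mult_ac)
    qed
    finally show "\<bar>\<sigma> x * d2 n x\<bar> \<le> 2 * C" .
  qed
  have \<eta>'_bd: "\<bar>\<eta>' n x\<bar> \<le> 1 + 4 * C" if x: "x \<in> {0..1}" for n x
  proof -
    have "\<bar>cos (a * x) * (s1 n x * s2 n x)\<bar> \<le> 1"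
      using s12[of n x] mult_mono[of "\<bar>cos (a * x)\<bar>" 1 "\<bar>s1 n x * s2 n x\<bar>" 1] by (simp add: abs_mult)
    moreover have "\<bar>\<sigma> x * d1 n x * s2 n x\<bar> \<le> 2 * C"
      using mult_mono[OF d_bd(1)[OF x, of n] s_bd(4)[of n x]] s_bd(3)[of n x] C by (simp add: abs_mult)
    moreover have "\<bar>\<sigma> x * d2 n x * s1 n x\<bar> \<le> 2 * C"
      using mult_mono[OF d_bd(2)[OF x, of n] s_bd(2)[of n x]] s_bd(1)[of n x] C by (simp add: abs_mult)
    moreover have "\<eta>' n x = cos (a * x) * (s1 n x * s2 n x) + \<sigma> x * d1 n x * s2 n x + \<sigma> x * d2 n x * s1 n x"
      by (simp add: \<eta>'_def algebra_simps)
    ultimately show ?thesis by linarith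
  qed
  have ev: "\<forall>\<^sub>F n in sequentially. s1 n x = 1 \<and> s2 n x = 1 \<and> d1 n x = 0 \<and> d2 n x = 0" if x: "x \<in> {0<..<1}" for x
  proof -
    obtain n1 n2 :: nat where n: "real n1 > 2 / x" "real n2 > 2 / (1 - x)"
      using reals_Archimedean2 by metis
    show ?thesis
    proof (rule eventually_sequentiallyI[of "max n1 n2"])
      fix n assume "max n1 n2 \<le> n"
      then have "real n > 2 / x" "real n > 2 / (1 - x)" using n by auto
      then have "real n * x + (- 1) > 1" "(- real n) * x + (real n - 1) > 1"
        using x by (auto simp: field_simps)
      then show "s1 n x = 1 \<and> s2 n x = 1 \<and> d1 n x = 0 \<and> d2 n x = 0"
        by (simp add: s1_def s2_def d1_def d2_def smooth_step_eq_1 deriv_smooth_step_eq_0)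
    qed
  qed
  have AE_open: "AE x in leb 1. x \<in> {0<..<1}"
    by (rule AE_I'[of "{0, 1}"]) (auto simp: null_sets_restrict_space)
  have \<eta>m: "\<eta> n \<in> borel_measurable (leb 1)" for n
    by (intro continuous_imp_measurable_on_sets_lebesgue continuous_at_imp_continuous_on ballI DERIV_isCont[OF \<eta>D]) simp
  have \<eta>'m: "\<eta>' n \<in> borel_measurable (leb 1)" for n
  proof -
    have "times_differentiable 2 (\<eta> n)" by (rule smooth)
    then have "\<And>x. \<eta>' n differentiable (at x)" by (simp add: numeral_2_eq_2 deriv_\<eta>)
    then have "continuous_on {0..1} (\<eta>' n)"
      by (intro continuous_at_imp_continuous_on ballI differentiable_imp_continuous_within) auto
    then show ?thesis by (rule continuous_imp_measurable_on_sets_lebesgue) simp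
  qed
  have lim1: "(\<lambda>n. LINT u|leb 1. \<phi> u * \<eta>' n u) \<longlonglongrightarrow> (LINT u|leb 1. \<phi> u * cos (a * u))"
  proof (rule bounded_convergence_Icc[where B = "\<bar>B\<bar> * (1 + 4 * C)"])
    show "AE u in leb 1. \<bar>\<phi> u * \<eta>' n u\<bar> \<le> \<bar>B\<bar> * (1 + 4 * C)" for n
      using \<phi>(2) by (rule lebesgue_on_mono) (use \<eta>'_bd in \<open>force simp: abs_mult intro!: mult_mono\<close>)
    show "AE u in leb 1. (\<lambda>n. \<phi> u * \<eta>' n u) \<longlonglongrightarrow> \<phi> u * cos (a * u)"
      using AE_open
    proof eventually_elim
      case (elim u)
      have "\<forall>\<^sub>F n in sequentially. \<phi> u * cos (a * u) = \<phi> u * \<eta>' n u"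
        using ev[OF elim] by eventually_elim (simp add: \<eta>'_def)
      then show ?case by (rule Lim_transform_eventually[OF tendsto_const])
    qed
  qed (use \<phi>(1) \<eta>'m in auto)
  have lim2: "(\<lambda>n. LINT u|leb 1. \<psi> u * \<eta> n u) \<longlonglongrightarrow> (LINT u|leb 1. \<psi> u * \<sigma> u)"
  proof (rule integral_dominated_convergence[where w = "\<lambda>u. \<bar>\<psi> u\<bar>"])
    show "AE u in leb 1. norm (\<psi> u * \<eta> n u) \<le> \<bar>\<psi> u\<bar>" for n
    proof (rule AE_I2)
      fix u :: real assume "u \<in> space (leb 1)"
      then have "\<bar>\<eta> n u\<bar> \<le> 1"
        using \<sigma>_bd1[of u] s12[of n u] mult_mono[of "\<bar>\<sigma> u\<bar>" 1 "\<bar>s1 n u * s2 n u\<bar>" 1]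
        by (simp add: \<eta>_def abs_mult)
      then show "norm (\<psi> u * \<eta> n u) \<le> \<bar>\<psi> u\<bar>"
        by (simp add: abs_mult mult_left_le)
    qed
    show "AE u in leb 1. (\<lambda>n. \<psi> u * \<eta> n u) \<longlonglongrightarrow> \<psi> u * \<sigma> u"
      using AE_open
    proof eventually_elim
      case (elim u)
      have "\<forall>\<^sub>F n in sequentially. \<psi> u * \<sigma> u = \<psi> u * \<eta> n u"
        using ev[OF elim] by eventually_elim (simp add: \<eta>_def)
      then show ?case by (rule Lim_transform_eventually[OF tendsto_const])
    qed
    have "continuous_on {0..1} \<sigma>" unfolding \<sigma>_def by (intro continuous_intros)
    then have "\<sigma> \<in> borel_measurable (leb 1)"
      by (rule continuous_imp_measurable_on_sets_lebesgue) simp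
    then show "(\<lambda>u. \<psi> u * \<sigma> u) \<in> borel_measurable (leb 1)"
      using \<psi> by auto
  qed (use \<psi> \<eta>m in auto)
  have eq: "(LINT u|leb 1. \<phi> u * \<eta>' (Suc n) u) = - (LINT u|leb 1. \<psi> u * \<eta> (Suc n) u)" for n
  proof -
    have "(LINT u|lebesgue_on {0<..<1}. \<phi> u * \<eta>' (Suc n) u) = - (LINT u|lebesgue_on {0<..<1}. \<psi> u * \<eta> (Suc n) u)"
      using weak test[of n] by (auto simp: has_weak_derivative_def deriv_\<eta>)
    then show ?thesis
      using \<phi>(1) \<eta>'m \<psi> \<eta>m by (subst (asm) (1 2) LINT_Ioo_eq_Icc) auto
  qed
  have "(\<lambda>n. - (LINT u|leb 1. \<psi> u * \<eta> (Suc n) u)) \<longlonglongrightarrow> (LINT u|leb 1. \<phi> u * cos (a * u))"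
    using LIMSEQ_Suc[OF lim1] by (simp only: eq)
  moreover have "(\<lambda>n. - (LINT u|leb 1. \<psi> u * \<eta> (Suc n) u)) \<longlonglongrightarrow> - (LINT u|leb 1. \<psi> u * \<sigma> u)"
    using LIMSEQ_Suc[OF lim2] by (rule tendsto_minus)
  ultimately have "(LINT u|leb 1. \<phi> u * cos (a * u)) = - (LINT u|leb 1. \<psi> u * \<sigma> u)"
    by (rule LIMSEQ_unique)
  also have "(LINT u|leb 1. \<psi> u * \<sigma> u) = (LINT u|leb 1. (\<psi> u * sin (a * u)) / a)"
    by (simp add: \<sigma>_def)
  also have "\<dots> = (LINT u|leb 1. \<psi> u * sin (a * u)) / a"
    by simp
  finally show ?thesis
    by (simp add: cos_coeff_def sin_coeff_def L2_inner_def a_def)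
qed

lemma L2_integrable: "\<psi> \<in> L2 \<Longrightarrow> integrable (leb 1) \<psi>"
proof -
  assume \<psi>: "\<psi> \<in> L2"
  then have m: "\<psi> \<in> borel_measurable (leb 1)" and i: "integrable (leb 1) (\<lambda>u. (\<psi> u)\<^sup>2)"
    by (auto simp: L2_def)
  have "integrable (leb 1) (\<lambda>u. 1 + (\<psi> u)\<^sup>2)"
    by (intro Bochner_Integration.integrable_add i continuous_imp_integrable_real continuous_on_const)
  then show ?thesis
  proof (rule Bochner_Integration.integrable_bound[OF _ m], intro AE_I2)
    fix u
    have "2 * \<bar>\<psi> u\<bar> \<le> 1 + \<bar>\<psi> u\<bar>\<^sup>2" using sum_squares_ge_zero[of "\<bar>\<psi> u\<bar> - 1" 0] by (simp add: power2_eq_square algebra_simps)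
    then show "norm (\<psi> u) \<le> norm (1 + (\<psi> u)\<^sup>2)" by simp
  qed
qed

text \<open>
  A du Bois-Reymond argument: by \<open>weak_derivative_cos_coeff\<close> and integration by parts, \<open>\<phi>\<close> and the
  primitive of its weak derivative have the same cosine coefficients of positive order.  They differ by a constant almost everywhere, and the primitive is continuous.
\<close>

lemma H1_bounded_continuous_representative:
  assumes \<phi>: "\<phi> \<in> borel_measurable (leb 1)" "AE u in leb 1. \<bar>\<phi> u\<bar> \<le> B"
    and H1: "\<phi> \<in> H1"
  shows "\<exists>c. continuous_on {0..1} c \<and> (AE u in leb 1. \<phi> u = c u)"
proof -
  obtain \<psi> where \<psi>: "\<psi> \<in> L2" and weak: "has_weak_derivative \<phi> \<psi>"
    using H1 by (auto simp: H1_def)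
  have i\<psi>: "integrable (leb 1) \<psi>" using \<psi> by (rule L2_integrable)
  define \<Psi> where "\<Psi> u = (LINT s|leb u. \<psi> s)" for u
  have \<Psi>: "continuous_on {0..1} \<Psi>"
    unfolding \<Psi>_def[abs_def] by (rule continuous_on_LINT_upper[OF i\<psi>])
  obtain C where C: "\<And>u. u \<in> {0..1} \<Longrightarrow> \<bar>\<Psi> u\<bar> \<le> C" "0 \<le> C"
    using continuous_on_Icc_bounded[OF \<Psi>] by blast
  have \<Psi>m: "\<Psi> \<in> borel_measurable (leb 1)" "AE u in leb 1. \<bar>\<Psi> u\<bar> \<le> C"
    using C by (auto intro!: measurable_continuous_Icc \<Psi> AE_I2)
  have \<Psi>c: "cos_coeff k \<Psi> = - sin_coeff k \<psi> / (real k * pi)" if k: "0 < k" for k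
  proof -
    have inner: "(LINT s|leb t. cos (real k * pi * s)) = sin (real k * pi * t) / (real k * pi)"
      if "0 \<le> t" for t
    proof -
      have "(LINT s|leb t. cos (real k * pi * s))
        = sin (real k * pi * t) / (real k * pi) - sin (real k * pi * 0) / (real k * pi)"
        using k that by (intro LINT_FTC_Icc) (auto intro!: derivative_eq_intros continuous_intros)
      then show ?thesis by simp
    qed
    have ic: "integrable (leb 1) (\<lambda>u. cos (real k * pi * u))"
      by (intro continuous_imp_integrable_real continuous_intros)
    have "(LINT t|leb 1. \<Psi> t * cos (real k * pi * t))
      + (LINT t|leb 1. \<psi> t * (LINT s|leb t. cos (real k * pi * s))) = 0"
      using integration_by_parts_Icc(1)[OF zero_le_one i\<psi> ic] k by (simp add: \<Psi>_def LINT_cos)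
    moreover have "(LINT t|leb 1. \<psi> t * (LINT s|leb t. cos (real k * pi * s)))
        = (LINT t|leb 1. \<psi> t * sin (real k * pi * t) / (real k * pi))"
      by (intro Bochner_Integration.integral_cong) (auto simp: inner)
    ultimately show ?thesis
      by (simp add: cos_coeff_def sin_coeff_def L2_inner_def)
  qed
  define f where "f u = \<phi> u - \<Psi> u" for u
  have fm: "f \<in> borel_measurable (leb 1)"
    unfolding f_def[abs_def] using \<phi>(1) \<Psi>m(1) by simp
  have fB: "AE u in leb 1. \<bar>f u\<bar> \<le> B + C"
    using \<phi>(2) \<Psi>m(2) by eventually_elim (auto simp: f_def)
  have f0: "cos_coeff k f = 0" if k: "0 < k" for k
  proof -
    have i: "integrable (leb 1) (\<lambda>y. \<phi> y * cos (real k * pi * y))"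
         "integrable (leb 1) (\<lambda>y. \<Psi> y * cos (real k * pi * y))"
      by (intro integrable_bounded_times_continuous[OF \<phi>] integrable_bounded_times_continuous[OF \<Psi>m]
          continuous_intros)+
    have "cos_coeff k f = cos_coeff k \<phi> - cos_coeff k \<Psi>"
      using i by (simp add: cos_coeff_def L2_inner_def f_def left_diff_distrib)
    then show ?thesis
      using \<Psi>c[OF k] weak_derivative_cos_coeff[OF \<phi> i\<psi> weak k] by simp
  qed
  have "AE u in leb 1. f u = cos_coeff 0 f"
    by (rule AE_const_if_cos_coeff_eq_0[OF fm fB f0])
  then have "AE u in leb 1. \<phi> u = \<Psi> u + cos_coeff 0 f"
    by eventually_elim (auto simp: f_def)
  moreover have "continuous_on {0..1} (\<lambda>u. \<Psi> u + cos_coeff 0 f)"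
    using \<Psi> by (intro continuous_intros)
  ultimately show ?thesis by blast
qed

section \<open>Fourier modes of weak solutions\<close>

text \<open>
  For such a profile the choice made in \<open>H1_rep\<close> is an actual continuous representative of the power, so
  boundary values have their intended meaning.
\<close>

definition regular_profile :: "nat \<Rightarrow> (real \<Rightarrow> real) \<Rightarrow> bool" where
  "regular_profile m r \<longleftrightarrow> continuous_on {0..1} (bdry_pow m r) \<and>
     (AE u in leb 1. r u ^ m = bdry_pow m r u)"

lemma regular_profileI:
  assumes r: "r \<in> borel_measurable (leb 1)" "\<And>u. u \<in> {0..1} \<Longrightarrow> r u \<in> {0..1}"
    and \<zeta>: "\<zeta> \<in> H1" "AE u in leb 1. r u ^ m = \<zeta> u"
  shows "regular_profile m r"
proof -
  have "\<zeta> \<in> borel_measurable (leb 1)"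
    by (rule measurable_AE_lebesgue_on[OF borel_measurable_power[OF r(1)] _ \<zeta>(2)]) simp
  moreover have "AE u in leb 1. \<bar>\<zeta> u\<bar> \<le> 1"
    by (rule lebesgue_on_mono[OF \<zeta>(2)]) (metis r(2) atLeastAtMost_iff power_le_one zero_le_power abs_of_nonneg)
  ultimately obtain c where c: "continuous_on {0..1} c" "AE u in leb 1. \<zeta> u = c u"
    using H1_bounded_continuous_representative \<zeta>(1) by blast
  have "AE u in leb 1. r u ^ m = c u"
    using \<zeta>(2) c(2) by eventually_elim simp
  with c(1) have "\<exists>c. continuous_on {0..1} c \<and> (AE u in leb 1. r u ^ m = c u)" by blast
  from someI_ex[OF this] show ?thesis
    unfolding regular_profile_def bdry_pow_def[abs_def] H1_rep_def .
qed

lemma regular_profile_bdry: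
  assumes reg: "regular_profile m r" and r: "\<And>u. u \<in> {0..1} \<Longrightarrow> r u \<in> {0..1}" and m: "1 \<le> m" and u: "u \<in> {0..1}"
  shows "bdry_pow m r u \<in> {0..1}" and "bdry m r u \<in> {0..1}" and "bdry m r u ^ m = bdry_pow m r u"
proof -
  have c: "continuous_on {0..1} (bdry_pow m r)" and ae: "AE u in leb 1. r u ^ m = bdry_pow m r u"
    using reg by (auto simp: regular_profile_def)
  have r01: "0 \<le> r v ^ m \<and> r v ^ m \<le> 1" if "v \<in> {0..1}" for v
    using r[OF that] by (auto intro: power_le_one)
  have "AE v in leb 1. 0 \<le> bdry_pow m r v"
    by (rule lebesgue_on_mono[OF ae]) (metis r01)
  then have 0: "0 \<le> bdry_pow m r u" by (rule continuous_AE_ge_imp_ge[OF c _ u])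
  have "AE v in leb 1. 0 \<le> 1 - bdry_pow m r v"
    by (rule lebesgue_on_mono[OF ae]) (metis r01 diff_ge_0_iff_ge)
  then have 1: "0 \<le> 1 - bdry_pow m r u"
    by (rule continuous_AE_ge_imp_ge[rotated]) (intro continuous_intros c u)+
  show p: "bdry_pow m r u \<in> {0..1}" using 0 1 by simp
  show "bdry m r u ^ m = bdry_pow m r u"
    using m p by (simp add: bdry_def real_root_pow_pos2)
  show "bdry m r u \<in> {0..1}"
    using m p real_root_le_mono[of m "bdry_pow m r u" 1] by (simp add: bdry_def)
qed

lemma C12_time_independent:
  assumes "\<And>u. u \<in> {0..1} \<Longrightarrow> (\<phi> has_real_derivative \<phi>' u) (at u)"
    and "\<And>u. u \<in> {0..1} \<Longrightarrow> (\<phi>' has_real_derivative \<phi>'' u) (at u)"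
    and "continuous_on {0..1} \<phi>''"
  shows "C12 T (\<lambda>_. \<phi>) (\<lambda>_ _. 0) (\<lambda>_. \<phi>') (\<lambda>_. \<phi>'')"
proof -
  have c: "continuous_on {0..1} \<phi>" "continuous_on {0..1} \<phi>'"
    by (intro continuous_at_imp_continuous_on ballI DERIV_isCont[OF assms(1)] DERIV_isCont[OF assms(2)]; assumption)+
  have l: "continuous_on ({0..T} \<times> {0..1}) (\<lambda>(s, u). f u)" if "continuous_on {0..1} f" for f :: "real \<Rightarrow> real"
    unfolding case_prod_beta by (rule continuous_on_compose2[OF that]) (auto intro!: continuous_intros)
  show ?thesis
    unfolding C12_def
    by (intro conjI ballI l c assms(3) continuous_on_const)
       (simp_all add: case_prod_beta continuous_on_const has_field_derivative_at_within[OF assms(1)]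
         has_field_derivative_at_within[OF assms(2)])
qed

locale pme_profile =
  fixes m :: nat and T :: real and \<rho> :: "real \<Rightarrow> real \<Rightarrow> real"
  assumes m: "1 \<le> m" and T: "0 < T" and adm: "pme_admissible m T \<rho>"
begin

lemma range: "t \<in> {0..T} \<Longrightarrow> u \<in> {0..1} \<Longrightarrow> \<rho> t u \<in> {0..1}"
  using adm by (simp add: pme_admissible_def)

lemma measurable_slice: "t \<in> {0..T} \<Longrightarrow> \<rho> t \<in> borel_measurable (leb 1)"
  using adm by (simp add: pme_admissible_def)

lemma power_range: "t \<in> {0..T} \<Longrightarrow> u \<in> {0..1} \<Longrightarrow> 0 \<le> \<rho> t u ^ j \<and> \<rho> t u ^ j \<le> 1"
  using range[of t u] by (auto intro: power_le_one)

lemma AE_power_le: "t \<in> {0..T} \<Longrightarrow> AE u in leb 1. \<bar>\<rho> t u ^ j\<bar> \<le> 1"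
  by (rule AE_I2) (use power_range in auto)

lemma measurable_moment:
  assumes \<phi>: "continuous_on {0..1} \<phi>"
  shows "(\<lambda>t. L2_inner (\<lambda>u. \<rho> t u ^ j) \<phi>) \<in> borel_measurable (leb T)"
proof -
  obtain C where C: "\<And>u. u \<in> {0..1} \<Longrightarrow> \<bar>\<phi> u\<bar> \<le> C" "0 \<le> C"
    using continuous_on_Icc_bounded[OF \<phi>] by blast
  have R: "{0..T} \<times> {0..1::real} \<in> sets lebesgue"
    by (rule sets_completionI_sets) (simp add: borel_closed closed_Times)
  have "(\<lambda>(t, u). \<rho> t u) \<in> borel_measurable (lebesgue_on ({0..T} \<times> {0..1}))"
    using adm by (simp add: pme_admissible_def)
  then have "(\<lambda>p. (case p of (t, u) \<Rightarrow> \<rho> t u) ^ j) \<in> borel_measurable (lebesgue_on ({0..T} \<times> {0..1}))"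
    by (rule borel_measurable_power)
  moreover have "(\<lambda>p. \<phi> (snd p)) \<in> borel_measurable (lebesgue_on ({0..T} \<times> {0..1}))"
    by (rule continuous_imp_measurable_on_sets_lebesgue[OF _ R], rule continuous_on_compose2[OF \<phi>])
       (auto intro!: continuous_intros)
  ultimately have "(\<lambda>p. (case p of (t, u) \<Rightarrow> \<rho> t u) ^ j * \<phi> (snd p)) \<in> borel_measurable (lebesgue_on ({0..T} \<times> {0..1}))"
    by (rule borel_measurable_times)
  then have "(\<lambda>(t, u). \<rho> t u ^ j * \<phi> u) \<in> borel_measurable (lebesgue_on ({0..T} \<times> {0..1}))"
    by (simp add: case_prod_beta)
  moreover have "\<bar>\<rho> t u ^ j * \<phi> u\<bar> \<le> 1 * C" if "t \<in> {0..T}" "u \<in> {0..1}" for t u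
    unfolding abs_mult using power_range[OF that, of j] C(1)[OF that(2)] by (intro mult_mono) auto
  ultimately show ?thesis
    unfolding L2_inner_def by (rule fubini_rectangle(1))
qed

lemma measurable_coeff_power [measurable]:
  "(\<lambda>t. cos_coeff k (\<lambda>u. \<rho> t u ^ j)) \<in> borel_measurable (leb T)"
  "(\<lambda>t. sin_coeff k (\<lambda>u. \<rho> t u ^ j)) \<in> borel_measurable (leb T)"
  unfolding cos_coeff_def sin_coeff_def by (intro measurable_moment continuous_intros)+

lemma measurable_coeff [measurable]:
  "(\<lambda>t. cos_coeff k (\<rho> t)) \<in> borel_measurable (leb T)"
  "(\<lambda>t. sin_coeff k (\<rho> t)) \<in> borel_measurable (leb T)"
  using measurable_coeff_power[of k 1] by simp_all

lemma AE_regular: "AE t in leb T. regular_profile m (\<rho> t)"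
proof -
  obtain \<zeta> where \<zeta>: "\<zeta> \<in> leb T \<rightarrow>\<^sub>M H1_borel"
    and ae: "AE t in leb T. AE u in leb 1. \<rho> t u ^ m = \<zeta> t u"
    using adm unfolding pme_admissible_def L2_time_H1_def by blast
  have "space H1_borel = H1"
    unfolding H1_borel_def by (rule space_measure_of_conv)
  then have H1: "\<zeta> t \<in> H1" if "t \<in> {0..T}" for t
    using measurable_space[OF \<zeta>, of t] that by simp
  show ?thesis
  proof (rule lebesgue_on_mono[OF ae])
    fix t assume t: "AE u in leb 1. \<rho> t u ^ m = \<zeta> t u" "t \<in> {0..T}"
    show "regular_profile m (\<rho> t)"
      by (rule regular_profileI[OF measurable_slice[OF t(2)] _ H1[OF t(2)] t(1)]) (rule range[OF t(2)])
  qed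
qed

lemma AE_bdry:
  assumes "u \<in> {0..1}"
  shows "AE t in leb T. bdry_pow m (\<rho> t) u \<in> {0..1}"
    and "AE t in leb T. bdry m (\<rho> t) u \<in> {0..1}"
    and "AE t in leb T. bdry m (\<rho> t) u ^ m = bdry_pow m (\<rho> t) u"
proof -
  have "AE t in leb T. bdry_pow m (\<rho> t) u \<in> {0..1} \<and> bdry m (\<rho> t) u \<in> {0..1}
      \<and> bdry m (\<rho> t) u ^ m = bdry_pow m (\<rho> t) u"
  proof (rule lebesgue_on_mono[OF AE_regular])
    fix t assume t: "regular_profile m (\<rho> t)" "t \<in> {0..T}"
    have r: "\<rho> t v \<in> {0..1}" if "v \<in> {0..1}" for v using range[OF t(2) that] .
    show "bdry_pow m (\<rho> t) u \<in> {0..1} \<and> bdry m (\<rho> t) u \<in> {0..1}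
      \<and> bdry m (\<rho> t) u ^ m = bdry_pow m (\<rho> t) u"
      using regular_profile_bdry[OF t(1) r m assms] by blast
  qed
  then show "AE t in leb T. bdry_pow m (\<rho> t) u \<in> {0..1}"
    and "AE t in leb T. bdry m (\<rho> t) u \<in> {0..1}"
    and "AE t in leb T. bdry m (\<rho> t) u ^ m = bdry_pow m (\<rho> t) u"
    by (auto elim: eventually_mono)
qed

lemma coeff_regular:
  assumes "regular_profile m (\<rho> t)" "t \<in> {0..T}"
  shows "cos_coeff k (bdry_pow m (\<rho> t)) = cos_coeff k (\<lambda>u. \<rho> t u ^ m)"
    and "sin_coeff k (bdry_pow m (\<rho> t)) = sin_coeff k (\<lambda>u. \<rho> t u ^ m)"
proof -
  have c: "continuous_on {0..1} (bdry_pow m (\<rho> t))" and ae: "AE u in leb 1. \<rho> t u ^ m = bdry_pow m (\<rho> t) u"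
    using assms by (auto simp: regular_profile_def)
  have eq: "L2_inner (bdry_pow m (\<rho> t)) h = L2_inner (\<lambda>u. \<rho> t u ^ m) h" if h: "continuous_on {0..1} h" for h
    unfolding L2_inner_def
  proof (rule integral_cong_AE)
    show "(\<lambda>u. bdry_pow m (\<rho> t) u * h u) \<in> borel_measurable (leb 1)"
      by (intro borel_measurable_times measurable_continuous_Icc c h)
    show "(\<lambda>u. \<rho> t u ^ m * h u) \<in> borel_measurable (leb 1)"
      by (intro borel_measurable_times borel_measurable_power measurable_slice assms measurable_continuous_Icc h)
    show "AE u in leb 1. bdry_pow m (\<rho> t) u * h u = \<rho> t u ^ m * h u"
      using ae by eventually_elim simp
  qed
  show "cos_coeff k (bdry_pow m (\<rho> t)) = cos_coeff k (\<lambda>u. \<rho> t u ^ m)"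
    "sin_coeff k (bdry_pow m (\<rho> t)) = sin_coeff k (\<lambda>u. \<rho> t u ^ m)"
    unfolding cos_coeff_def sin_coeff_def by (rule eq, intro continuous_intros)+
qed

text \<open>
  Boundary values are obtained from \<open>H1_rep\<close> separately at every time, so their measurability in time is not
  evident.  They are limits of Fejer means, and the coefficients of these are moments of \<open>\<rho>\<close>.
\<close>

lemma measurable_bdry_pow [measurable]:
  assumes "u \<in> {0..1}"
  shows "(\<lambda>t. bdry_pow m (\<rho> t) u) \<in> borel_measurable (leb T)"
proof (rule measurable_AE_limit)
  show "(\<lambda>t. cos_mean N (\<lambda>u. \<rho> t u ^ m) u) \<in> borel_measurable (leb T)" for N
    unfolding cos_mean_def by measurable
  show "AE t in leb T. (\<lambda>N. cos_mean N (\<lambda>u. \<rho> t u ^ m) u) \<longlonglongrightarrow> bdry_pow m (\<rho> t) u"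
  proof (rule lebesgue_on_mono[OF AE_regular])
    fix t assume t: "regular_profile m (\<rho> t)" "t \<in> {0..T}"
    then have "continuous_on {0..1} (bdry_pow m (\<rho> t))" by (simp add: regular_profile_def)
    from cos_mean_tendsto[OF this assms]
    show "(\<lambda>N. cos_mean N (\<lambda>u. \<rho> t u ^ m) u) \<longlonglongrightarrow> bdry_pow m (\<rho> t) u"
      by (simp add: cos_mean_def coeff_regular[OF t])
  qed
qed simp

lemma measurable_bdry [measurable]:
  assumes "u \<in> {0..1}"
  shows "(\<lambda>t. bdry m (\<rho> t) u) \<in> borel_measurable (leb T)"
  unfolding bdry_def
  by (rule measurable_compose[OF measurable_bdry_pow[OF assms]])
     (intro borel_measurable_continuous_onI continuous_intros)

lemma pme_bulk_time_independent:
  "pme_bulk m g \<rho> (\<lambda>_. \<phi>) (\<lambda>_ _. 0) (\<lambda>_ u. c * \<phi> u) t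
   = L2_inner (\<rho> t) \<phi> - L2_inner g \<phi> - c * (LINT s|leb t. L2_inner (\<lambda>u. \<rho> s u ^ m) \<phi>)"
proof -
  have e: "\<rho> s u * (0 + \<rho> s u ^ (m - 1) * (c * \<phi> u)) = c * (\<rho> s u ^ m * \<phi> u)" for s u
    using m by (cases m) auto
  have "L2_inner (\<rho> s) (\<lambda>u. 0 + \<rho> s u ^ (m - 1) * (c * \<phi> u)) = c * L2_inner (\<lambda>u. \<rho> s u ^ m) \<phi>" for s
    unfolding L2_inner_def e by simp
  then show ?thesis
    by (simp add: pme_bulk_def)
qed

lemma integrable_subinterval_of_bounded:
  fixes f :: "real \<Rightarrow> real"
  assumes "f \<in> borel_measurable (leb T)" "AE s in leb T. \<bar>f s\<bar> \<le> B" "t \<in> {0..T}"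
  shows "integrable (leb t) f"
proof (rule integrable_bounded_Icc)
  show "f \<in> borel_measurable (leb t)"
    by (rule measurable_Icc_subset[OF assms(1)]) (use assms(3) in auto)
  show "AE s in leb t. \<bar>f s\<bar> \<le> B"
    by (rule AE_Icc_subset[OF assms(2)]) (use assms(3) in auto)
qed

lemma integrable_solution_data:
  assumes "t \<in> {0..T}"
  shows "integrable (leb t) (\<lambda>s. cos_coeff k (\<lambda>u. \<rho> s u ^ m))"
    and "integrable (leb t) (\<lambda>s. sin_coeff k (\<lambda>u. \<rho> s u ^ m))"
    and "u \<in> {0..1} \<Longrightarrow> integrable (leb t) (\<lambda>s. bdry_pow m (\<rho> s) u)"
    and "u \<in> {0..1} \<Longrightarrow> integrable (leb t) (\<lambda>s. bdry m (\<rho> s) u)"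
proof -
  have "AE s in leb T. \<bar>cos_coeff k (\<lambda>u. \<rho> s u ^ m)\<bar> \<le> 1"
    by (rule AE_I2) (use abs_coeff_le(1)[OF AE_power_le] in auto)
  then show "integrable (leb t) (\<lambda>s. cos_coeff k (\<lambda>u. \<rho> s u ^ m))"
    by (rule integrable_subinterval_of_bounded[OF measurable_coeff_power(1) _ assms])
  have "AE s in leb T. \<bar>sin_coeff k (\<lambda>u. \<rho> s u ^ m)\<bar> \<le> 1"
    by (rule AE_I2) (use abs_coeff_le(2)[OF AE_power_le] in auto)
  then show "integrable (leb t) (\<lambda>s. sin_coeff k (\<lambda>u. \<rho> s u ^ m))"
    by (rule integrable_subinterval_of_bounded[OF measurable_coeff_power(2) _ assms])
  assume u: "u \<in> {0..1}"
  have "AE s in leb T. \<bar>bdry_pow m (\<rho> s) u\<bar> \<le> 1"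
    using AE_bdry(1)[OF u] by eventually_elim auto
  then show "integrable (leb t) (\<lambda>s. bdry_pow m (\<rho> s) u)"
    by (rule integrable_subinterval_of_bounded[OF measurable_bdry_pow[OF u] _ assms])
  have "AE s in leb T. \<bar>bdry m (\<rho> s) u\<bar> \<le> 1"
    using AE_bdry(2)[OF u] by eventually_elim auto
  then show "integrable (leb t) (\<lambda>s. bdry m (\<rho> s) u)"
    by (rule integrable_subinterval_of_bounded[OF measurable_bdry[OF u] _ assms])
qed

text \<open>
  The derivative of \<open>cos (k \<pi> u)\<close> vanishes at both end points.  So the term with the powers of the
  boundary values disappears and only the Robin fluxes remain.
\<close>

lemma robin_cos_coeff:
  assumes sol: "robin_weak_solution m T \<alpha> \<beta> \<kappa> g \<rho>" and t: "t \<in> {0..T}"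
  shows "cos_coeff k (\<rho> t) = cos_coeff k g
    + (LINT s|leb t. - (real k * pi)\<^sup>2 * cos_coeff k (\<lambda>u. \<rho> s u ^ m)
        + \<kappa> * ((\<alpha> - bdry m (\<rho> s) 0) + (- 1) ^ k * (\<beta> - bdry m (\<rho> s) 1)))"
proof -
  let ?e = "\<lambda>u. cos (real k * pi * u)" and ?e' = "\<lambda>u. - (real k * pi) * sin (real k * pi * u)"
  have C: "C12 T (\<lambda>_. ?e) (\<lambda>_ _. 0) (\<lambda>_. ?e') (\<lambda>_ u. - (real k * pi)\<^sup>2 * ?e u)"
    by (rule C12_time_independent)
       (auto intro!: derivative_eq_intros continuous_intros simp: power2_eq_square)
  have e1: "cos (real k * pi * 1) = (- 1) ^ k" by simp
  have "pme_bulk m g \<rho> (\<lambda>_. ?e) (\<lambda>_ _. 0) (\<lambda>_ u. - (real k * pi)\<^sup>2 * ?e u) t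
      + (LINT s|leb t. bdry_pow m (\<rho> s) 1 * ?e' 1 - bdry_pow m (\<rho> s) 0 * ?e' 0)
      - \<kappa> * (LINT s|leb t. ?e 0 * (\<alpha> - bdry m (\<rho> s) 0) + ?e 1 * (\<beta> - bdry m (\<rho> s) 1)) = 0"
    using sol t C unfolding robin_weak_solution_def by blast
  then have *: "cos_coeff k (\<rho> t) - cos_coeff k g
      + (real k * pi)\<^sup>2 * (LINT s|leb t. cos_coeff k (\<lambda>u. \<rho> s u ^ m))
      - \<kappa> * (LINT s|leb t. (\<alpha> - bdry m (\<rho> s) 0) + (- 1) ^ k * (\<beta> - bdry m (\<rho> s) 1)) = 0"
    unfolding pme_bulk_time_independent by (simp add: cos_coeff_def)
  have i: "integrable (leb t) (\<lambda>s. cos_coeff k (\<lambda>u. \<rho> s u ^ m))"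
    "integrable (leb t) (\<lambda>s. (\<alpha> - bdry m (\<rho> s) 0) + (- 1) ^ k * (\<beta> - bdry m (\<rho> s) 1))"
    by (intro integrable_solution_data[OF t] Bochner_Integration.integrable_add Bochner_Integration.integrable_diff
        integrable_mult_right integrable_const_Icc; simp)+
  have "(LINT s|leb t. - (real k * pi)\<^sup>2 * cos_coeff k (\<lambda>u. \<rho> s u ^ m)
        + \<kappa> * ((\<alpha> - bdry m (\<rho> s) 0) + (- 1) ^ k * (\<beta> - bdry m (\<rho> s) 1)))
      = - (real k * pi)\<^sup>2 * (LINT s|leb t. cos_coeff k (\<lambda>u. \<rho> s u ^ m))
      + \<kappa> * (LINT s|leb t. (\<alpha> - bdry m (\<rho> s) 0) + (- 1) ^ k * (\<beta> - bdry m (\<rho> s) 1))"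
    by (subst Bochner_Integration.integral_add[OF integrable_mult_right[OF i(1)] integrable_mult_right[OF i(2)]])
       simp
  with * show ?thesis by simp
qed

lemma C12_0_sin:
  shows "C12_0 T (\<lambda>_ u. sin (real k * pi * u)) (\<lambda>_ _. 0) (\<lambda>_ u. real k * pi * cos (real k * pi * u))
     (\<lambda>_ u. - (real k * pi)\<^sup>2 * sin (real k * pi * u))"
proof -
  have "C12 T (\<lambda>_ u. sin (real k * pi * u)) (\<lambda>_ _. 0) (\<lambda>_ u. real k * pi * cos (real k * pi * u))
     (\<lambda>_ u. - (real k * pi)\<^sup>2 * sin (real k * pi * u))"
    by (rule C12_time_independent)
       (auto intro!: derivative_eq_intros continuous_intros simp: power2_eq_square)
  then show ?thesis by (simp add: C12_0_def)
qed

text \<open>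
  The common part of the Robin and the Dirichlet case; \<open>A\<close> and \<open>B\<close> are the boundary values of the \<open>m\<close>-th
  power at 0 and 1.
\<close>

lemma sin_coeff_from_weak_form:
  assumes t: "t \<in> {0..T}" and A: "integrable (leb t) A" and B: "integrable (leb t) B"
    and eq: "pme_bulk m g \<rho> (\<lambda>_ u. sin (real k * pi * u)) (\<lambda>_ _. 0) (\<lambda>_ u. - (real k * pi)\<^sup>2 * sin (real k * pi * u)) t
      + (LINT s|leb t. B s * (real k * pi * cos (real k * pi * 1)) - A s * (real k * pi * cos (real k * pi * 0))) = 0"
  shows "sin_coeff k (\<rho> t) = sin_coeff k g
    + (LINT s|leb t. - (real k * pi)\<^sup>2 * sin_coeff k (\<lambda>u. \<rho> s u ^ m) - real k * pi * ((- 1) ^ k * B s - A s))"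
proof -
  have "(LINT s|leb t. B s * (real k * pi * cos (real k * pi * 1)) - A s * (real k * pi * cos (real k * pi * 0)))
    = (LINT s|leb t. real k * pi * ((- 1) ^ k * B s - A s))"
    by (intro Bochner_Integration.integral_cong) (simp_all add: algebra_simps)
  then have "(LINT s|leb t. B s * (real k * pi * cos (real k * pi * 1)) - A s * (real k * pi * cos (real k * pi * 0)))
    = real k * pi * (LINT s|leb t. (- 1) ^ k * B s - A s)"
    by simp
  with eq have *: "sin_coeff k (\<rho> t) - sin_coeff k g
      + (real k * pi)\<^sup>2 * (LINT s|leb t. sin_coeff k (\<lambda>u. \<rho> s u ^ m))
      + real k * pi * (LINT s|leb t. (- 1) ^ k * B s - A s) = 0"
    unfolding pme_bulk_time_independent by (simp add: sin_coeff_def)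
  have i: "integrable (leb t) (\<lambda>s. (- 1) ^ k * B s - A s)"
    using A B by simp
  have "(LINT s|leb t. - (real k * pi)\<^sup>2 * sin_coeff k (\<lambda>u. \<rho> s u ^ m) - real k * pi * ((- 1) ^ k * B s - A s))
      = - (real k * pi)\<^sup>2 * (LINT s|leb t. sin_coeff k (\<lambda>u. \<rho> s u ^ m))
      - real k * pi * (LINT s|leb t. (- 1) ^ k * B s - A s)"
    by (subst Bochner_Integration.integral_diff[OF integrable_mult_right[OF integrable_solution_data(2)[OF t]] integrable_mult_right[OF i]])
       simp
  with * show ?thesis by simp
qed

text \<open>
  Sines vanish at the end points and do not see the fluxes.  The rate is therefore that of the Dirichlet
  solution, except for the boundary values of the \<open>m\<close>-th power.
\<close>

lemma robin_sin_coeff: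
  assumes sol: "robin_weak_solution m T \<alpha> \<beta> \<kappa> g \<rho>" and t: "t \<in> {0..T}"
  shows "sin_coeff k (\<rho> t) = sin_coeff k g
    + (LINT s|leb t. - (real k * pi)\<^sup>2 * sin_coeff k (\<lambda>u. \<rho> s u ^ m)
         - real k * pi * ((- 1) ^ k * bdry_pow m (\<rho> s) 1 - bdry_pow m (\<rho> s) 0))"
proof (rule sin_coeff_from_weak_form[OF t])
  let ?e = "\<lambda>u. sin (real k * pi * u)" and ?e' = "\<lambda>u. real k * pi * cos (real k * pi * u)"
  have "pme_bulk m g \<rho> (\<lambda>_. ?e) (\<lambda>_ _. 0) (\<lambda>_ u. - (real k * pi)\<^sup>2 * ?e u) t
      + (LINT s|leb t. bdry_pow m (\<rho> s) 1 * ?e' 1 - bdry_pow m (\<rho> s) 0 * ?e' 0)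
      - \<kappa> * (LINT s|leb t. ?e 0 * (\<alpha> - bdry m (\<rho> s) 0) + ?e 1 * (\<beta> - bdry m (\<rho> s) 1)) = 0"
    using sol t C12_0_sin[of k] unfolding robin_weak_solution_def C12_0_def by blast
  then show "pme_bulk m g \<rho> (\<lambda>_. ?e) (\<lambda>_ _. 0) (\<lambda>_ u. - (real k * pi)\<^sup>2 * ?e u) t
      + (LINT s|leb t. bdry_pow m (\<rho> s) 1 * ?e' 1 - bdry_pow m (\<rho> s) 0 * ?e' 0) = 0"
    by simp
qed (auto intro: integrable_solution_data[OF t])

lemma dirichlet_sin_coeff:
  assumes sol: "dirichlet_weak_solution m T \<alpha> \<beta> g \<rho>" and t: "t \<in> {0..T}"
  shows "sin_coeff k (\<rho> t) = sin_coeff k g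
    + (LINT s|leb t. - (real k * pi)\<^sup>2 * sin_coeff k (\<lambda>u. \<rho> s u ^ m)
         - real k * pi * ((- 1) ^ k * \<beta> ^ m - \<alpha> ^ m))"
proof (rule sin_coeff_from_weak_form[OF t])
  let ?e = "\<lambda>u. sin (real k * pi * u)" and ?e' = "\<lambda>u. real k * pi * cos (real k * pi * u)"
  show "pme_bulk m g \<rho> (\<lambda>_. ?e) (\<lambda>_ _. 0) (\<lambda>_ u. - (real k * pi)\<^sup>2 * ?e u) t
      + (LINT s|leb t. \<beta> ^ m * ?e' 1 - \<alpha> ^ m * ?e' 0) = 0"
    using sol t C12_0_sin[of k] unfolding dirichlet_weak_solution_def by blast
qed (auto intro: integrable_const_Icc)

end

text \<open>
  Cosine modes of Robin and Neumann solutions are thus covered by the same lemma.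
\<close>

lemma neumann_imp_robin_0:
  "neumann_weak_solution m T g \<rho> \<Longrightarrow> robin_weak_solution m T \<alpha> \<beta> 0 g \<rho>"
  by (simp add: neumann_weak_solution_def robin_weak_solution_def)

section \<open>Elementary inequalities for powers\<close>

lemma abs_diff_power_le:
  fixes a b :: real
  assumes "0 \<le> a" "0 \<le> b" "1 \<le> k"
  shows "\<bar>a - b\<bar> ^ k \<le> \<bar>a ^ k - b ^ k\<bar>"
proof -
  have *: "(x - y) ^ k \<le> x ^ k - y ^ k" if "0 \<le> y" "y \<le> x" for x y :: real
    using assms(3)
  proof (induction k rule: dec_induct)
    case (step n)
    have "(x - y) ^ Suc n \<le> (x - y) * (x ^ n - y ^ n)"
      using step that by (simp add: mult_left_mono)
    also have "\<dots> = x ^ Suc n - y ^ Suc n - (y * (x ^ n - y ^ n) + y ^ n * (x - y))"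
      by (simp add: algebra_simps)
    also have "\<dots> \<le> x ^ Suc n - y ^ Suc n"
    proof -
      have "0 \<le> y * (x ^ n - y ^ n)" "0 \<le> y ^ n * (x - y)"
        using that power_mono[OF that(2,1), of n] by (intro mult_nonneg_nonneg; simp)+
      then show ?thesis by linarith
    qed
    finally show ?case .
  qed simp
  show ?thesis
    using *[of b a] *[of a b] assms power_mono[of a b k] power_mono[of b a k]
    by (cases "b \<le> a") (auto simp: abs_if)
qed

text \<open>
  If \<open>\<bar>a - b\<bar> > d\<close>, then \<open>d\<^bsup>k-1\<^esup> \<bar>a - b\<bar>\<^sup>2 \<le> \<bar>a - b\<bar>\<^bsup>k+1\<^esup> \<le> (a - b) (a\<^sup>k - b\<^sup>k)\<close>.
\<close>

lemma square_diff_le_power_pairing: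
  fixes a b d :: real
  assumes "0 \<le> a" "0 \<le> b" "1 \<le> k" "0 < d"
  shows "(a - b) * (a - b) \<le> d\<^sup>2 + (1 / d ^ (k - 1)) * ((a - b) * (a ^ k - b ^ k))"
proof -
  have sgn: "(a - b) * (a ^ k - b ^ k) = \<bar>a - b\<bar> * \<bar>a ^ k - b ^ k\<bar>"
  proof (cases "b \<le> a")
    case True
    then have "b ^ k \<le> a ^ k" using assms by (intro power_mono)
    with True show ?thesis by simp
  next
    case False
    then have "a ^ k \<le> b ^ k" using assms by (intro power_mono) auto
    with False show ?thesis by (simp add: algebra_simps)
  qed
  then have nn: "0 \<le> (a - b) * (a ^ k - b ^ k)" by simp
  show ?thesis
  proof (cases "\<bar>a - b\<bar> \<le> d")
    case True
    then have "(a - b) * (a - b) \<le> d\<^sup>2"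
      using power_mono[of "\<bar>a - b\<bar>" d 2] by (simp add: power2_eq_square)
    moreover have "0 \<le> (1 / d ^ (k - 1)) * ((a - b) * (a ^ k - b ^ k))"
      by (rule mult_nonneg_nonneg[OF _ nn]) (use assms(4) in simp)
    ultimately show ?thesis by linarith
  next
    case False
    have "d ^ (k - 1) * ((a - b) * (a - b)) \<le> \<bar>a - b\<bar> ^ (k - 1) * (\<bar>a - b\<bar> * \<bar>a - b\<bar>)"
      unfolding abs_mult_self_eq using False assms(4) by (intro mult_right_mono power_mono) auto
    also have "\<dots> = \<bar>a - b\<bar> * \<bar>a - b\<bar> ^ k"
      using assms(3) by (cases k) (auto simp: mult_ac)
    also have "\<dots> \<le> \<bar>a - b\<bar> * \<bar>a ^ k - b ^ k\<bar>"
      using assms by (intro mult_left_mono abs_diff_power_le) auto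
    also have "\<dots> = (a - b) * (a ^ k - b ^ k)" by (simp add: sgn)
    finally have "(a - b) * (a - b) \<le> (1 / d ^ (k - 1)) * ((a - b) * (a ^ k - b ^ k))"
      using assms(4) by (simp add: pos_le_divide_eq mult.commute)
    then show ?thesis using zero_le_power2[of d] by linarith
  qed
qed

text \<open>
  The tangent at \<open>y\<close> lies below the graph of the convex function \<open>x\<^bsup>n+1\<^esup>/(n+1)\<close>.
\<close>

lemma power_convex:
  fixes x y :: real
  assumes "0 \<le> x" "0 \<le> y"
  shows "y ^ Suc n / real (Suc n) - x ^ Suc n / real (Suc n) \<le> (y - x) * y ^ n"
proof -
  have "real (Suc n) * ((y - x) * y ^ n) \<ge> y ^ Suc n - x ^ Suc n"
  proof (induction n)
    case (Suc n)
    have e: "(y - x) * (y ^ Suc n - x ^ Suc n) \<ge> 0"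
    proof (cases "x \<le> y")
      case True
      then show ?thesis using power_mono[OF True assms(1), of "Suc n"] by (intro mult_nonneg_nonneg) auto
    next
      case False
      then have "y ^ Suc n \<le> x ^ Suc n" using assms(2) by (intro power_mono) auto
      then show ?thesis using False by (intro mult_nonpos_nonpos) auto
    qed
    have "real (Suc (Suc n)) * ((y - x) * y ^ Suc n) = y * (real (Suc n) * ((y - x) * y ^ n)) + (y - x) * y ^ Suc n"
      by (simp add: algebra_simps)
    also have "\<dots> \<ge> y * (y ^ Suc n - x ^ Suc n) + (y - x) * y ^ Suc n"
      using mult_left_mono[OF Suc.IH assms(2)] by linarith
    finally have "real (Suc (Suc n)) * ((y - x) * y ^ Suc n) \<ge> y * (y ^ Suc n - x ^ Suc n) + (y - x) * y ^ Suc n" .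
    moreover have "y * (y ^ Suc n - x ^ Suc n) + (y - x) * y ^ Suc n
        = (y ^ Suc (Suc n) - x ^ Suc (Suc n)) + (y - x) * (y ^ Suc n - x ^ Suc n)"
      by (simp add: algebra_simps)
    ultimately show ?case using e by linarith
  qed simp
  then show ?thesis
    by (simp add: diff_divide_distrib[symmetric] pos_divide_le_eq mult.commute del: power_Suc)
qed

lemma power_diff_abs_le:
  fixes x a :: real
  assumes "x \<in> {0..1}" "a \<in> {0..1}"
  shows "\<bar>x ^ k - a ^ k\<bar> \<le> real k * \<bar>x - a\<bar>"
  using norm_power_diff[of x a k] assms by simp

text \<open>
  With \<open>A = x\<^sup>k - a\<^sup>k\<close> one has \<open>\<bar>A\<bar> \<le> d + A\<^sup>2/d\<close>, and \<open>A\<^sup>2 \<le> k (x - a) A\<close> because \<open>x\<^sup>k\<close> is increasing and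
  \<open>k\<close>-Lipschitz on \<open>[0,1]\<close>.
\<close>

lemma abs_power_diff_le_product:
  fixes x a d :: real
  assumes x: "x \<in> {0..1}" and a: "a \<in> {0..1}" and d: "0 < d" and k: "1 \<le> k"
  shows "\<bar>x ^ k - a ^ k\<bar> \<le> d + (real k / d) * ((x - a) * (x ^ k - a ^ k))"
proof -
  let ?A = "\<bar>x ^ k - a ^ k\<bar>"
  have P: "(x - a) * (x ^ k - a ^ k) = \<bar>x - a\<bar> * ?A"
  proof (cases "a \<le> x")
    case True
    then have "a ^ k \<le> x ^ k" using a by (intro power_mono) auto
    with True show ?thesis by simp
  next
    case False
    then have "x ^ k \<le> a ^ k" using x by (intro power_mono) auto
    with False show ?thesis by (simp add: algebra_simps)
  qed
  have "?A * ?A \<le> (real k * \<bar>x - a\<bar>) * ?A"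
    by (intro mult_right_mono power_diff_abs_le x a) simp
  then have AA: "?A * ?A \<le> real k * ((x - a) * (x ^ k - a ^ k))" unfolding P by (simp add: mult.assoc)
  have "d * ?A \<le> d * d + ?A * ?A"
  proof (cases "?A \<le> d")
    case True
    then have "d * ?A \<le> d * d" using d by (intro mult_left_mono) auto
    then show ?thesis using zero_le_square[of ?A] by linarith
  next
    case False
    then have "d * ?A \<le> ?A * ?A" by (intro mult_right_mono) auto
    then show ?thesis using zero_le_square[of d] by linarith
  qed
  also have "\<dots> \<le> d * d + real k * ((x - a) * (x ^ k - a ^ k))" using AA by simp
  finally have "?A * d \<le> d * d + real k * ((x - a) * (x ^ k - a ^ k))" by (simp only: mult.commute)
  also have "\<dots> = (d + (real k / d) * ((x - a) * (x ^ k - a ^ k))) * d"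
  proof -
    have "d * d + real k * p = (d + (real k / d) * p) * d" for p
      using d by (simp add: field_simps)
    then show ?thesis .
  qed
  finally have "?A * d \<le> (d + (real k / d) * ((x - a) * (x ^ k - a ^ k))) * d" .
  then show ?thesis by (rule mult_right_le_imp_le[OF _ d])
qed

lemma sum_inverse_squares_le_2: "(\<Sum>k<N. if k = 0 then 0 else 1 / (real k)\<^sup>2) \<le> 2"
proof -
  have "(\<Sum>k<Suc (Suc n). if k = 0 then 0 else 1 / (real k)\<^sup>2) \<le> 2 - 1 / real (Suc n)" for n
  proof (induction n)
    case (Suc n)
    have "1 / (real (Suc (Suc n)))\<^sup>2 \<le> 1 / real (Suc n) - 1 / real (Suc (Suc n))"
    proof -
      have "1 / (real (Suc (Suc n)))\<^sup>2 \<le> 1 / (real (Suc n) * real (Suc (Suc n)))"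
        unfolding power2_eq_square by (intro divide_left_mono mult_right_mono) auto
      also have "\<dots> = 1 / real (Suc n) - 1 / real (Suc (Suc n))"
        by (simp add: field_simps)
      finally show ?thesis .
    qed
    with Suc show ?case by simp
  qed simp
  note * = this
  consider "N = 0" | "N = 1" | n where "N = Suc (Suc n)" by (metis One_nat_def not0_implies_Suc)
  then show ?thesis
  proof cases
    case 3
    have "0 \<le> 1 / real (Suc n)" by simp
    then show ?thesis using *[of n] unfolding 3 by linarith
  qed simp_all
qed

section \<open>The monotone pairing of two solutions\<close>

definition monotone_pairing :: "nat \<Rightarrow> (real \<Rightarrow> real) \<Rightarrow> (real \<Rightarrow> real) \<Rightarrow> real" where
  "monotone_pairing m r1 r2 = L2_inner (\<lambda>u. r1 u - r2 u) (\<lambda>u. r1 u ^ m - r2 u ^ m)"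

text \<open>
  Oleinik's argument for one Fourier mode \<open>a\<close> with rate \<open>f\<close>.
\<close>

lemma primitive_coeff_energy_nonneg:
  fixes a f :: "real \<Rightarrow> real"
  assumes T: "0 \<le> T" and f: "integrable (leb T) f"
    and a: "\<And>t. t \<in> {0..T} \<Longrightarrow> a t = (LINT s|leb t. f s)"
  shows "0 \<le> (LINT t|leb T. a t * f t)"
proof -
  have "(LINT t|leb T. a t * f t) = (LINT t|leb T. (LINT s|leb t. f s) * f t)"
    using a by (intro Bochner_Integration.integral_cong) auto
  also have "\<dots> = (LINT t|leb T. f t)\<^sup>2 / 2"
    by (rule LINT_primitive_times_self[OF T f])
  finally have eq: "(LINT t|leb T. a t * f t) = (LINT t|leb T. f t)\<^sup>2 / 2" .
  show ?thesis unfolding eq by simp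
qed

locale pme_profile_pair = P1: pme_profile m T \<rho>1 + P2: pme_profile m T \<rho>2 for m T \<rho>1 \<rho>2
begin

text \<open>
  The function \<open>W\<close> is formed with the continuous representatives of the \<open>m\<close>-th powers, so that it has
  boundary values and its Fejer means converge pointwise.
\<close>

abbreviation "v t \<equiv> (\<lambda>u. \<rho>1 t u - \<rho>2 t u)"

abbreviation "W t \<equiv> (\<lambda>u. bdry_pow m (\<rho>1 t) u - bdry_pow m (\<rho>2 t) u)"

lemma T0: "0 \<le> T" using P1.T by simp

lemma v_bound: "t \<in> {0..T} \<Longrightarrow> u \<in> {0..1} \<Longrightarrow> \<bar>v t u\<bar> \<le> 1"
  using P1.range[of t u] P2.range[of t u] by auto

lemma v_measurable: "t \<in> {0..T} \<Longrightarrow> v t \<in> borel_measurable (leb 1)"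
  by (intro borel_measurable_diff P1.measurable_slice P2.measurable_slice)

lemma AE_v: "AE t in leb T. v t \<in> borel_measurable (leb 1) \<and> (\<forall>u\<in>{0..1}. \<bar>v t u\<bar> \<le> 1)"
  by (rule AE_I2) (use v_bound v_measurable in auto)

lemma AE_regular2: "AE t in leb T. t \<in> {0..T} \<and> regular_profile m (\<rho>1 t) \<and> regular_profile m (\<rho>2 t)"
proof -
  have "AE t in leb T. t \<in> {0..T}" by (rule AE_I2) simp
  then show ?thesis using P1.AE_regular P2.AE_regular by eventually_elim auto
qed

lemma regular_bounds:
  assumes "t \<in> {0..T}" "regular_profile m (\<rho>1 t)" "regular_profile m (\<rho>2 t)" "u \<in> {0..1}"
  shows "bdry_pow m (\<rho>1 t) u \<in> {0..1}" "bdry_pow m (\<rho>2 t) u \<in> {0..1}"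
  using regular_profile_bdry(1)[OF assms(2) P1.range[OF assms(1)] P1.m assms(4)]
    regular_profile_bdry(1)[OF assms(3) P2.range[OF assms(1)] P1.m assms(4)] by auto

lemma W_regular:
  assumes "t \<in> {0..T}" "regular_profile m (\<rho>1 t)" "regular_profile m (\<rho>2 t)"
  shows "continuous_on {0..1} (W t)" and "\<forall>u\<in>{0..1}. \<bar>W t u\<bar> \<le> 1"
proof -
  show "continuous_on {0..1} (W t)"
    using assms by (intro continuous_intros) (auto simp: regular_profile_def)
  show "\<forall>u\<in>{0..1}. \<bar>W t u\<bar> \<le> 1"
    using regular_bounds[OF assms] by fastforce
qed

lemma coeff_v:
  assumes "C = cos_coeff \<or> C = sin_coeff" "t \<in> {0..T}"
  shows "C k (v t) = C k (\<rho>1 t) - C k (\<rho>2 t)"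
  using P1.AE_power_le[OF assms(2), of 1] P2.AE_power_le[OF assms(2), of 1]
  by (intro coeff_diff[OF assms(1) P1.measurable_slice _ P2.measurable_slice] assms(2)) simp_all

lemma coeff_W:
  assumes "C = cos_coeff \<or> C = sin_coeff" "t \<in> {0..T}" "regular_profile m (\<rho>1 t)" "regular_profile m (\<rho>2 t)"
  shows "C k (W t) = C k (\<lambda>u. \<rho>1 t u ^ m) - C k (\<lambda>u. \<rho>2 t u ^ m)"
proof -
  have c: "continuous_on {0..1} (bdry_pow m (\<rho>1 t))" "continuous_on {0..1} (bdry_pow m (\<rho>2 t))"
    using assms by (auto simp: regular_profile_def)
  have "AE u in leb 1. \<bar>bdry_pow m (\<rho>1 t) u\<bar> \<le> 1" "AE u in leb 1. \<bar>bdry_pow m (\<rho>2 t) u\<bar> \<le> 1"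
    by (rule AE_I2, use regular_bounds[OF assms(2-4)] in force)+
  from coeff_diff[OF assms(1) measurable_continuous_Icc[OF c(1)] this(1) measurable_continuous_Icc[OF c(2)] this(2)]
  show ?thesis
    using assms(1) P1.coeff_regular[OF assms(3,2)] P2.coeff_regular[OF assms(4,2)] by auto
qed

lemma measurable_coeff_v:
  assumes "C = cos_coeff \<or> C = sin_coeff"
  shows "(\<lambda>t. C k (v t)) \<in> borel_measurable (leb T)"
proof -
  have "(\<lambda>t. C k (\<rho>1 t) - C k (\<rho>2 t)) \<in> borel_measurable (leb T)"
    using assms P1.measurable_coeff P2.measurable_coeff by auto
  then show ?thesis
    by (rule measurable_lebesgue_cong[THEN iffD1, rotated]) (simp add: coeff_v[OF assms])
qed

lemma AE_coeff_W:
  assumes "C = cos_coeff \<or> C = sin_coeff"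
  shows "AE t in leb T. C k (\<lambda>u. \<rho>1 t u ^ m) - C k (\<lambda>u. \<rho>2 t u ^ m) = C k (W t)"
  using AE_regular2 by eventually_elim (use coeff_W[OF assms] in auto)

lemma measurable_coeff_diff:
  assumes "C = cos_coeff \<or> C = sin_coeff"
  shows "(\<lambda>t. C k (\<lambda>u. \<rho>1 t u ^ m) - C k (\<lambda>u. \<rho>2 t u ^ m)) \<in> borel_measurable (leb T)"
  using assms P1.measurable_coeff_power P2.measurable_coeff_power by auto

lemma measurable_coeff_W:
  assumes "C = cos_coeff \<or> C = sin_coeff"
  shows "(\<lambda>t. C k (W t)) \<in> borel_measurable (leb T)"
  by (rule measurable_AE_lebesgue_on[OF measurable_coeff_diff[OF assms] _ AE_coeff_W[OF assms]]) simp

lemma pairing_regular: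
  assumes t: "t \<in> {0..T}" "regular_profile m (\<rho>1 t)" "regular_profile m (\<rho>2 t)"
  shows "L2_inner (v t) (W t) = monotone_pairing m (\<rho>1 t) (\<rho>2 t)"
  unfolding monotone_pairing_def L2_inner_def
proof (rule integral_cong_AE)
  show "(\<lambda>u. v t u * W t u) \<in> borel_measurable (leb 1)"
    by (intro borel_measurable_times v_measurable t measurable_continuous_Icc W_regular)
  show "(\<lambda>u. v t u * (\<rho>1 t u ^ m - \<rho>2 t u ^ m)) \<in> borel_measurable (leb 1)"
    by (intro borel_measurable_times v_measurable borel_measurable_diff borel_measurable_power
        P1.measurable_slice P2.measurable_slice t)
  have "AE u in leb 1. \<rho>1 t u ^ m = bdry_pow m (\<rho>1 t) u" "AE u in leb 1. \<rho>2 t u ^ m = bdry_pow m (\<rho>2 t) u"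
    using t by (auto simp: regular_profile_def)
  then show "AE u in leb 1. v t u * W t u = v t u * (\<rho>1 t u ^ m - \<rho>2 t u ^ m)"
    by eventually_elim simp
qed

lemma measurable_rectangle:
  "(\<lambda>(t, u). (\<rho>1 t u - \<rho>2 t u) * (\<rho>1 t u ^ j - \<rho>2 t u ^ j)) \<in> borel_measurable (lebesgue_on ({0..T} \<times> {0..1}))"
proof -
  have "(\<lambda>p. \<rho>1 (fst p) (snd p)) \<in> borel_measurable (lebesgue_on ({0..T} \<times> {0..1}))"
    "(\<lambda>p. \<rho>2 (fst p) (snd p)) \<in> borel_measurable (lebesgue_on ({0..T} \<times> {0..1}))"
    using P1.adm P2.adm unfolding pme_admissible_def case_prod_beta by blast+
  then show ?thesis
    unfolding case_prod_beta by (intro borel_measurable_times borel_measurable_diff borel_measurable_power)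
qed

lemma rectangle_bound:
  assumes "t \<in> {0..T}" "u \<in> {0..1}"
  shows "\<bar>(\<rho>1 t u - \<rho>2 t u) * (\<rho>1 t u ^ j - \<rho>2 t u ^ j)\<bar> \<le> 1 * 1"
  unfolding abs_mult
  using v_bound[OF assms] P1.power_range[OF assms, of j] P2.power_range[OF assms, of j]
  by (intro mult_mono) auto

lemma measurable_pairing:
  "(\<lambda>t. monotone_pairing j (\<rho>1 t) (\<rho>2 t)) \<in> borel_measurable (leb T)"
  unfolding monotone_pairing_def L2_inner_def
  by (rule fubini_rectangle(1)[OF measurable_rectangle rectangle_bound])

lemma abs_pairing_le: "t \<in> {0..T} \<Longrightarrow> \<bar>monotone_pairing j (\<rho>1 t) (\<rho>2 t)\<bar> \<le> 1"
  unfolding monotone_pairing_def by (rule abs_L2_inner_le) (use rectangle_bound in \<open>auto intro!: AE_I2\<close>)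

lemma integrable_pairing: "integrable (leb T) (\<lambda>t. monotone_pairing j (\<rho>1 t) (\<rho>2 t))"
  by (rule integrable_bounded_Icc[OF measurable_pairing, of _ 1]) (use abs_pairing_le in \<open>auto intro!: AE_I2\<close>)

lemma dist_square_eq: "(L2_spacetime_dist T \<rho>1 \<rho>2)\<^sup>2 = (LINT t|leb T. monotone_pairing 1 (\<rho>1 t) (\<rho>2 t))"
proof -
  have "(LINT (t, u)|lebesgue_on ({0..T} \<times> {0..1}). (\<rho>1 t u - \<rho>2 t u)\<^sup>2)
      = (LINT (t, u)|lebesgue_on ({0..T} \<times> {0..1}). (\<rho>1 t u - \<rho>2 t u) * (\<rho>1 t u ^ 1 - \<rho>2 t u ^ 1))"
    by (simp add: power2_eq_square)
  also have "\<dots> = (LINT t|leb T. monotone_pairing 1 (\<rho>1 t) (\<rho>2 t))"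
    unfolding monotone_pairing_def L2_inner_def
    by (rule fubini_rectangle(2)[OF measurable_rectangle rectangle_bound])
  moreover have "0 \<le> (LINT (t, u)|lebesgue_on ({0..T} \<times> {0..1}). (\<rho>1 t u - \<rho>2 t u)\<^sup>2)"
    by (intro Bochner_Integration.integral_nonneg) auto
  ultimately show ?thesis
    by (simp add: L2_spacetime_dist_def)
qed

text \<open>
  An interpolation: small differences are estimated by \<open>d\<close>, large ones by the monotone pairing.
\<close>

lemma pairing_1_le:
  assumes d: "0 < d" and t: "t \<in> {0..T}"
  shows "monotone_pairing 1 (\<rho>1 t) (\<rho>2 t) \<le> d\<^sup>2 + (1 / d ^ (m - 1)) * monotone_pairing m (\<rho>1 t) (\<rho>2 t)"
proof -
  have int: "integrable (leb 1) (\<lambda>u. (\<rho>1 t u - \<rho>2 t u) * (\<rho>1 t u ^ j - \<rho>2 t u ^ j))" for j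
    by (rule integrable_bounded_Icc[where B = 1])
       (use t rectangle_bound in \<open>auto intro!: AE_I2 borel_measurable_times borel_measurable_diff borel_measurable_power
          P1.measurable_slice P2.measurable_slice\<close>)
  have "monotone_pairing 1 (\<rho>1 t) (\<rho>2 t)
      \<le> (LINT u|leb 1. d\<^sup>2 + (1 / d ^ (m - 1)) * ((\<rho>1 t u - \<rho>2 t u) * (\<rho>1 t u ^ m - \<rho>2 t u ^ m)))"
    unfolding monotone_pairing_def L2_inner_def
  proof (rule Bochner_Integration.integral_mono)
    fix u :: real assume "u \<in> space (leb 1)"
    then have "u \<in> {0..1}" by simp
    then show "(\<rho>1 t u - \<rho>2 t u) * (\<rho>1 t u ^ 1 - \<rho>2 t u ^ 1)
      \<le> d\<^sup>2 + (1 / d ^ (m - 1)) * ((\<rho>1 t u - \<rho>2 t u) * (\<rho>1 t u ^ m - \<rho>2 t u ^ m))"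
      using square_diff_le_power_pairing[of "\<rho>1 t u" "\<rho>2 t u" m d] P1.range[OF t] P2.range[OF t] P1.m d by auto
  qed (intro int Bochner_Integration.integrable_add integrable_const_Icc integrable_mult_right)+
  also have "\<dots> = d\<^sup>2 + (1 / d ^ (m - 1)) * monotone_pairing m (\<rho>1 t) (\<rho>2 t)"
    unfolding monotone_pairing_def L2_inner_def
    by (subst Bochner_Integration.integral_add[OF integrable_const_Icc integrable_mult_right[OF int]])
       (simp only: LINT_const_Icc[OF zero_le_one], simp)
  finally show ?thesis .
qed

lemma dist_square_le:
  assumes d: "0 < d"
  shows "(L2_spacetime_dist T \<rho>1 \<rho>2)\<^sup>2
    \<le> T * d\<^sup>2 + (1 / d ^ (m - 1)) * (LINT t|leb T. monotone_pairing m (\<rho>1 t) (\<rho>2 t))"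
proof -
  have "(L2_spacetime_dist T \<rho>1 \<rho>2)\<^sup>2
      \<le> (LINT t|leb T. d\<^sup>2 + (1 / d ^ (m - 1)) * monotone_pairing m (\<rho>1 t) (\<rho>2 t))"
    unfolding dist_square_eq
    by (rule Bochner_Integration.integral_mono)
       (use pairing_1_le[OF d] in \<open>auto intro!: integrable_pairing Bochner_Integration.integrable_add
         integrable_const_Icc integrable_mult_right\<close>)
  also have "\<dots> = T * d\<^sup>2 + (1 / d ^ (m - 1)) * (LINT t|leb T. monotone_pairing m (\<rho>1 t) (\<rho>2 t))"
    by (subst Bochner_Integration.integral_add[OF integrable_const_Icc integrable_mult_right[OF integrable_pairing]])
       (simp only: LINT_const_Icc[OF T0], simp)
  finally show ?thesis .
qed

end

section \<open>Comparison with the Neumann and Dirichlet solutions\<close>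

context pme_profile_pair
begin

lemma LINT_pairing_eq: "(LINT t|leb T. L2_inner (v t) (W t)) = (LINT t|leb T. monotone_pairing m (\<rho>1 t) (\<rho>2 t))"
proof -
  have ae: "AE t in leb T. monotone_pairing m (\<rho>1 t) (\<rho>2 t) = L2_inner (v t) (W t)"
    using AE_regular2 by eventually_elim (use pairing_regular in auto)
  show ?thesis
    by (rule integral_cong_AE[OF measurable_AE_lebesgue_on[OF measurable_pairing _ ae] measurable_pairing])
       (use ae in \<open>auto elim: eventually_mono\<close>)
qed

lemma abs_coeff_v_le: "t \<in> {0..T} \<Longrightarrow> \<bar>cos_coeff k (v t)\<bar> \<le> 1" "t \<in> {0..T} \<Longrightarrow> \<bar>sin_coeff k (v t)\<bar> \<le> 1"
proof -
  have "AE u in leb 1. \<bar>v t u\<bar> \<le> 1" if "t \<in> {0..T}"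
    by (rule AE_I2) (use that v_bound in auto)
  then show "t \<in> {0..T} \<Longrightarrow> \<bar>cos_coeff k (v t)\<bar> \<le> 1" "t \<in> {0..T} \<Longrightarrow> \<bar>sin_coeff k (v t)\<bar> \<le> 1"
    using abs_coeff_le[of "v t" 1 k] by auto
qed

lemma AE_abs_coeff_W_le:
  "AE t in leb T. \<bar>cos_coeff k (W t)\<bar> \<le> 1"
  using AE_regular2
proof eventually_elim
  case (elim t)
  have "AE u in leb 1. \<bar>W t u\<bar> \<le> 1"
    by (rule AE_I2) (use elim W_regular in auto)
  then show ?case by (rule abs_coeff_le) simp
qed

text \<open>
  For \<open>k > 0\<close> the energy identity of the \<open>k\<close>-th mode bounds \<open>(k \<pi>)\<^sup>2 \<integral> a\<^sub>k b\<^sub>k\<close> by the flux term, which is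
  \<open>O(\<kappa>)\<close>.  The mode \<open>k = 0\<close> is not damped by diffusion, but the difference of the two masses
  changes through the fluxes only and is itself \<open>O(\<kappa>)\<close>.
\<close>

lemma robin_neumann_pairing_le:
  assumes ab: "\<alpha> \<in> {0..1}" "\<beta> \<in> {0..1}" and \<kappa>: "0 \<le> \<kappa>"
    and sol1: "robin_weak_solution m T \<alpha> \<beta> \<kappa> g \<rho>1" and sol2: "robin_weak_solution m T \<alpha> \<beta> 0 g \<rho>2"
  shows "(LINT t|leb T. monotone_pairing m (\<rho>1 t) (\<rho>2 t)) \<le> (2 * T\<^sup>2 + 8 * T) * \<kappa>"
proof -
  let ?M = "leb T"
  define j where "j k s = (\<alpha> - bdry m (\<rho>1 s) 0) + (- 1) ^ k * (\<beta> - bdry m (\<rho>1 s) 1)" for k :: nat and s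
  define f where "f k s = - (real k * pi)\<^sup>2 * cos_coeff k (W s) + \<kappa> * j k s" for k s
  have jm: "j k \<in> borel_measurable ?M" for k
    unfolding j_def[abs_def]
    by (intro borel_measurable_add borel_measurable_times borel_measurable_diff borel_measurable_const P1.measurable_bdry) auto
  have j2: "AE s in ?M. \<bar>j k s\<bar> \<le> 2" for k
  proof -
    have "AE s in ?M. bdry m (\<rho>1 s) 0 \<in> {0..1}" "AE s in ?M. bdry m (\<rho>1 s) 1 \<in> {0..1}"
      using P1.AE_bdry(2)[of 0] P1.AE_bdry(2)[of 1] by auto
    then show ?thesis
    proof eventually_elim
      case (elim s)
      have "\<bar>(- 1) ^ k * (\<beta> - bdry m (\<rho>1 s) 1)\<bar> = \<bar>\<beta> - bdry m (\<rho>1 s) 1\<bar>"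
        by (simp add: abs_mult power_abs)
      then show ?case using elim ab unfolding j_def by auto
    qed
  qed
  have Wm: "(\<lambda>s. cos_coeff k (W s)) \<in> borel_measurable ?M" for k
    by (rule measurable_coeff_W) simp
  have vm: "(\<lambda>s. cos_coeff k (v s)) \<in> borel_measurable ?M" for k
    by (rule measurable_coeff_v) simp
  have ij: "integrable ?M (j k)" for k by (rule integrable_bounded_Icc[OF jm j2])
  have iW: "integrable ?M (\<lambda>s. cos_coeff k (W s))" for k
    by (rule integrable_bounded_Icc[OF Wm AE_abs_coeff_W_le])
  have "f k = (\<lambda>s. - (real k * pi)\<^sup>2 * cos_coeff k (W s) + \<kappa> * j k s)" for k
    by (simp add: f_def[abs_def])
  then have if0: "integrable ?M (f k)" for k
    using ij iW by (auto intro!: Bochner_Integration.integrable_add)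
  have prim: "cos_coeff k (v t) = (LINT s|leb t. f k s)" if t: "t \<in> {0..T}" for k t
  proof -
    let ?Mt = "leb t"
    have i1: "integrable ?Mt (\<lambda>s. - (real k * pi)\<^sup>2 * cos_coeff k (\<lambda>u. \<rho>1 s u ^ m) + \<kappa> * j k s)"
      using P1.integrable_solution_data(1)[OF t] integrable_subinterval[OF ij, of 0 t] t
      by (intro Bochner_Integration.integrable_add integrable_mult_right) auto
    have i2: "integrable ?Mt (\<lambda>s. - (real k * pi)\<^sup>2 * cos_coeff k (\<lambda>u. \<rho>2 s u ^ m))"
      using P2.integrable_solution_data(1)[OF t] by (intro integrable_mult_right) auto
    have ae: "AE s in ?Mt. (- (real k * pi)\<^sup>2 * cos_coeff k (\<lambda>u. \<rho>1 s u ^ m) + \<kappa> * j k s)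
        - (- (real k * pi)\<^sup>2 * cos_coeff k (\<lambda>u. \<rho>2 s u ^ m)) = f k s"
      by (rule AE_Icc_subset[where a = 0 and b = T])
         (use AE_coeff_W[OF disjI1[OF refl], of k] t in \<open>auto elim!: eventually_mono simp: f_def algebra_simps\<close>)
    have "cos_coeff k (v t) = cos_coeff k (\<rho>1 t) - cos_coeff k (\<rho>2 t)"
      by (rule coeff_v[OF _ t]) simp
    also have "\<dots> = (LINT s|?Mt. (- (real k * pi)\<^sup>2 * cos_coeff k (\<lambda>u. \<rho>1 s u ^ m) + \<kappa> * j k s))
        - (LINT s|?Mt. - (real k * pi)\<^sup>2 * cos_coeff k (\<lambda>u. \<rho>2 s u ^ m))"
      using P1.robin_cos_coeff[OF sol1 t, of k] P2.robin_cos_coeff[OF sol2 t, of k] by (simp add: j_def)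
    also have "\<dots> = (LINT s|?Mt. (- (real k * pi)\<^sup>2 * cos_coeff k (\<lambda>u. \<rho>1 s u ^ m) + \<kappa> * j k s)
        - (- (real k * pi)\<^sup>2 * cos_coeff k (\<lambda>u. \<rho>2 s u ^ m)))"
      by (rule Bochner_Integration.integral_diff[OF i1 i2, symmetric])
    also have "\<dots> = (LINT s|?Mt. f k s)"
      using ae borel_measurable_integrable[OF Bochner_Integration.integrable_diff[OF i1 i2]]
      by (intro integral_cong_AE measurable_AE_lebesgue_on[OF _ _ ae]) auto
    finally show ?thesis .
  qed
  have ivj: "integrable ?M (\<lambda>t. cos_coeff k (v t) * j k t)" and
    bvj: "AE t in ?M. \<bar>cos_coeff k (v t) * j k t\<bar> \<le> 1 * 2" for k
  proof -
    show *: "AE t in ?M. \<bar>cos_coeff k (v t) * j k t\<bar> \<le> 1 * 2"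
      by (rule lebesgue_on_mono[OF j2]) (unfold abs_mult, intro mult_mono abs_coeff_v_le, auto)
    show "integrable ?M (\<lambda>t. cos_coeff k (v t) * j k t)"
      by (rule integrable_bounded_Icc[OF _ *]) (intro borel_measurable_times vm jm)
  qed
  have ivW: "integrable ?M (\<lambda>t. cos_coeff k (v t) * cos_coeff k (W t))" for k
  proof -
    have *: "AE t in ?M. \<bar>cos_coeff k (v t) * cos_coeff k (W t)\<bar> \<le> 1 * 1"
      by (rule lebesgue_on_mono[OF AE_abs_coeff_W_le]) (unfold abs_mult, intro mult_mono abs_coeff_v_le, auto)
    show ?thesis
      by (rule integrable_bounded_Icc[OF _ *]) (intro borel_measurable_times vm Wm)
  qed
  have vW_le: "(real k * pi)\<^sup>2 * (LINT t|?M. cos_coeff k (v t) * cos_coeff k (W t)) \<le> 2 * T * \<kappa>" for k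
  proof -
    have "0 \<le> (LINT t|?M. cos_coeff k (v t) * f k t)"
      by (rule primitive_coeff_energy_nonneg[OF T0 if0 prim])
    also have "\<dots> = (LINT t|?M. - (real k * pi)\<^sup>2 * (cos_coeff k (v t) * cos_coeff k (W t)) + \<kappa> * (cos_coeff k (v t) * j k t))"
      by (simp add: f_def algebra_simps)
    also have "\<dots> = - (real k * pi)\<^sup>2 * (LINT t|?M. cos_coeff k (v t) * cos_coeff k (W t))
        + \<kappa> * (LINT t|?M. cos_coeff k (v t) * j k t)"
      by (subst Bochner_Integration.integral_add[OF integrable_mult_right[OF ivW] integrable_mult_right[OF ivj]]) simp
    finally have "(real k * pi)\<^sup>2 * (LINT t|?M. cos_coeff k (v t) * cos_coeff k (W t)) \<le> \<kappa> * (LINT t|?M. cos_coeff k (v t) * j k t)"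
      by simp
    also have "\<dots> \<le> \<kappa> * (2 * T)"
      using LINT_abs_le_Icc[OF T0 bvj, of k] by (intro mult_left_mono \<kappa>) auto
    finally show ?thesis by (simp add: mult_ac)
  qed
  \<comment> \<open>The factor \<open>1 / \<pi>\<^sup>2\<close> is dropped for \<open>k > 0\<close>.\<close>
  define e where "e k = (if k = 0 then 2 * T\<^sup>2 * \<kappa> else 2 * T * \<kappa> * (1 / (real k)\<^sup>2))" for k :: nat
  have le: "(LINT t|?M. cos_coeff k (v t) * cos_coeff k (W t)) \<le> e k" for k
  proof (cases "k = 0")
    case True
    have "\<bar>LINT t|?M. cos_coeff 0 (v t) * cos_coeff 0 (W t)\<bar> \<le> (T - 0) * (2 * T * \<kappa>)"
    proof (rule LINT_abs_le_Icc[OF T0])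
      show "AE t in ?M. \<bar>cos_coeff 0 (v t) * cos_coeff 0 (W t)\<bar> \<le> 2 * T * \<kappa>"
      proof (rule lebesgue_on_mono[OF AE_abs_coeff_W_le[of 0]])
        fix t assume W: "\<bar>cos_coeff 0 (W t)\<bar> \<le> 1" and t: "t \<in> {0..T}"
        have "\<bar>cos_coeff 0 (v t)\<bar> \<le> (t - 0) * (2 * \<kappa>)"
          unfolding prim[OF t]
        proof (rule LINT_abs_le_Icc)
          show "AE s in leb t. \<bar>f 0 s\<bar> \<le> 2 * \<kappa>"
            by (rule AE_Icc_subset[where a = 0 and b = T])
               (use j2[of 0] t \<kappa> in \<open>auto elim!: eventually_mono simp: f_def abs_mult mult.commute intro: mult_left_mono\<close>)
        qed (use t \<kappa> in auto)
        also have "\<dots> \<le> 2 * T * \<kappa>"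
          using t \<kappa> mult_right_mono[of t T "2 * \<kappa>"] by auto
        finally show "\<bar>cos_coeff 0 (v t) * cos_coeff 0 (W t)\<bar> \<le> 2 * T * \<kappa>"
          using mult_mono[OF _ W, of "\<bar>cos_coeff 0 (v t)\<bar>" "2 * T * \<kappa>"] T0 \<kappa> by (simp add: abs_mult)
      qed
    qed (use T0 \<kappa> in auto)
    then show ?thesis using True by (auto simp: e_def power2_eq_square mult_ac)
  next
    case False
    let ?I = "LINT t|?M. cos_coeff k (v t) * cos_coeff k (W t)"
    have "(real k * pi)\<^sup>2 * ?I \<le> 2 * T * \<kappa>" by (rule vW_le)
    also have "\<dots> \<le> pi\<^sup>2 * (2 * T * \<kappa>)"
    proof -
      have "1 * 1 \<le> pi * pi" using pi_gt3 by (intro mult_mono) auto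
      then show ?thesis using T0 \<kappa> mult_right_mono[of 1 "pi\<^sup>2" "2 * T * \<kappa>"] by (simp add: power2_eq_square)
    qed
    finally have "pi\<^sup>2 * ((real k)\<^sup>2 * ?I) \<le> pi\<^sup>2 * (2 * T * \<kappa>)"
      by (simp add: power_mult_distrib mult_ac)
    then have "(real k)\<^sup>2 * ?I \<le> 2 * T * \<kappa>"
      by (rule mult_left_le_imp_le) simp
    then show ?thesis using False by (simp add: e_def pos_le_divide_eq mult.commute)
  qed
  have sum: "(\<Sum>k<N. fejer_coeff N k * e k) \<le> (2 * T\<^sup>2 + 8 * T) * \<kappa>" for N
  proof -
    have "fejer_coeff N k * e k \<le> (if k = 0 then 2 * T\<^sup>2 * \<kappa> else 0) + 4 * T * \<kappa> * (if k = 0 then 0 else 1 / (real k)\<^sup>2)" for k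
    proof (cases "k = 0")
      case False
      have "fejer_coeff N k * e k \<le> 2 * e k"
        by (rule mult_right_mono[OF fejer_coeff_le_2]) (use T0 \<kappa> in \<open>simp add: e_def\<close>)
      then show ?thesis using False by (simp add: e_def)
    qed (simp add: e_def fejer_coeff_def)
    then have "(\<Sum>k<N. fejer_coeff N k * e k)
      \<le> (\<Sum>k<N. (if k = 0 then 2 * T\<^sup>2 * \<kappa> else 0) + 4 * T * \<kappa> * (if k = 0 then 0 else 1 / (real k)\<^sup>2))"
      by (intro sum_mono)
    also have "\<dots> = (\<Sum>k<N. if k = 0 then 2 * T\<^sup>2 * \<kappa> else 0) + 4 * T * \<kappa> * (\<Sum>k<N. if k = 0 then 0 else 1 / (real k)\<^sup>2)"
      by (simp add: sum.distrib sum_distrib_left)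
    also have "\<dots> \<le> 2 * T\<^sup>2 * \<kappa> + 4 * T * \<kappa> * 2"
      using T0 \<kappa> by (intro add_mono mult_left_mono sum_inverse_squares_le_2) auto
    finally show ?thesis by (simp add: algebra_simps)
  qed
  have "(LINT t|?M. L2_inner (v t) (W t)) \<le> (2 * T\<^sup>2 + 8 * T) * \<kappa>"
  proof (rule LINT_L2_inner_le_by_coeffs[where C = cos_coeff and A = 1 and B = 1 and e = e])
    show "AE t in ?M. continuous_on {0..1} (W t) \<and> (\<forall>u\<in>{0..1}. \<bar>W t u\<bar> \<le> 1)"
      using AE_regular2 by eventually_elim (use W_regular in auto)
  qed (use AE_v vm Wm le sum in auto)
  then show ?thesis by (simp only: LINT_pairing_eq)
qed

text \<open>
  Let \<open>l\<close> be the affine function with the boundary values of \<open>W\<close>.  In the rate of the \<open>k\<close>-th sine mode of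
  \<open>v\<close> the boundary terms are exactly \<open>(k \<pi>)\<^sup>2\<close> times the coefficient of \<open>l\<close>, so that the rate is
  \<open>- (k \<pi>)\<^sup>2\<close> times the coefficient of \<open>Z = W - l\<close>.  Therefore the pairing of \<open>v\<close> with \<open>Z\<close> is nonpositive
  after integration in time, and the pairing with \<open>l\<close> is bounded by the boundary values.
\<close>

lemma robin_dirichlet_pairing_le:
  assumes sol1: "robin_weak_solution m T \<alpha> \<beta> \<kappa> g \<rho>1" and sol2: "dirichlet_weak_solution m T \<alpha> \<beta> g \<rho>2"
    and ab: "\<alpha> \<in> {0..1}" "\<beta> \<in> {0..1}"
  shows "(LINT t|leb T. monotone_pairing m (\<rho>1 t) (\<rho>2 t))
    \<le> (LINT t|leb T. \<bar>bdry_pow m (\<rho>1 t) 0 - \<alpha> ^ m\<bar> + \<bar>bdry_pow m (\<rho>1 t) 1 - \<beta> ^ m\<bar>)"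
proof -
  let ?M = "leb T"
  define A B where "A t = bdry_pow m (\<rho>1 t) 0 - \<alpha> ^ m" and "B t = bdry_pow m (\<rho>1 t) 1 - \<beta> ^ m" for t
  define l where "l t u = (1 - u) * A t + u * B t" for t u
  define Z where "Z t u = W t u - l t u" for t u
  define b where "b k t = sin_coeff k (Z t)" for k t
  have Am: "A \<in> borel_measurable ?M" "B \<in> borel_measurable ?M"
    unfolding A_def[abs_def] B_def[abs_def]
    by (intro borel_measurable_diff borel_measurable_const P1.measurable_bdry_pow; simp)+
  have \<alpha>\<beta>: "0 \<le> \<alpha> ^ m" "\<alpha> ^ m \<le> 1" "0 \<le> \<beta> ^ m" "\<beta> ^ m \<le> 1" using ab by (auto intro: power_le_one)
  have AB1: "AE t in ?M. t \<in> {0..T} \<and> regular_profile m (\<rho>1 t) \<and> regular_profile m (\<rho>2 t) \<and> \<bar>A t\<bar> \<le> 1 \<and> \<bar>B t\<bar> \<le> 1"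
    using AE_regular2
  proof eventually_elim
    case (elim t)
    then have "bdry_pow m (\<rho>1 t) 0 \<in> {0..1}" "bdry_pow m (\<rho>1 t) 1 \<in> {0..1}"
      using regular_bounds[of t 0] regular_bounds[of t 1] by auto
    then show ?case using elim \<alpha>\<beta> by (auto simp: A_def B_def)
  qed
  have lc: "continuous_on S (l t)" for S t unfolding l_def[abs_def] by (intro continuous_intros)
  have l_le: "\<bar>l t u\<bar> \<le> \<bar>A t\<bar> + \<bar>B t\<bar>" if "u \<in> {0..1}" for t u
  proof -
    have "\<bar>l t u\<bar> \<le> \<bar>(1 - u) * A t\<bar> + \<bar>u * B t\<bar>" unfolding l_def by (rule abs_triangle_ineq)
    also have "\<dots> \<le> 1 * \<bar>A t\<bar> + 1 * \<bar>B t\<bar>"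
      unfolding abs_mult using that by (intro add_mono mult_right_mono) auto
    finally show ?thesis by simp
  qed
  \<comment> \<open>The bound 3 comes from \<open>\<bar>W\<bar> \<le> 1\<close> and \<open>\<bar>l\<bar> \<le> \<bar>A\<bar> + \<bar>B\<bar> \<le> 2\<close>.\<close>
  have Z: "AE t in ?M. continuous_on {0..1} (Z t) \<and> (\<forall>u\<in>{0..1}. \<bar>Z t u\<bar> \<le> 3)"
    using AB1
  proof eventually_elim
    case (elim t)
    have "continuous_on {0..1} (Z t)"
      unfolding Z_def[abs_def] by (intro continuous_on_diff[OF W_regular(1) lc]) (use elim in auto)
    moreover have "\<bar>Z t u\<bar> \<le> 3" if u: "u \<in> {0..1}" for u
    proof -
      have "\<bar>W t u\<bar> \<le> 1" using W_regular(2)[of t] elim u by blast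
      then show ?thesis using l_le[OF u, of t] elim unfolding Z_def by linarith
    qed
    ultimately show ?case by blast
  qed
  define f where "f k s = (- (real k * pi)\<^sup>2) * b k s" for k s
  define F where "F k s = (- (real k * pi)\<^sup>2 * sin_coeff k (\<lambda>u. \<rho>1 s u ^ m) - real k * pi * ((- 1) ^ k * bdry_pow m (\<rho>1 s) 1 - bdry_pow m (\<rho>1 s) 0))
     - (- (real k * pi)\<^sup>2 * sin_coeff k (\<lambda>u. \<rho>2 s u ^ m) - real k * pi * ((- 1) ^ k * \<beta> ^ m - \<alpha> ^ m))" for k s
  have b_eq: "AE s in ?M. sin_coeff k (W s) - sin_coeff k (l s) = b k s" for k
    using AB1
  proof eventually_elim
    case (elim t)
    have c: "continuous_on {0..1} (W t)" using elim W_regular by auto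
    have "AE u in leb 1. \<bar>W t u\<bar> \<le> 1"
      by (rule AE_I2) (use W_regular(2)[of t] elim in auto)
    moreover have "AE u in leb 1. \<bar>l t u\<bar> \<le> \<bar>A t\<bar> + \<bar>B t\<bar>"
      by (rule AE_I2) (use l_le in auto)
    ultimately show ?case
      using coeff_diff[of sin_coeff "W t" 1 "l t" _ k] measurable_continuous_Icc[OF c] measurable_continuous_Icc[OF lc]
      unfolding b_def Z_def[abs_def] by simp
  qed
  have Ff: "AE s in ?M. F k s = f k s" for k
    using AB1 b_eq[of k] AE_coeff_W[OF disjI2[OF refl], of k]
  proof eventually_elim
    case (elim s)
    have "sin_coeff k (\<lambda>u. \<rho>1 s u ^ m) - sin_coeff k (\<lambda>u. \<rho>2 s u ^ m) = sin_coeff k (W s)" using elim by simp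
    moreover have "(real k * pi)\<^sup>2 * sin_coeff k (l s) = - (real k * pi * ((- 1) ^ k * B s - A s))"
      unfolding l_def[abs_def] by (rule sin_coeff_linear)
    moreover have "F k s = - (real k * pi)\<^sup>2 * (sin_coeff k (\<lambda>u. \<rho>1 s u ^ m) - sin_coeff k (\<lambda>u. \<rho>2 s u ^ m))
       - real k * pi * ((- 1) ^ k * B s - A s)"
      by (simp add: F_def A_def B_def algebra_simps)
    moreover have "f k s = - (real k * pi)\<^sup>2 * sin_coeff k (W s) + (real k * pi)\<^sup>2 * sin_coeff k (l s)"
      using elim unfolding f_def by (simp add: algebra_simps flip: elim(2))
    ultimately show ?case by simp
  qed
  have iF1: "integrable (leb t) (\<lambda>s. - (real k * pi)\<^sup>2 * sin_coeff k (\<lambda>u. \<rho>1 s u ^ m) - real k * pi * ((- 1) ^ k * bdry_pow m (\<rho>1 s) 1 - bdry_pow m (\<rho>1 s) 0))"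
    and iF2: "integrable (leb t) (\<lambda>s. - (real k * pi)\<^sup>2 * sin_coeff k (\<lambda>u. \<rho>2 s u ^ m) - real k * pi * ((- 1) ^ k * \<beta> ^ m - \<alpha> ^ m))"
    if t: "t \<in> {0..T}" for t k
    by (intro Bochner_Integration.integrable_diff integrable_mult_right P1.integrable_solution_data[OF t] P2.integrable_solution_data[OF t]
        integrable_const_Icc; simp)+
  have iF: "integrable (leb t) (F k)" if "t \<in> {0..T}" for t k
    unfolding F_def[abs_def] by (rule Bochner_Integration.integrable_diff[OF iF1[OF that] iF2[OF that]])
  have TT: "T \<in> {0..T}" using T0 by simp
  have fm: "f k \<in> borel_measurable ?M" for k
    using measurable_AE_lebesgue_on[OF borel_measurable_integrable[OF iF[OF TT]] _ Ff[of k]] by simp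
  have if0: "integrable ?M (f k)" for k
    by (rule integrable_cong_AE_imp[OF iF[OF TT] fm]) (use Ff in auto)
  have prim: "sin_coeff k (v t) = (LINT s|leb t. f k s)" if t: "t \<in> {0..T}" for k t
  proof -
    have "sin_coeff k (v t) = sin_coeff k (\<rho>1 t) - sin_coeff k (\<rho>2 t)"
      by (rule coeff_v[OF _ t]) simp
    also have "\<dots> = (LINT s|leb t. F k s)"
      unfolding F_def Bochner_Integration.integral_diff[OF iF1[OF t] iF2[OF t]]
      using P1.robin_sin_coeff[OF sol1 t, of k] P2.dirichlet_sin_coeff[OF sol2 t, of k] by simp
    also have "\<dots> = (LINT s|leb t. f k s)"
    proof (rule integral_cong_AE[OF borel_measurable_integrable[OF iF[OF t]]])
      show "f k \<in> borel_measurable (leb t)"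
        by (rule measurable_Icc_subset[OF fm]) (use t in auto)
      show "AE s in leb t. F k s = f k s"
        by (rule AE_Icc_subset[OF Ff]) (use t in auto)
    qed
    finally show ?thesis .
  qed
  have le: "(LINT t|?M. sin_coeff k (v t) * sin_coeff k (Z t)) \<le> 0" for k
  proof (cases "k = 0")
    case True
    then show ?thesis by (simp add: sin_coeff_def L2_inner_def)
  next
    case False
    have "0 \<le> (LINT t|?M. sin_coeff k (v t) * f k t)"
      by (rule primitive_coeff_energy_nonneg[OF T0 if0 prim])
    also have "\<dots> = (LINT t|?M. (- (real k * pi)\<^sup>2) * (sin_coeff k (v t) * sin_coeff k (Z t)))"
      by (intro Bochner_Integration.integral_cong) (auto simp: f_def b_def)
    also have "\<dots> = (- (real k * pi)\<^sup>2) * (LINT t|?M. sin_coeff k (v t) * sin_coeff k (Z t))"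
      by simp
    finally show ?thesis using False by (simp add: mult_le_0_iff zero_le_mult_iff)
  qed
  have bm: "(\<lambda>t. sin_coeff k (Z t)) \<in> borel_measurable ?M" for k
  proof (cases "k = 0")
    case True
    then show ?thesis by (simp add: sin_coeff_def L2_inner_def)
  next
    case False
    have "(\<lambda>t. f k t / (- (real k * pi)\<^sup>2)) \<in> borel_measurable ?M"
      by (intro borel_measurable_divide fm borel_measurable_const)
    then show ?thesis using False by (simp add: f_def b_def)
  qed
  have main: "(LINT t|?M. L2_inner (v t) (Z t)) \<le> 0"
  proof (rule LINT_L2_inner_le_by_coeffs[where C = sin_coeff and A = 1 and B = 3 and e = "\<lambda>k. 0"])
    show "(\<lambda>t. sin_coeff k (v t)) \<in> borel_measurable ?M" for k
      by (rule measurable_coeff_v) simp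
  qed (use AE_v Z bm le in auto)
  have ZW: "AE t in ?M. L2_inner (v t) (Z t) \<ge> monotone_pairing m (\<rho>1 t) (\<rho>2 t) - (\<bar>A t\<bar> + \<bar>B t\<bar>)"
    using AB1
  proof eventually_elim
    case (elim t)
    then have t: "t \<in> {0..T}" and r: "regular_profile m (\<rho>1 t)" "regular_profile m (\<rho>2 t)" by auto
    have vae: "AE u in leb 1. \<bar>v t u\<bar> \<le> 1"
      by (rule AE_I2) (use v_bound[OF t] in auto)
    have "L2_inner (v t) (Z t) = L2_inner (v t) (W t) - L2_inner (v t) (l t)"
      using integrable_bounded_times_continuous[OF v_measurable[OF t] vae W_regular(1)[OF t r]]
        integrable_bounded_times_continuous[OF v_measurable[OF t] vae lc]
      by (simp add: L2_inner_def Z_def right_diff_distrib)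
    moreover have "\<bar>L2_inner (v t) (l t)\<bar> \<le> \<bar>A t\<bar> + \<bar>B t\<bar>"
    proof (rule abs_L2_inner_le)
      show "AE u in leb 1. \<bar>v t u * l t u\<bar> \<le> \<bar>A t\<bar> + \<bar>B t\<bar>"
      proof (rule AE_I2)
        fix u :: real assume "u \<in> space (leb 1)"
        then have u: "u \<in> {0..1}" by simp
        show "\<bar>v t u * l t u\<bar> \<le> \<bar>A t\<bar> + \<bar>B t\<bar>"
          using mult_mono[OF v_bound[OF t u] l_le[OF u, of t]] by (simp add: abs_mult)
      qed
    qed simp
    ultimately show ?case using pairing_regular[OF t r] by linarith
  qed
  have iAB: "integrable ?M (\<lambda>t. \<bar>A t\<bar> + \<bar>B t\<bar>)"
  proof (rule integrable_bounded_Icc[where B = 2])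
    show "(\<lambda>t. \<bar>A t\<bar> + \<bar>B t\<bar>) \<in> borel_measurable ?M"
      using Am by simp
    show "AE t in ?M. \<bar>\<bar>A t\<bar> + \<bar>B t\<bar>\<bar> \<le> 2"
      using AB1 by eventually_elim auto
  qed
  have iZ: "integrable ?M (\<lambda>t. L2_inner (v t) (Z t))"
  proof (rule integrable_bounded_Icc[where B = 3])
    have lim: "AE t in ?M. (\<lambda>N. \<Sum>k<N. fejer_coeff N k * sin_coeff k (v t) * sin_coeff k (Z t)) \<longlonglongrightarrow> L2_inner (v t) (Z t)"
      using AE_v Z
    proof eventually_elim
      case (elim t)
      show ?case by (rule fejer_parseval(2)[of _ 1]) (use elim in \<open>auto intro!: AE_I2\<close>)
    qed
    have "(\<lambda>t. sin_coeff k (v t)) \<in> borel_measurable ?M" for k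
      by (rule measurable_coeff_v) simp
    then have "(\<lambda>t. \<Sum>k<N. fejer_coeff N k * sin_coeff k (v t) * sin_coeff k (Z t)) \<in> borel_measurable ?M" for N
      by (intro borel_measurable_sum borel_measurable_times bm borel_measurable_const)
    then show "(\<lambda>t. L2_inner (v t) (Z t)) \<in> borel_measurable ?M"
      by (rule measurable_AE_limit[OF _ _ lim]) simp
    show "AE t in ?M. \<bar>L2_inner (v t) (Z t)\<bar> \<le> 3"
      using AE_v Z
    proof eventually_elim
      case (elim t)
      show ?case
      proof (rule abs_L2_inner_le)
        show "AE u in leb 1. \<bar>v t u * Z t u\<bar> \<le> 3"
        proof (rule AE_I2)
          fix u :: real assume "u \<in> space (leb 1)"
          then have "\<bar>v t u\<bar> \<le> 1" "\<bar>Z t u\<bar> \<le> 3" using elim by auto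
          from mult_mono[OF this] show "\<bar>v t u * Z t u\<bar> \<le> 3" by (simp add: abs_mult)
        qed
      qed simp
    qed
  qed
  have "(LINT t|?M. monotone_pairing m (\<rho>1 t) (\<rho>2 t) - (\<bar>A t\<bar> + \<bar>B t\<bar>)) \<le> (LINT t|?M. L2_inner (v t) (Z t))"
    by (rule integral_mono_AE[OF Bochner_Integration.integrable_diff[OF integrable_pairing iAB] iZ ZW])
  also have "(LINT t|?M. monotone_pairing m (\<rho>1 t) (\<rho>2 t) - (\<bar>A t\<bar> + \<bar>B t\<bar>))
      = (LINT t|?M. monotone_pairing m (\<rho>1 t) (\<rho>2 t)) - (LINT t|?M. \<bar>A t\<bar> + \<bar>B t\<bar>)"
    by (rule Bochner_Integration.integral_diff[OF integrable_pairing iAB])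
  finally show ?thesis using main by (simp add: A_def B_def)
qed

end

section \<open>Exponential memory in time\<close>

text \<open>
  The average of \<open>f\<close> over the past of \<open>r\<close> with exponential weights.  The weights have total mass
  \<open>1 - exp (- l r)\<close>; in the applications the missing mass \<open>exp (- l r)\<close> sits at the initial time.
\<close>

definition memory :: "real \<Rightarrow> (real \<Rightarrow> real) \<Rightarrow> real \<Rightarrow> real" where
  "memory l f r = (LINT x|leb r. l * exp (- l * (r - x)) * f x)"

lemma memory_eq: "memory l f r = l * exp (- l * r) * (LINT x|leb r. exp (l * x) * f x)"
proof -
  have "l * exp (- l * (r - x)) * f x = l * exp (- l * r) * (exp (l * x) * f x)" for x
    by (simp add: right_diff_distrib exp_diff exp_minus field_simps)
  then show ?thesis unfolding memory_def by (simp only: integral_mult_right_zero)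
qed

lemma continuous_on_memory:
  assumes "integrable (leb T) f"
  shows "continuous_on {0..T} (memory l f)"
proof -
  have "integrable (leb T) (\<lambda>x. exp (l * x) * f x)"
    by (intro integrable_times_continuous assms continuous_intros)
  from continuous_on_LINT_upper[OF this] show ?thesis
    unfolding memory_eq[abs_def] by (intro continuous_intros)
qed

lemma LINT_exp_kernel:
  fixes l r r' :: real
  assumes "0 \<le> r"
  shows "(LINT x|leb r. l * exp (- l * (r' - x))) = exp (- l * (r' - r)) - exp (- l * r')"
proof -
  have "(LINT x|leb r. l * exp (- l * (r' - x))) = exp (- l * (r' - r)) - exp (- l * (r' - 0))"
    using assms by (intro LINT_FTC_Icc) (auto intro!: derivative_eq_intros continuous_intros)
  then show ?thesis by simp
qed

lemma LINT_exp_minus: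
  fixes c t :: real
  assumes "0 \<le> t"
  shows "(LINT s|leb t. - c * exp (- c * s)) = exp (- c * t) - 1"
proof -
  have "(LINT s|leb t. - c * exp (- c * s)) = exp (- c * t) - exp (- c * 0)"
    using assms by (intro LINT_FTC_Icc) (auto intro!: derivative_eq_intros continuous_intros)
  then show ?thesis by simp
qed

lemma integrable_memory_integrand:
  fixes f :: "real \<Rightarrow> real"
  assumes "integrable (leb r) f"
  shows "integrable (leb r) (\<lambda>x. l * exp (- l * (r' - x)) * f x)"
  by (intro integrable_times_continuous assms continuous_intros)

lemma memory_const: "0 \<le> r \<Longrightarrow> memory l (\<lambda>_. c) r = (1 - exp (- l * r)) * c"
  using LINT_exp_kernel[of r l r] by (simp add: memory_def)

lemma memory_add:
  assumes "integrable (leb r) f" "integrable (leb r) g"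
  shows "memory l (\<lambda>x. f x + g x) r = memory l f r + memory l g r"
  unfolding memory_def distrib_left
  by (rule Bochner_Integration.integral_add) (intro integrable_memory_integrand assms)+

lemma memory_cmult: "memory l (\<lambda>x. c * f x) r = c * memory l f r"
proof -
  have "l * exp (- l * (r - x)) * (c * f x) = c * (l * exp (- l * (r - x)) * f x)" for x by simp
  then show ?thesis unfolding memory_def by (simp only: integral_mult_right_zero)
qed

lemma memory_diff:
  assumes "integrable (leb r) f" "integrable (leb r) g"
  shows "memory l (\<lambda>x. f x - g x) r = memory l f r - memory l g r"
  using memory_add[OF assms(1) integrable_mult_right[OF assms(2), of "-1"], of l] memory_cmult[of l "-1" g r]
  by simp

lemma memory_sum:
  assumes "\<And>k. k \<in> A \<Longrightarrow> integrable (leb r) (f k)"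
  shows "memory l (\<lambda>x. \<Sum>k\<in>A. f k x) r = (\<Sum>k\<in>A. memory l (f k) r)"
  unfolding memory_def sum_distrib_left
  by (rule Bochner_Integration.integral_sum) (intro integrable_memory_integrand assms)

lemma memory_mono:
  assumes l: "0 \<le> l" and fg: "integrable (leb r) f" "integrable (leb r) g"
    and le: "AE x in leb r. f x \<le> g x"
  shows "memory l f r \<le> memory l g r"
  unfolding memory_def
proof (rule integral_mono_AE)
  show "AE x in leb r. l * exp (- l * (r - x)) * f x \<le> l * exp (- l * (r - x)) * g x"
    using le by eventually_elim (use l in \<open>auto intro!: mult_left_mono\<close>)
qed (intro integrable_memory_integrand fg)+

lemma abs_memory_le_memory_abs:
  assumes l: "0 \<le> l"
  shows "\<bar>memory l f r\<bar> \<le> memory l (\<lambda>x. \<bar>f x\<bar>) r"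
proof -
  have "\<bar>memory l f r\<bar> \<le> (LINT x|leb r. \<bar>l * exp (- l * (r - x)) * f x\<bar>)"
    unfolding memory_def by (rule integral_abs_bound)
  also have "\<dots> = memory l (\<lambda>x. \<bar>f x\<bar>) r"
    unfolding memory_def using l by (simp add: abs_mult)
  finally show ?thesis .
qed

lemma abs_memory_le:
  assumes l: "0 \<le> l" and r: "0 \<le> r" and f: "integrable (leb r) f"
    and B: "AE x in leb r. \<bar>f x\<bar> \<le> B" "0 \<le> B"
  shows "\<bar>memory l f r\<bar> \<le> B"
proof -
  have "\<bar>memory l f r\<bar> \<le> memory l (\<lambda>x. \<bar>f x\<bar>) r" by (rule abs_memory_le_memory_abs[OF l])
  also have "\<dots> \<le> memory l (\<lambda>_. B) r"
    using f B(1) by (intro memory_mono l) (auto intro!: continuous_imp_integrable_real)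
  also have "\<dots> = (1 - exp (- l * r)) * B" by (rule memory_const[OF r])
  also have "\<dots> \<le> 1 * B" using B(2) by (intro mult_right_mono) auto
  finally show ?thesis by simp
qed

text \<open>
  If \<open>p\<close> has derivative \<open>f\<close>, then comparing \<open>p\<close> with its weighted past, initial value included, is the
  same as averaging \<open>f\<close>.  This turns the mode equations into statements about increments of \<open>\<rho>\<close>.
\<close>

lemma memory_primitive:
  assumes l: "0 < l" and r: "0 \<le> r" and f: "integrable (leb r) f"
    and p: "\<And>t. t \<in> {0..r} \<Longrightarrow> p t = p0 + (LINT s|leb t. f s)"
  shows "l * (p r - exp (- l * r) * p0 - memory l p r) = memory l f r"
proof -
  let ?g = "\<lambda>x. l * exp (- l * (r - x))" and ?F = "\<lambda>t. LINT s|leb t. f s"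
  have g: "integrable (leb r) ?g" by (intro continuous_imp_integrable_real continuous_intros)
  have F: "continuous_on {0..r} ?F" by (rule continuous_on_LINT_upper[OF f])
  then have iF: "integrable (leb r) ?F" by (rule continuous_imp_integrable_real)
  have "memory l p r = memory l (\<lambda>t. p0 + ?F t) r"
    unfolding memory_def by (intro Bochner_Integration.integral_cong) (auto simp: p)
  also have "\<dots> = memory l (\<lambda>_. p0) r + memory l ?F r"
    by (rule memory_add[OF _ iF]) (intro continuous_imp_integrable_real continuous_intros)
  finally have mp: "memory l p r = (1 - exp (- l * r)) * p0 + memory l ?F r"
    using memory_const[OF r] by simp
  have "(LINT t|leb r. f t * (LINT s|leb t. ?g s))
      = (LINT t|leb r. exp (- l * (r - t)) * f t - exp (- l * r) * f t)"
  proof (intro Bochner_Integration.integral_cong refl)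
    fix t assume "t \<in> space (leb r)"
    then have "0 \<le> t" by simp
    show "f t * (LINT s|leb t. ?g s) = exp (- l * (r - t)) * f t - exp (- l * r) * f t"
      unfolding LINT_exp_kernel[OF \<open>0 \<le> t\<close>] by (simp add: algebra_simps)
  qed
  also have "\<dots> = (LINT t|leb r. exp (- l * (r - t)) * f t) - (LINT t|leb r. exp (- l * r) * f t)"
    by (rule Bochner_Integration.integral_diff) (intro integrable_times_continuous f continuous_intros)+
  finally have 2: "(LINT t|leb r. f t * (LINT s|leb t. ?g s))
      = (LINT t|leb r. exp (- l * (r - t)) * f t) - exp (- l * r) * ?F r"
    by simp
  have mf: "memory l f r = l * (LINT t|leb r. exp (- l * (r - t)) * f t)"
    unfolding memory_def by (simp add: mult.assoc)
  have "(LINT t|leb r. ?F t * ?g t) = memory l ?F r"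
    unfolding memory_def by (simp add: mult.commute)
  with integration_by_parts_Icc(1)[OF r f g] 2 LINT_exp_kernel[OF r, of l r]
  have "memory l ?F r + (LINT t|leb r. exp (- l * (r - t)) * f t) - exp (- l * r) * ?F r
      = ?F r * (1 - exp (- l * r))"
    by simp
  then have E: "(LINT t|leb r. exp (- l * (r - t)) * f t) = ?F r - memory l ?F r"
    by (simp add: algebra_simps)
  have pr: "p r = p0 + ?F r" using p[of r] r by simp
  show ?thesis unfolding mf E mp pr by (simp add: algebra_simps)
qed

text \<open>
  Decreasing weights preserve the sign: integrate by parts against the nonnegative function
  \<open>\<integral>\<^sub>0\<^sup>t F F' = F(t)\<^sup>2/2\<close>.
\<close>

lemma LINT_weighted_primitive_times_self_nonneg:
  fixes q :: "real \<Rightarrow> real"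
  assumes T: "0 \<le> T" and c: "0 \<le> c" and q: "integrable (leb T) q"
  shows "0 \<le> (LINT t|leb T. exp (- c * t) * ((LINT s|leb t. q s) * q t))"
proof -
  let ?M = "leb T" and ?F = "\<lambda>t. LINT s|leb t. q s"
  let ?Fq = "\<lambda>t. ?F t * q t" and ?g = "\<lambda>s. - c * exp (- c * s)"
  have Fq: "integrable ?M ?Fq" by (rule integration_by_parts_Icc(2)[OF T q q])
  have g: "integrable ?M ?g" by (intro continuous_imp_integrable_real continuous_intros)
  have H: "(LINT s|leb t. ?Fq s) = (?F t)\<^sup>2 / 2" if "t \<in> {0..T}" for t
    using that integrable_subinterval[OF q, of 0 t] by (intro LINT_primitive_times_self) auto
  have "(LINT t|?M. (LINT s|leb t. ?Fq s) * ?g t) + (LINT t|?M. ?Fq t * (LINT s|leb t. ?g s))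
      = (LINT t|?M. ?Fq t) * (LINT t|?M. ?g t)"
    by (rule integration_by_parts_Icc(1)[OF T Fq g])
  also have "(LINT t|?M. ?Fq t * (LINT s|leb t. ?g s)) = (LINT t|?M. exp (- c * t) * ?Fq t - ?Fq t)"
  proof (intro Bochner_Integration.integral_cong refl)
    fix t assume "t \<in> space ?M"
    then have "0 \<le> t" by simp
    show "?Fq t * (LINT s|leb t. ?g s) = exp (- c * t) * ?Fq t - ?Fq t"
      unfolding LINT_exp_minus[OF \<open>0 \<le> t\<close>] by (simp add: algebra_simps)
  qed
  also have "\<dots> = (LINT t|?M. exp (- c * t) * ?Fq t) - (LINT t|?M. ?Fq t)"
    by (intro Bochner_Integration.integral_diff integrable_times_continuous Fq continuous_intros)
  also have "(LINT t|?M. ?g t) = exp (- c * T) - 1" by (rule LINT_exp_minus[OF T])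
  finally have "(LINT t|?M. exp (- c * t) * ?Fq t)
      = exp (- c * T) * (LINT t|?M. ?Fq t) - (LINT t|?M. (LINT s|leb t. ?Fq s) * ?g t)"
    by (simp add: algebra_simps)
  moreover have "0 \<le> exp (- c * T) * (LINT t|?M. ?Fq t)"
  proof (rule mult_nonneg_nonneg)
    show "0 \<le> (LINT t|?M. ?Fq t)" using T by (subst H) auto
  qed simp
  moreover have "(LINT t|?M. (LINT s|leb t. ?Fq s) * ?g t) \<le> 0"
  proof -
    have "0 \<le> (LINT t|?M. - ((LINT s|leb t. ?Fq s) * ?g t))"
      by (rule Bochner_Integration.integral_nonneg) (use c in \<open>auto simp: H intro!: mult_nonneg_nonneg\<close>)
    then show ?thesis by simp
  qed
  ultimately show ?thesis by linarith
qed

text \<open>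
  The kernel \<open>exp (- l \<bar>r - s\<bar>)\<close> is positive semidefinite.  For \<open>q = exp (l x) b\<close> with primitive \<open>F\<close> the
  integrand equals \<open>l exp (- 2 l r) F F'\<close>.
\<close>

lemma LINT_times_memory_nonneg:
  assumes T: "0 \<le> T" and l: "0 \<le> l" and b: "integrable (leb T) b"
  shows "0 \<le> (LINT r|leb T. b r * memory l b r)"
proof -
  define q where "q x = exp (l * x) * b x" for x
  have q: "integrable (leb T) q"
    unfolding q_def[abs_def] by (intro integrable_times_continuous b continuous_intros)
  have "b r * memory l b r = l * (exp (- (2 * l) * r) * ((LINT s|leb r. q s) * q r))" for r
  proof -
    have "exp (- (2 * l) * r) * exp (l * r) = exp (- l * r)" by (simp flip: exp_add)
    then show ?thesis unfolding memory_eq q_def by (simp add: mult_ac)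
  qed
  then have "(LINT r|leb T. b r * memory l b r)
      = l * (LINT r|leb T. exp (- (2 * l) * r) * ((LINT s|leb r. q s) * q r))"
    by simp
  then show ?thesis
    using LINT_weighted_primitive_times_self_nonneg[OF T _ q, of "2 * l"] l by simp
qed

text \<open>
  This is the equation \<open>M' = l (f - M)\<close> for the memory \<open>M\<close> of \<open>f\<close>, integrated over \<open>[0,T]\<close>.  For
  \<open>f \<ge> 0\<close> it shows that the memory does not increase the \<open>L\<^sup>1\<close> norm.
\<close>

lemma LINT_memory:
  assumes T: "0 \<le> T" and l: "0 < l" and f: "integrable (leb T) f"
  shows "l * (LINT r|leb T. f r - memory l f r) = memory l f T"
proof -
  let ?M = "leb T" and ?q = "\<lambda>x. exp (l * x) * f x" and ?g = "\<lambda>s. - l * exp (- l * s)"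
  let ?E = "\<lambda>r. LINT x|leb r. ?q x"
  have q: "integrable ?M ?q" by (intro integrable_times_continuous f continuous_intros)
  have g: "integrable ?M ?g" by (intro continuous_imp_integrable_real continuous_intros)
  have im: "integrable ?M (memory l f)"
    by (intro continuous_imp_integrable_real continuous_on_memory f)
  have "(LINT t|?M. ?E t * ?g t) = (LINT t|?M. - memory l f t)"
    unfolding memory_eq by (intro Bochner_Integration.integral_cong) (auto simp: mult_ac)
  then have 1: "(LINT t|?M. ?E t * ?g t) = - (LINT t|?M. memory l f t)" by simp
  have "?q t * (LINT s|leb t. ?g s) = f t - ?q t" if "t \<in> {0..T}" for t
  proof -
    have "exp (l * t) * exp (- l * t) = 1" by (simp flip: exp_add)
    moreover have "(LINT s|leb t. ?g s) = exp (- l * t) - 1"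
      using that by (intro LINT_exp_minus) auto
    moreover have "exp (l * t) * f t * (exp (- l * t) - 1) = (exp (l * t) * exp (- l * t)) * f t - exp (l * t) * f t"
      by (simp only: algebra_simps)
    ultimately show ?thesis by (simp only: mult_1_left)
  qed
  then have "(LINT t|?M. ?q t * (LINT s|leb t. ?g s)) = (LINT t|?M. f t - ?q t)"
    by (intro Bochner_Integration.integral_cong) auto
  also have "\<dots> = (LINT t|?M. f t) - ?E T"
    by (rule Bochner_Integration.integral_diff[OF f q])
  finally have 2: "(LINT t|?M. ?q t * (LINT s|leb t. ?g s)) = (LINT t|?M. f t) - ?E T" .
  have "- (LINT t|?M. memory l f t) + ((LINT t|?M. f t) - ?E T) = ?E T * (exp (- l * T) - 1)"
    using integration_by_parts_Icc(1)[OF T q g] unfolding 1 2 LINT_exp_minus[OF T] .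
  then have "(LINT t|?M. f t) - (LINT t|?M. memory l f t) = exp (- l * T) * ?E T"
    by (simp add: algebra_simps)
  then have "l * ((LINT t|?M. f t) - (LINT t|?M. memory l f t)) = memory l f T"
    unfolding memory_eq[of l f T] by (simp only: mult.assoc)
  then show ?thesis
    by (simp only: Bochner_Integration.integral_diff[OF f im])
qed

lemma memory_tendsto_continuous:
  assumes g: "continuous_on {0..T} g" and r: "0 < r" "r \<le> T"
  shows "(\<lambda>n. memory (real n) g r) \<longlonglongrightarrow> g r"
proof (rule LIMSEQ_I)
  fix e :: real assume e: "0 < e"
  obtain C where C: "\<And>x. x \<in> {0..T} \<Longrightarrow> \<bar>g x\<bar> \<le> C" "0 \<le> C"
    using continuous_on_Icc_bounded[OF g] by blast
  obtain d where d: "0 < d" "\<And>x. x \<in> {0..T} \<Longrightarrow> \<bar>x - r\<bar> < d \<Longrightarrow> \<bar>g x - g r\<bar> < e / 2"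
    using g r e unfolding continuous_on_iff dist_real_def
    by (metis atLeastAtMost_iff half_gt_zero less_imp_le)
  have gr: "continuous_on {0..r} g" using g by (rule continuous_on_subset) (use r in auto)
  have ig: "integrable (leb r) g" by (rule continuous_imp_integrable_real[OF gr])
  have lim: "(\<lambda>n. 2 * C * (real n * exp (- real n * d)) * r + C * exp (- real n * r)) \<longlonglongrightarrow> 0"
  proof -
    have 1: "(\<lambda>n. real n * exp (- real n * d)) \<longlonglongrightarrow> 0" using d(1) by real_asymp
    have 2: "(\<lambda>n. exp (- real n * r)) \<longlonglongrightarrow> 0" using r(1) by real_asymp
    have "(\<lambda>n. 2 * C * (real n * exp (- real n * d)) * r + C * exp (- real n * r)) \<longlonglongrightarrow> 2 * C * 0 * r + C * 0"
      by (intro tendsto_intros 1 2)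
    then show ?thesis by simp
  qed
  then have "\<forall>\<^sub>F n in sequentially. 2 * C * (real n * exp (- real n * d)) * r + C * exp (- real n * r) < e / 2"
    using e by (intro order_tendstoD) auto
  then obtain N where N: "\<And>n. n \<ge> N \<Longrightarrow> 2 * C * (real n * exp (- real n * d)) * r + C * exp (- real n * r) < e / 2"
    by (auto simp: eventually_sequentially)
  show "\<exists>no. \<forall>n\<ge>no. norm (memory (real n) g r - g r) < e"
  proof (intro exI[of _ N] allI impI)
    fix n assume n: "N \<le> n"
    let ?K = "2 * C * (real n * exp (- real n * d))"
    have ic: "integrable (leb r) (\<lambda>_. c)" for c :: real
      by (intro continuous_imp_integrable_real continuous_intros)
    have "memory (real n) (\<lambda>x. g x - g r) r = memory (real n) g r - (1 - exp (- real n * r)) * g r"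
      using memory_diff[OF ig ic] memory_const[of r] r by simp
    then have eq: "memory (real n) g r - g r = memory (real n) (\<lambda>x. g x - g r) r - exp (- real n * r) * g r"
      by (simp add: algebra_simps)
    have "\<bar>memory (real n) (\<lambda>x. g x - g r) r\<bar> \<le> memory (real n) (\<lambda>x. \<bar>g x - g r\<bar>) r"
      by (rule abs_memory_le_memory_abs) simp
    also have "\<dots> \<le> (LINT x|leb r. real n * exp (- real n * (r - x)) * (e / 2) + ?K)"
      unfolding memory_def
    proof (rule Bochner_Integration.integral_mono)
      fix x assume "x \<in> space (leb r)"
      then have x: "x \<in> {0..T}" "x \<le> r" using r by auto
      have K0: "0 \<le> ?K" using C(2) by simp
      show "real n * exp (- real n * (r - x)) * \<bar>g x - g r\<bar> \<le> real n * exp (- real n * (r - x)) * (e / 2) + ?K"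
      proof (cases "\<bar>x - r\<bar> < d")
        case True
        then have "real n * exp (- real n * (r - x)) * \<bar>g x - g r\<bar> \<le> real n * exp (- real n * (r - x)) * (e / 2)"
          using d(2)[OF x(1)] by (intro mult_left_mono) auto
        then show ?thesis using K0 by linarith
      next
        case False
        then have "exp (- real n * (r - x)) \<le> exp (- real n * d)"
          using x by (simp add: mult_left_mono)
        moreover have "\<bar>g x - g r\<bar> \<le> 2 * C" using C(1)[OF x(1)] C(1)[of r] r by auto
        ultimately have "real n * exp (- real n * (r - x)) * \<bar>g x - g r\<bar> \<le> real n * exp (- real n * d) * (2 * C)"
          by (intro mult_mono) auto
        moreover have "0 \<le> real n * exp (- real n * (r - x)) * (e / 2)" using e by simp
        ultimately show ?thesis by (simp add: mult_ac)
      qed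
    qed (intro continuous_imp_integrable_real continuous_intros gr)+
    also have "\<dots> = memory (real n) (\<lambda>_. e / 2) r + r * ?K"
      unfolding memory_def
      by (subst Bochner_Integration.integral_add[OF integrable_memory_integrand[OF ic] ic])
         (use LINT_const_Icc[of 0 r ?K] r in simp)
    also have "\<dots> \<le> e / 2 + ?K * r"
    proof -
      have "(1 - exp (- real n * r)) * (e / 2) \<le> 1 * (e / 2)" using e by (intro mult_right_mono) auto
      then show ?thesis using memory_const[of r "real n" "e / 2"] r by (simp add: mult.commute)
    qed
    finally have 1: "\<bar>memory (real n) (\<lambda>x. g x - g r) r\<bar> \<le> e / 2 + ?K * r" .
    have 2: "\<bar>exp (- real n * r) * g r\<bar> \<le> C * exp (- real n * r)"
      using C(1)[of r] r by (simp add: abs_mult mult.commute mult_right_mono)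
    have "\<bar>memory (real n) g r - g r\<bar> \<le> e / 2 + ?K * r + C * exp (- real n * r)"
      using 1 2 unfolding eq by linarith
    then show "norm (memory (real n) g r - g r) < e" using N[OF n] by simp
  qed
qed

text \<open>
  By the contraction property in \<open>L\<^sup>1\<close> it is enough to treat a continuous function close to \<open>h\<close> in
  \<open>L\<^sup>1\<close>.
\<close>

lemma memory_tendsto_weakly:
  assumes T: "0 \<le> T"
    and h: "h \<in> borel_measurable (leb T)" "AE r in leb T. \<bar>h r\<bar> \<le> B" "0 \<le> B"
    and z: "z \<in> borel_measurable (leb T)" "AE r in leb T. \<bar>z r\<bar> \<le> C" "0 \<le> C"
  shows "(\<lambda>n. LINT r|leb T. memory (real n) h r * z r) \<longlonglongrightarrow> (LINT r|leb T. h r * z r)"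
proof (rule LIMSEQ_I)
  let ?M = "leb T"
  fix e :: real assume e: "0 < e"
  \<comment> \<open>Three errors of size \<open>e1\<close> in \<open>L\<^sup>1\<close> will be multiplied by the bound \<open>C\<close> on \<open>z\<close>.\<close>
  define e1 where "e1 = e / (4 * (C + 1))"
  have e1: "0 < e1" using e z(3) by (simp add: e1_def)
  have ih: "integrable ?M h" by (rule integrable_bounded_Icc[OF h(1,2)])
  \<comment> \<open>The bound on \<open>h\<close> holds almost everywhere only; the approximation lemma asks for it everywhere.\<close>
  define F where "F x = max (- B) (min B (h x))" for x
  have Fm: "F \<in> borel_measurable ?M" unfolding F_def[abs_def]
    by (intro borel_measurable_max borel_measurable_min borel_measurable_const h)
  have FB: "\<bar>F x\<bar> \<le> B" for x unfolding F_def using h(3) by linarith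
  have Fh: "AE x in ?M. h x = F x" using h(2) by eventually_elim (auto simp: F_def)
  obtain g where g: "\<And>n::nat. continuous_on UNIV (g n)" "\<And>n x. \<bar>g n x\<bar> \<le> B"
    "AE x in ?M. (\<lambda>n. g n x) \<longlonglongrightarrow> F x"
    using bounded_measurable_approx_continuous[OF Fm, of B] FB h(3) by auto
  have gc: "continuous_on {0..T} (g n)" for n using g(1) continuous_on_subset by blast
  have ig: "integrable ?M (g n)" for n by (rule continuous_imp_integrable_real[OF gc])
  have "(\<lambda>n. LINT x|?M. \<bar>h x - g n x\<bar>) \<longlonglongrightarrow> (LINT x|?M. 0)"
  proof (rule bounded_convergence_Icc[where B = "2 * B"])
    show "(\<lambda>x. \<bar>h x - g n x\<bar>) \<in> borel_measurable ?M" for n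
      by (intro borel_measurable_abs borel_measurable_diff h measurable_continuous_Icc gc)
    show "AE x in ?M. \<bar>\<bar>h x - g n x\<bar>\<bar> \<le> 2 * B" for n
      using h(2) by eventually_elim (use g(2)[of n] in \<open>smt (verit)\<close>)
    show "AE x in ?M. (\<lambda>n. \<bar>h x - g n x\<bar>) \<longlonglongrightarrow> 0"
      using g(3) Fh
    proof eventually_elim
      case (elim x)
      have "(\<lambda>n. \<bar>h x - g n x\<bar>) \<longlonglongrightarrow> \<bar>h x - F x\<bar>" by (intro tendsto_intros elim)
      then show ?case using elim by simp
    qed
  qed
  then have "\<forall>\<^sub>F n in sequentially. (LINT x|?M. \<bar>h x - g n x\<bar>) < e1"
    using e1 by (intro order_tendstoD) auto
  then obtain k where k: "(LINT x|?M. \<bar>h x - g k x\<bar>) < e1" by (auto simp: eventually_sequentially)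
  have AE_pos: "AE x in ?M. 0 < x \<and> x \<le> T"
    by (rule AE_I'[of "{0}"]) (use T in \<open>auto simp: null_sets_restrict_space\<close>)
  have im: "integrable ?M (memory l f)" if "integrable ?M f" for l f
    by (intro continuous_imp_integrable_real continuous_on_memory that)
  have "(\<lambda>n. LINT x|?M. \<bar>memory (real n) (g k) x - g k x\<bar>) \<longlonglongrightarrow> (LINT x|?M. 0)"
  proof (rule bounded_convergence_Icc[where B = "2 * B"])
    show "(\<lambda>x. \<bar>memory (real n) (g k) x - g k x\<bar>) \<in> borel_measurable ?M" for n
      by (intro borel_measurable_abs borel_measurable_diff measurable_continuous_Icc gc continuous_on_memory ig)
    show "AE x in ?M. \<bar>\<bar>memory (real n) (g k) x - g k x\<bar>\<bar> \<le> 2 * B" for n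
    proof (rule AE_I2)
      fix x assume "x \<in> space ?M"
      then have x: "x \<in> {0..T}" by simp
      have "\<bar>memory (real n) (g k) x\<bar> \<le> B"
        by (rule abs_memory_le) (use x g(2) h(3) in \<open>auto intro!: AE_I2 integrable_subinterval[OF ig]\<close>)
      then show "\<bar>\<bar>memory (real n) (g k) x - g k x\<bar>\<bar> \<le> 2 * B" using g(2)[of k x] by linarith
    qed
    show "AE x in ?M. (\<lambda>n. \<bar>memory (real n) (g k) x - g k x\<bar>) \<longlonglongrightarrow> 0"
      using AE_pos
    proof eventually_elim
      case (elim x)
      have "(\<lambda>n. \<bar>memory (real n) (g k) x - g k x\<bar>) \<longlonglongrightarrow> \<bar>g k x - g k x\<bar>"
        by (intro tendsto_intros memory_tendsto_continuous[OF gc]) (use elim in auto)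
      then show ?case by simp
    qed
  qed
  then have "\<forall>\<^sub>F n in sequentially. (LINT x|?M. \<bar>memory (real n) (g k) x - g k x\<bar>) < e1"
    using e1 by (intro order_tendstoD) auto
  then obtain N where N: "\<And>n. n \<ge> N \<Longrightarrow> (LINT x|?M. \<bar>memory (real n) (g k) x - g k x\<bar>) < e1"
    by (auto simp: eventually_sequentially)
  show "\<exists>no. \<forall>n\<ge>no. norm ((LINT r|?M. memory (real n) h r * z r) - (LINT r|?M. h r * z r)) < e"
  proof (intro exI[of _ "Suc N"] allI impI)
    fix n assume "Suc N \<le> n"
    then have n: "N \<le> n" "0 < real n" by auto
    define D where "D x = \<bar>h x - g k x\<bar>" for x
    have D: "integrable ?M D" unfolding D_def[abs_def]
      by (intro integrable_abs Bochner_Integration.integrable_diff ih ig)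
    have mD: "(LINT x|?M. memory (real n) D x) \<le> (LINT x|?M. D x)"
    proof -
      have "0 \<le> memory (real n) D T"
        unfolding memory_def by (rule Bochner_Integration.integral_nonneg) (simp add: D_def)
      then have "0 \<le> real n * (LINT x|?M. D x - memory (real n) D x)"
        using LINT_memory[OF T n(2) D] by simp
      then have "0 \<le> (LINT x|?M. D x - memory (real n) D x)"
        using n(2) by (simp add: zero_le_mult_iff)
      then show ?thesis using Bochner_Integration.integral_diff[OF D im[OF D, of "real n"]] by simp
    qed
    have imz: "integrable ?M (\<lambda>r. f r * z r)" if f: "integrable ?M f" for f
    proof (rule Bochner_Integration.integrable_bound[OF integrable_mult_right[OF f, of C]])
      show "(\<lambda>r. f r * z r) \<in> borel_measurable ?M"
        by (intro borel_measurable_times borel_measurable_integrable[OF f] z)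
      show "AE r in ?M. norm (f r * z r) \<le> norm (C * f r)"
        using z(2)
      proof eventually_elim
        case (elim r)
        then have "\<bar>f r\<bar> * \<bar>z r\<bar> \<le> \<bar>f r\<bar> * C" by (intro mult_left_mono) auto
        then show ?case using z(3) by (simp add: abs_mult mult.commute)
      qed
    qed
    let ?R = "\<lambda>x. C * (memory (real n) D x + \<bar>memory (real n) (g k) x - g k x\<bar> + D x)"
    have iR: "integrable ?M (\<lambda>x. \<bar>memory (real n) (g k) x - g k x\<bar>)"
      by (intro integrable_abs Bochner_Integration.integrable_diff im ig)
    have "\<bar>(LINT r|?M. memory (real n) h r * z r) - (LINT r|?M. h r * z r)\<bar>
        = \<bar>LINT r|?M. memory (real n) h r * z r - h r * z r\<bar>"
      by (simp add: Bochner_Integration.integral_diff[OF imz[OF im[OF ih]] imz[OF ih]])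
    also have "\<dots> \<le> (LINT r|?M. \<bar>memory (real n) h r * z r - h r * z r\<bar>)"
      by (rule integral_abs_bound)
    also have "\<dots> \<le> (LINT r|?M. ?R r)"
    proof (rule integral_mono_AE)
      show "integrable ?M (\<lambda>r. \<bar>memory (real n) h r * z r - h r * z r\<bar>)"
        by (intro integrable_abs Bochner_Integration.integrable_diff imz im ih)
      show "integrable ?M ?R"
        by (intro integrable_mult_right Bochner_Integration.integrable_add iR im D)
      have "AE r in ?M. r \<in> {0..T}" by (rule AE_I2) simp
      then show "AE r in ?M. \<bar>memory (real n) h r * z r - h r * z r\<bar> \<le> ?R r"
        using z(2)
      proof eventually_elim
        case (elim r)
        have ihr: "integrable (leb r) h" "integrable (leb r) (g k)"
          using integrable_subinterval[OF ih, of 0 r] integrable_subinterval[OF ig, of 0 r] elim by auto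
        have "\<bar>memory (real n) (\<lambda>x. h x - g k x) r\<bar> \<le> memory (real n) D r"
          unfolding D_def[abs_def] by (rule abs_memory_le_memory_abs) simp
        then have "\<bar>memory (real n) h r - memory (real n) (g k) r\<bar> \<le> memory (real n) D r"
          by (simp add: memory_diff[OF ihr])
        then have "\<bar>memory (real n) h r - h r\<bar> \<le> memory (real n) D r + \<bar>memory (real n) (g k) r - g k r\<bar> + D r"
          unfolding D_def[of r] by linarith
        then have "\<bar>z r\<bar> * \<bar>memory (real n) h r - h r\<bar> \<le> ?R r"
          using elim z(3) by (intro mult_mono) auto
        moreover have "memory (real n) h r * z r - h r * z r = z r * (memory (real n) h r - h r)"
          by (simp add: algebra_simps)
        ultimately show ?case by (simp add: abs_mult)
      qed
    qed
    also have "\<dots> = C * ((LINT x|?M. memory (real n) D x) + (LINT x|?M. \<bar>memory (real n) (g k) x - g k x\<bar>) + (LINT x|?M. D x))"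
      using iR im[OF D] D by simp
    also have "\<dots> \<le> C * (e1 + e1 + e1)"
      using mD k N[OF n(1)] z(3) unfolding D_def[symmetric] by (intro mult_left_mono) auto
    also have "\<dots> < e"
    proof -
      have "0 \<le> C * e1" using e1 z(3) by simp
      then have "C * (e1 + e1 + e1) < 4 * (C + 1) * e1" using e1 by (simp add: algebra_simps)
      also have "\<dots> = e" using z(3) by (simp add: e1_def)
      finally show ?thesis .
    qed
    finally show "norm ((LINT r|?M. memory (real n) h r * z r) - (LINT r|?M. h r * z r)) < e" by simp
  qed
qed

section \<open>The energy estimate at the boundary\<close>

context pme_profile
begin

text \<open>
  Write \<open>z\<^sub>r = \<rho>\<^sub>r\<^sup>m - h\<close> with the affine function \<open>h\<close> that has the Dirichlet values of the \<open>m\<close>-th power, and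
  let \<open>p\<^sub>k\<close>, \<open>b\<^sub>k\<close> be the cosine coefficients of \<open>\<rho>\<close> and \<open>z\<close>.  The equation reads
  \<open>p\<^sub>k' = - (k \<pi>)\<^sup>2 b\<^sub>k + th0 + (-1)\<^sup>k th1\<close>, where \<open>th0\<close> and \<open>th1\<close> are the fluxes corrected by the slope \<open>D\<close>
  of \<open>h\<close>.  Multiply the memory of this equation by the Fejer weights and \<open>b\<^sub>k\<close>, sum over \<open>k\<close> and integrate
  in time.

  On the left, \<open>memory_primitive\<close> produces the pairing of \<open>z\<^sub>r\<close> with increments \<open>\<rho>\<^sub>r - \<rho>\<^sub>s\<close>, and convexity
  bounds this pairing from below by increments of \<open>\<Phi>(r) = \<integral> \<rho>\<^sub>r\<^bsup>m+1\<^esup>/(m+1) - h \<rho>\<^sub>r\<close>.  By \<open>LINT_memory\<close> these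
  telescope to boundary terms, at least \<open>-4\<close> as \<open>\<bar>\<Phi>\<bar> \<le> 2\<close>.  On the right, the diffusion terms are
  nonpositive by \<open>LINT_times_memory_nonneg\<close>, and the remaining sums are Fejer means of \<open>z\<^sub>r\<close> at 0 and at 1.
  So after \<open>N \<rightarrow> \<infinity>\<close> only \<open>z\<^sub>r(0)\<close> and \<open>z\<^sub>r(1)\<close> times the memories of \<open>th0\<close> and \<open>th1\<close> are left, and
  \<open>l \<rightarrow> \<infinity>\<close> gives the claim; the slope \<open>D\<close> accounts for \<open>2 T\<close>.
\<close>

lemma robin_energy:
  assumes sol: "robin_weak_solution m T \<alpha> \<beta> \<kappa> g \<rho>" and \<kappa>: "0 < \<kappa>"
    and ab: "\<alpha> \<in> {0..1}" "\<beta> \<in> {0..1}"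
  shows "\<kappa> * (LINT t|leb T. (bdry m (\<rho> t) 0 - \<alpha>) * (bdry_pow m (\<rho> t) 0 - \<alpha> ^ m)
      + (bdry m (\<rho> t) 1 - \<beta>) * (bdry_pow m (\<rho> t) 1 - \<beta> ^ m)) \<le> 4 + 2 * T"
proof -
  let ?M = "leb T"
  have T0: "0 \<le> T" "0 \<in> {0..T}" "T \<in> {0..T}" using T by auto
  have ab1: "0 \<le> \<alpha> ^ m" "\<alpha> ^ m \<le> 1" "0 \<le> \<beta> ^ m" "\<beta> ^ m \<le> 1" using ab by (auto intro: power_le_one)
  define D where "D = \<beta> ^ m - \<alpha> ^ m"
  define h where "h u = \<alpha> ^ m + D * u" for u
  have hc: "continuous_on S h" for S unfolding h_def[abs_def] by (intro continuous_intros)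
  have h01: "h u \<in> {0..1}" if u: "u \<in> {0..1}" for u
  proof -
    have "h u = (1 - u) * \<alpha> ^ m + u * \<beta> ^ m" by (simp add: h_def D_def algebra_simps)
    moreover have "(1 - u) * \<alpha> ^ m + u * \<beta> ^ m \<le> (1 - u) * 1 + u * 1"
      using u ab1 by (intro add_mono mult_left_mono) auto
    moreover have "0 \<le> (1 - u) * \<alpha> ^ m + u * \<beta> ^ m"
      using u ab1 by (intro add_nonneg_nonneg mult_nonneg_nonneg) auto
    ultimately show ?thesis by simp
  qed
  define z where "z r u = bdry_pow m (\<rho> r) u - h u" for r u
  define b where "b k r = cos_coeff k (\<lambda>u. \<rho> r u ^ m) - cos_coeff k h" for k r
  define p where "p k r = cos_coeff k (\<rho> r)" for k r
  define th0 th1 where "th0 s = \<kappa> * (\<alpha> - bdry m (\<rho> s) 0) + D" and "th1 s = \<kappa> * (\<beta> - bdry m (\<rho> s) 1) - D" for s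
  define f where "f k s = - (real k * pi)\<^sup>2 * b k s + (th0 s + (- 1) ^ k * th1 s)" for k s
  define \<Phi> where "\<Phi> r = L2_inner (\<lambda>u. \<rho> r u ^ Suc m) (\<lambda>_. 1 / real (Suc m)) - L2_inner (\<rho> r) h" for r
  define good where "good r \<longleftrightarrow> r \<in> {0..T} \<and> regular_profile m (\<rho> r)" for r
  have AE_good: "AE r in ?M. good r"
    by (rule lebesgue_on_mono[OF AE_regular]) (simp add: good_def)
  have D1: "\<bar>D\<bar> \<le> 1" using ab1 by (auto simp: D_def)
  have z: "continuous_on {0..1} (z r)" "\<And>u. u \<in> {0..1} \<Longrightarrow> \<bar>z r u\<bar> \<le> 1"
    "cos_coeff k (z r) = b k r" if r: "good r" for r k
  proof -
    have rT: "r \<in> {0..T}" and reg: "regular_profile m (\<rho> r)" using r by (auto simp: good_def)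
    have bc: "continuous_on {0..1} (bdry_pow m (\<rho> r))" using reg by (simp add: regular_profile_def)
    show "continuous_on {0..1} (z r)" unfolding z_def[abs_def] by (intro continuous_on_diff bc hc)
    have b01: "bdry_pow m (\<rho> r) u \<in> {0..1}" if "u \<in> {0..1}" for u
      by (rule regular_profile_bdry(1)[OF reg _ m that]) (rule range[OF rT])
    show "\<bar>z r u\<bar> \<le> 1" if "u \<in> {0..1}" for u
      using b01[OF that] h01[OF that] by (auto simp: z_def)
    have "AE u in leb 1. \<bar>bdry_pow m (\<rho> r) u\<bar> \<le> 1" "AE u in leb 1. \<bar>h u\<bar> \<le> 1"
      by (rule AE_I2, use b01 h01 in force)+
    then have "cos_coeff k (z r) = cos_coeff k (bdry_pow m (\<rho> r)) - cos_coeff k h"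
      unfolding z_def[abs_def]
      by (intro coeff_diff[OF disjI1[OF refl] measurable_continuous_Icc[OF bc] _ measurable_continuous_Icc[OF hc]])
    then show "cos_coeff k (z r) = b k r"
      unfolding b_def using coeff_regular(1)[OF reg rT] by simp
  qed
  have bm: "b k \<in> borel_measurable ?M" for k
    unfolding b_def[abs_def] by (intro borel_measurable_diff measurable_coeff_power borel_measurable_const)
  have b1: "AE r in ?M. \<bar>b k r\<bar> \<le> 1" for k
    using AE_good
  proof eventually_elim
    case (elim r)
    have "AE u in leb 1. \<bar>z r u\<bar> \<le> 1" by (rule AE_I2) (use z(2)[OF elim] in auto)
    from abs_coeff_le(1)[OF this, of k] show ?case using z(3)[OF elim] by simp
  qed
  have ib: "integrable ?M (b k)" for k by (rule integrable_bounded_Icc[OF bm b1])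
  have th_meas: "th0 \<in> borel_measurable ?M" "th1 \<in> borel_measurable ?M"
    unfolding th0_def[abs_def] th1_def[abs_def]
    by (intro borel_measurable_add borel_measurable_diff borel_measurable_times borel_measurable_const measurable_bdry; simp)+
  define C where "C = \<kappa> + 1"
  have C0: "0 \<le> C" using \<kappa> by (simp add: C_def)
  have bdry01: "AE s in ?M. bdry m (\<rho> s) 0 \<in> {0..1}" "AE s in ?M. bdry m (\<rho> s) 1 \<in> {0..1}"
    using AE_bdry(2)[of 0] AE_bdry(2)[of 1] by auto
  have kap: "\<bar>\<kappa> * x\<bar> \<le> \<kappa>" if "\<bar>x\<bar> \<le> 1" for x
    using mult_left_mono[OF that, of \<kappa>] \<kappa> by (simp add: abs_mult)
  have thC: "AE s in ?M. \<bar>th0 s\<bar> \<le> C" "AE s in ?M. \<bar>th1 s\<bar> \<le> C"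
  proof -
    show "AE s in ?M. \<bar>th0 s\<bar> \<le> C"
      using bdry01(1)
    proof eventually_elim
      case (elim s)
      then have "\<bar>\<kappa> * (\<alpha> - bdry m (\<rho> s) 0)\<bar> \<le> \<kappa>" using ab by (intro kap) auto
      then show ?case using D1 by (simp add: th0_def C_def)
    qed
    show "AE s in ?M. \<bar>th1 s\<bar> \<le> C"
      using bdry01(2)
    proof eventually_elim
      case (elim s)
      then have "\<bar>\<kappa> * (\<beta> - bdry m (\<rho> s) 1)\<bar> \<le> \<kappa>" using ab by (intro kap) auto
      then show ?case using D1 by (simp add: th1_def C_def)
    qed
  qed
  have ith: "integrable ?M th0" "integrable ?M th1"
    by (rule integrable_bounded_Icc[OF th_meas(1) thC(1)], rule integrable_bounded_Icc[OF th_meas(2) thC(2)])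
  have if0: "integrable ?M (f k)" for k
    unfolding f_def[abs_def] by (intro Bochner_Integration.integrable_add integrable_mult_right ib ith)
  have sub: "integrable (leb r) F" if "integrable ?M F" "r \<in> {0..T}" for F :: "real \<Rightarrow> real" and r
    using integrable_subinterval[OF that(1), of 0 r] that(2) by auto
  \<comment> \<open>The affine function has no second derivative, so subtracting \<open>h\<close> only moves its slope into the fluxes.\<close>
  have f_rate: "f k s = - (real k * pi)\<^sup>2 * cos_coeff k (\<lambda>u. \<rho> s u ^ m)
        + \<kappa> * ((\<alpha> - bdry m (\<rho> s) 0) + (- 1) ^ k * (\<beta> - bdry m (\<rho> s) 1))" for k s
  proof -
    have "(real k * pi)\<^sup>2 * cos_coeff k h = D * ((- 1) ^ k - 1)"
      unfolding h_def[abs_def] by (rule cos_coeff_linear)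
    then show ?thesis
      unfolding f_def b_def th0_def th1_def by (simp add: algebra_simps)
  qed
  have prim: "p k t = p k 0 + (LINT s|leb t. f k s)" if t: "t \<in> {0..T}" for k t
  proof -
    have "(LINT s|leb 0. f k s) = 0"
      by (rule integral_eq_zero_null_sets) simp
    then have "p k 0 = cos_coeff k g"
      using robin_cos_coeff[OF sol T0(2), of k] unfolding p_def f_rate[symmetric] by simp
    then show ?thesis
      using robin_cos_coeff[OF sol t, of k] unfolding p_def f_rate[symmetric] by simp
  qed
  have pm: "p k \<in> borel_measurable ?M" for k unfolding p_def[abs_def] by (rule measurable_coeff)
  have p1: "\<bar>p k r\<bar> \<le> 1" if "r \<in> {0..T}" for k r
    unfolding p_def using abs_coeff_le(1)[OF AE_power_le[OF that, of 1]] by simp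
  have ip: "integrable ?M (p k)" for k
    by (rule integrable_bounded_Icc[OF pm, of _ 1]) (use p1 in \<open>auto intro!: AE_I2\<close>)
  have \<Phi>m: "\<Phi> \<in> borel_measurable ?M"
    unfolding \<Phi>_def[abs_def] using measurable_moment[OF hc, of 1]
    by (intro borel_measurable_diff measurable_moment) (simp_all add: continuous_on_const)
  have \<Phi>2: "\<bar>\<Phi> r\<bar> \<le> 2" if r: "r \<in> {0..T}" for r
  proof -
    have "\<bar>L2_inner (\<lambda>u. \<rho> r u ^ Suc m) (\<lambda>_. 1 / real (Suc m))\<bar> \<le> 1"
    proof (rule abs_L2_inner_le, rule AE_I2)
      fix u :: real assume "u \<in> space (leb 1)"
      then have u: "u \<in> {0..1}" by simp
      have "1 / real (Suc m) \<le> 1" by simp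
      then have "\<rho> r u ^ Suc m * (1 / real (Suc m)) \<le> 1 * 1"
        using power_range[OF r u, of "Suc m"] by (intro mult_mono) auto
      then show "\<bar>\<rho> r u ^ Suc m * (1 / real (Suc m))\<bar> \<le> 1"
        using power_range[OF r u, of "Suc m"] by (simp add: abs_mult del: power_Suc)
    qed simp
    moreover have "\<bar>L2_inner (\<rho> r) h\<bar> \<le> 1"
    proof (rule abs_L2_inner_le, rule AE_I2)
      fix u :: real assume "u \<in> space (leb 1)"
      then have u: "u \<in> {0..1}" by simp
      show "\<bar>\<rho> r u * h u\<bar> \<le> 1"
        using mult_mono[of "\<bar>\<rho> r u\<bar>" 1 "\<bar>h u\<bar>" 1] range[OF r u] h01[OF u] by (simp add: abs_mult)
    qed simp
    ultimately show ?thesis unfolding \<Phi>_def by linarith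
  qed
  have i\<Phi>: "integrable ?M \<Phi>"
    by (rule integrable_bounded_Icc[OF \<Phi>m, of 2]) (use \<Phi>2 in \<open>auto intro!: AE_I2\<close>)
  define Y where "Y r s = L2_inner (\<rho> s) (z r)" for r s
  have convex: "\<Phi> r - \<Phi> s \<le> Y r r - Y r s" if r: "good r" and s: "s \<in> {0..T}" for r s
  proof -
    have rT: "r \<in> {0..T}" and reg: "regular_profile m (\<rho> r)" using r by (auto simp: good_def)
    have \<rho>1: "AE u in leb 1. \<bar>\<rho> t u\<bar> \<le> 1" if "t \<in> {0..T}" for t
      using AE_power_le[OF that, of 1] by simp
    have i: "integrable (leb 1) (\<lambda>u. \<rho> t u * q u)" if "t \<in> {0..T}" "continuous_on {0..1} q" for t q
      by (rule integrable_bounded_times_continuous[OF measurable_slice[OF that(1)] \<rho>1[OF that(1)] that(2)])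
    have iS: "integrable (leb 1) (\<lambda>u. \<rho> t u ^ Suc m * (1 / real (Suc m)))" if "t \<in> {0..T}" for t
      by (rule integrable_bounded_times_continuous[OF borel_measurable_power[OF measurable_slice[OF that]] AE_power_le[OF that]])
         (rule continuous_on_const)
    have "\<Phi> r - \<Phi> s = (LINT u|leb 1. (\<rho> r u ^ Suc m * (1 / real (Suc m)) - \<rho> r u * h u)
        - (\<rho> s u ^ Suc m * (1 / real (Suc m)) - \<rho> s u * h u))"
      unfolding \<Phi>_def L2_inner_def
      by (simp only: Bochner_Integration.integral_diff Bochner_Integration.integrable_diff iS[OF rT] iS[OF s] i[OF rT hc] i[OF s hc])
    also have "\<dots> \<le> (LINT u|leb 1. \<rho> r u * z r u - \<rho> s u * z r u)"
    proof (rule integral_mono_AE)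
      have "AE u in leb 1. u \<in> {0..1}" by (rule AE_I2) simp
      moreover have "AE u in leb 1. \<rho> r u ^ m = bdry_pow m (\<rho> r) u"
        using reg by (simp add: regular_profile_def)
      ultimately show "AE u in leb 1. (\<rho> r u ^ Suc m * (1 / real (Suc m)) - \<rho> r u * h u)
        - (\<rho> s u ^ Suc m * (1 / real (Suc m)) - \<rho> s u * h u) \<le> \<rho> r u * z r u - \<rho> s u * z r u"
      proof eventually_elim
        case (elim u)
        have "\<rho> r u ^ Suc m / real (Suc m) - \<rho> s u ^ Suc m / real (Suc m) \<le> (\<rho> r u - \<rho> s u) * \<rho> r u ^ m"
          using range[OF rT elim(1)] range[OF s elim(1)] by (intro power_convex) auto
        moreover have "\<rho> r u * z r u - \<rho> s u * z r u = (\<rho> r u - \<rho> s u) * \<rho> r u ^ m - \<rho> r u * h u + \<rho> s u * h u"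
          unfolding z_def elim(2)[symmetric] by (simp add: algebra_simps)
        ultimately show ?case by (simp del: power_Suc)
      qed
    qed (intro Bochner_Integration.integrable_diff iS i rT s hc z(1)[OF r])+
    also have "\<dots> = Y r r - Y r s"
      unfolding Y_def L2_inner_def
      by (rule Bochner_Integration.integral_diff[OF i[OF rT z(1)[OF r]] i[OF s z(1)[OF r]]])
    finally show ?thesis .
  qed
  have Y_lim: "(\<lambda>N. \<Sum>k<N. fejer_coeff N k * p k s * b k r) \<longlonglongrightarrow> Y r s"
    and Y_bd: "\<bar>\<Sum>k<N. fejer_coeff N k * p k s * b k r\<bar> \<le> 1" if r: "good r" and s: "s \<in> {0..T}" for r s N
  proof -
    have \<rho>1: "AE u in leb 1. \<bar>\<rho> s u\<bar> \<le> 1" using AE_power_le[OF s, of 1] by simp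
    show "(\<lambda>N. \<Sum>k<N. fejer_coeff N k * p k s * b k r) \<longlonglongrightarrow> Y r s"
      using fejer_parseval(1)[OF measurable_slice[OF s] \<rho>1 z(1)[OF r]] unfolding Y_def p_def z(3)[OF r] .
    show "\<bar>\<Sum>k<N. fejer_coeff N k * p k s * b k r\<bar> \<le> 1"
      using abs_fejer_sum_le[OF disjI1[OF refl] measurable_slice[OF s] \<rho>1 _ z(1)[OF r] z(2)[OF r], of N]
      unfolding p_def z(3)[OF r] by simp
  qed
  have key: "- 4 \<le> (LINT r|?M. memory l th0 r * z r 0 + memory l th1 r * z r 1)" if l: "0 < l" for l
  proof -
    \<comment> \<open>\<open>X N\<close> is the memory of the rates tested with the Fejer mean of \<open>z\<^sub>r\<close>; in its limit \<open>X'\<close> only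
      increments of \<open>\<rho>\<close>, tested with \<open>z\<^sub>r\<close> itself, are left.\<close>
    define X where "X N r = (\<Sum>k<N. fejer_coeff N k * (b k r * memory l (f k) r))" for N r
    define X' where "X' r = l * (Y r r - exp (- l * r) * Y r 0 - memory l (Y r) r)" for r
    define M where "M N r u = (\<Sum>k<N. fejer_coeff N k * b k r * cos (real k * pi * u))" for N r u
    have X_eq: "X N r = l * ((\<Sum>k<N. fejer_coeff N k * p k r * b k r) - exp (- l * r) * (\<Sum>k<N. fejer_coeff N k * p k 0 * b k r)
        - memory l (\<lambda>s. \<Sum>k<N. fejer_coeff N k * p k s * b k r) r)" if r: "r \<in> {0..T}" for N r
    proof -
      have mf: "memory l (f k) r = l * (p k r - exp (- l * r) * p k 0 - memory l (p k) r)" for k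
      proof (rule memory_primitive[symmetric, OF l _ sub[OF if0 r]])
        show "0 \<le> r" using r by simp
        show "p k t = p k 0 + (LINT s|leb t. f k s)" if "t \<in> {0..r}" for t
          by (rule prim) (use that r in auto)
      qed
      have "memory l (\<lambda>s. \<Sum>k<N. fejer_coeff N k * p k s * b k r) r = memory l (\<lambda>s. \<Sum>k<N. (fejer_coeff N k * b k r) * p k s) r"
        by (simp add: mult_ac)
      also have "\<dots> = (\<Sum>k<N. fejer_coeff N k * b k r * memory l (p k) r)"
        by (simp add: memory_sum[OF integrable_mult_right[OF sub[OF ip r]]] memory_cmult)
      finally have ms: "memory l (\<lambda>s. \<Sum>k<N. fejer_coeff N k * p k s * b k r) r = (\<Sum>k<N. fejer_coeff N k * b k r * memory l (p k) r)" .
      have "X N r = (\<Sum>k<N. l * (fejer_coeff N k * p k r * b k r) - l * (exp (- l * r) * (fejer_coeff N k * p k 0 * b k r))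
          - l * (fejer_coeff N k * b k r * memory l (p k) r))"
        unfolding X_def mf by (intro sum.cong refl) (simp only: algebra_simps)
      also have "\<dots> = l * ((\<Sum>k<N. fejer_coeff N k * p k r * b k r) - exp (- l * r) * (\<Sum>k<N. fejer_coeff N k * p k 0 * b k r)
        - (\<Sum>k<N. fejer_coeff N k * b k r * memory l (p k) r))"
        by (simp only: sum_subtractf sum_distrib_left right_diff_distrib)
      finally show ?thesis unfolding ms .
    qed
    have Xm: "X N \<in> borel_measurable ?M" for N
      unfolding X_def[abs_def]
      by (intro borel_measurable_sum borel_measurable_times borel_measurable_const bm measurable_continuous_Icc
          continuous_on_memory if0)
    have pbm: "(\<lambda>s. \<Sum>k<N. fejer_coeff N k * p k s * b k r) \<in> borel_measurable ?M" for N r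
      by (intro borel_measurable_sum borel_measurable_times borel_measurable_const pm)
    have ipb: "integrable (leb r) (\<lambda>s. \<Sum>k<N. fejer_coeff N k * p k s * b k r)" if r: "r \<in> {0..T}" for N r
      by (intro Bochner_Integration.integrable_sum integrable_mult_left integrable_mult_right sub[OF ip r])
    have e1: "0 \<le> exp (- l * r)" "exp (- l * r) \<le> 1" if "0 \<le> r" for r using l that by auto
    have X_bd: "AE r in ?M. \<bar>X N r\<bar> \<le> l * 3" for N
      using AE_good
    proof eventually_elim
      case (elim r)
      then have r: "r \<in> {0..T}" by (simp add: good_def)
      have "\<bar>memory l (\<lambda>s. \<Sum>k<N. fejer_coeff N k * p k s * b k r) r\<bar> \<le> 1"
      proof (rule abs_memory_le[OF _ _ ipb[OF r]])
        show "AE s in leb r. \<bar>\<Sum>k<N. fejer_coeff N k * p k s * b k r\<bar> \<le> 1"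
          by (rule AE_I2) (use r in \<open>auto intro!: Y_bd[OF elim]\<close>)
      qed (use l r in auto)
      moreover have "\<bar>\<Sum>k<N. fejer_coeff N k * p k r * b k r\<bar> \<le> 1" by (rule Y_bd[OF elim r])
      moreover have "\<bar>exp (- l * r) * (\<Sum>k<N. fejer_coeff N k * p k 0 * b k r)\<bar> \<le> 1"
        using mult_mono[OF e1(2)[of r] Y_bd[OF elim T0(2), of N]] r by (simp add: abs_mult)
      ultimately have "\<bar>(\<Sum>k<N. fejer_coeff N k * p k r * b k r) - exp (- l * r) * (\<Sum>k<N. fejer_coeff N k * p k 0 * b k r)
        - memory l (\<lambda>s. \<Sum>k<N. fejer_coeff N k * p k s * b k r) r\<bar> \<le> 3" by linarith
      then show ?case unfolding X_eq[OF r] abs_mult using l by (simp add: mult_left_mono)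
    qed
    have X_lim: "AE r in ?M. (\<lambda>N. X N r) \<longlonglongrightarrow> X' r"
      using AE_good
    proof eventually_elim
      case (elim r)
      then have r: "r \<in> {0..T}" by (simp add: good_def)
      have "(\<lambda>N. memory l (\<lambda>s. \<Sum>k<N. fejer_coeff N k * p k s * b k r) r) \<longlonglongrightarrow> memory l (Y r) r"
        unfolding memory_def
      proof (rule bounded_convergence_Icc[where B = l])
        show "(\<lambda>x. l * exp (- l * (r - x)) * (\<Sum>k<N. fejer_coeff N k * p k x * b k r)) \<in> borel_measurable (leb r)" for N
          by (intro borel_measurable_integrable integrable_memory_integrand ipb r)
        show "AE x in leb r. \<bar>l * exp (- l * (r - x)) * (\<Sum>k<N. fejer_coeff N k * p k x * b k r)\<bar> \<le> l" for N
        proof (rule AE_I2)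
          fix x assume "x \<in> space (leb r)"
          then have x: "x \<in> {0..T}" "0 \<le> r - x" using r by auto
          have "l * exp (- l * (r - x)) \<le> l * 1" using l e1(2)[OF x(2)] by (intro mult_left_mono) auto
          from mult_mono[OF this Y_bd[OF elim x(1), of N]]
          show "\<bar>l * exp (- l * (r - x)) * (\<Sum>k<N. fejer_coeff N k * p k x * b k r)\<bar> \<le> l"
            using l by (simp add: abs_mult)
        qed
        show "AE x in leb r. (\<lambda>N. l * exp (- l * (r - x)) * (\<Sum>k<N. fejer_coeff N k * p k x * b k r))
            \<longlonglongrightarrow> l * exp (- l * (r - x)) * Y r x"
          by (rule AE_I2) (use r in \<open>auto intro!: tendsto_mult_left Y_lim[OF elim]\<close>)
      qed
      then show ?case
        unfolding X_eq[OF r] X'_def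
        by (intro tendsto_intros Y_lim[OF elim] r T0)
    qed
    have X'm: "X' \<in> borel_measurable ?M" by (rule measurable_AE_limit[OF Xm _ X_lim]) simp
    have X'_bd: "AE r in ?M. \<bar>X' r\<bar> \<le> l * 3"
    proof -
      have "AE r in ?M. \<forall>N. \<bar>X N r\<bar> \<le> l * 3" using X_bd by (simp add: AE_all_countable)
      then show ?thesis using X_lim
        by eventually_elim (auto intro!: LIMSEQ_le_const2[OF tendsto_rabs])
    qed
    have lim1: "(\<lambda>N. LINT r|?M. X N r) \<longlonglongrightarrow> (LINT r|?M. X' r)"
      by (rule bounded_convergence_Icc[OF Xm X_bd X_lim])
    have lower: "- 4 \<le> (LINT r|?M. X' r)"
    proof -
      have im\<Phi>: "integrable ?M (memory l \<Phi>)"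
        by (intro continuous_imp_integrable_real continuous_on_memory i\<Phi>)
      have iexp: "integrable ?M (\<lambda>r. l * exp (- l * r) * \<Phi> 0)"
        by (intro continuous_imp_integrable_real continuous_intros)
      have i\<Phi>m: "integrable ?M (\<lambda>r. \<Phi> r - memory l \<Phi> r)"
        by (rule Bochner_Integration.integrable_diff[OF i\<Phi> im\<Phi>])
      have ix: "(LINT r|?M. l * exp (- l * r) * \<Phi> 0) = (1 - exp (- l * T)) * \<Phi> 0"
      proof -
        have "(LINT r|?M. l * exp (- l * r) * \<Phi> 0) = (LINT r|?M. (- \<Phi> 0) * (- l * exp (- l * r)))"
          by (simp add: mult_ac)
        also have "\<dots> = (- \<Phi> 0) * (LINT r|?M. - l * exp (- l * r))"
          by (rule integral_mult_right_zero)
        also have "\<dots> = (1 - exp (- l * T)) * \<Phi> 0"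
          unfolding LINT_exp_minus[OF T0(1)] by (simp add: algebra_simps)
        finally show ?thesis .
      qed
      have "(LINT r|?M. l * (\<Phi> r - memory l \<Phi> r) - l * exp (- l * r) * \<Phi> 0)
          = l * (LINT r|?M. \<Phi> r - memory l \<Phi> r) - (LINT r|?M. l * exp (- l * r) * \<Phi> 0)"
        by (subst Bochner_Integration.integral_diff[OF integrable_mult_right[OF i\<Phi>m] iexp]) simp
      also have "\<dots> = memory l \<Phi> T - (1 - exp (- l * T)) * \<Phi> 0"
        unfolding LINT_memory[OF T0(1) l i\<Phi>] ix ..
      also have "\<dots> \<ge> - 4"
      proof -
        have "\<bar>memory l \<Phi> T\<bar> \<le> 2"
          by (rule abs_memory_le[OF _ T0(1) i\<Phi>]) (use l \<Phi>2 in \<open>auto intro!: AE_I2\<close>)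
        moreover have "\<bar>(1 - exp (- l * T)) * \<Phi> 0\<bar> \<le> 1 * 2"
          unfolding abs_mult using \<Phi>2[OF T0(2)] e1[OF T0(1)] by (intro mult_mono) auto
        ultimately show ?thesis by linarith
      qed
      finally have "- 4 \<le> (LINT r|?M. l * (\<Phi> r - memory l \<Phi> r) - l * exp (- l * r) * \<Phi> 0)" .
      also have "\<dots> \<le> (LINT r|?M. X' r)"
      proof (rule integral_mono_AE)
        show "integrable ?M (\<lambda>r. l * (\<Phi> r - memory l \<Phi> r) - l * exp (- l * r) * \<Phi> 0)"
          by (rule Bochner_Integration.integrable_diff[OF integrable_mult_right[OF i\<Phi>m] iexp])
        show "integrable ?M X'" by (rule integrable_bounded_Icc[OF X'm X'_bd])
        show "AE r in ?M. l * (\<Phi> r - memory l \<Phi> r) - l * exp (- l * r) * \<Phi> 0 \<le> X' r"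
          using AE_good
        proof eventually_elim
          case (elim r)
          then have r: "r \<in> {0..T}" by (simp add: good_def)
          have Ym: "Y r \<in> borel_measurable (leb r)"
          proof (rule measurable_AE_limit)
            show "(\<lambda>s. \<Sum>k<N. fejer_coeff N k * p k s * b k r) \<in> borel_measurable (leb r)" for N
              by (rule borel_measurable_integrable[OF ipb[OF r]])
            show "AE s in leb r. (\<lambda>N. \<Sum>k<N. fejer_coeff N k * p k s * b k r) \<longlonglongrightarrow> Y r s"
              by (rule AE_I2) (use r in \<open>auto intro!: Y_lim[OF elim]\<close>)
          qed simp
          have Y1: "\<bar>Y r s\<bar> \<le> 1" if "s \<in> {0..T}" for s
            by (rule LIMSEQ_le_const2[OF tendsto_rabs[OF Y_lim[OF elim that]]]) (use Y_bd[OF elim that] in auto)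
          have iY: "integrable (leb r) (Y r)"
            by (rule integrable_bounded_Icc[OF Ym, of 1]) (use Y1 r in \<open>auto intro!: AE_I2\<close>)
          have ic: "integrable (leb r) (\<lambda>_. c)" for c :: real by (rule integrable_const_Icc)
          have i\<Phi>r: "integrable (leb r) \<Phi>" by (rule sub[OF i\<Phi> r])
          have "memory l (\<lambda>s. \<Phi> r - \<Phi> s) r \<le> memory l (\<lambda>s. Y r r - Y r s) r"
            by (intro memory_mono Bochner_Integration.integrable_diff ic i\<Phi>r iY AE_I2)
               (use l r convex[OF elim] in auto)
          then have "(1 - exp (- l * r)) * \<Phi> r - memory l \<Phi> r \<le> (1 - exp (- l * r)) * Y r r - memory l (Y r) r"
            using memory_diff[OF ic i\<Phi>r] memory_diff[OF ic iY] memory_const[of r l] r by simp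
          moreover have "exp (- l * r) * (\<Phi> r - \<Phi> 0) \<le> exp (- l * r) * (Y r r - Y r 0)"
            by (intro mult_left_mono convex[OF elim T0(2)]) simp
          ultimately have "\<Phi> r - memory l \<Phi> r - exp (- l * r) * \<Phi> 0 \<le> Y r r - exp (- l * r) * Y r 0 - memory l (Y r) r"
            by (simp add: algebra_simps)
          from mult_left_mono[OF this, of l] l show ?case
            unfolding X'_def by (simp add: algebra_simps)
        qed
      qed
      finally show ?thesis .
    qed
    have ib_mem: "integrable ?M (\<lambda>r. b k r * memory l F r)" if "integrable ?M F" for k F
      by (rule integrable_bounded_times_continuous[OF bm b1 continuous_on_memory[OF that]])
    \<comment> \<open>This is where the diffusion terms are discarded by their sign.\<close>
    have upper: "(LINT r|?M. X N r) \<le> (LINT r|?M. memory l th0 r * M N r 0 + memory l th1 r * M N r 1)" for N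
    proof -
      let ?t = "\<lambda>k s. th0 s + (- 1) ^ k * th1 s"
      have it: "integrable ?M (?t k)" for k
        by (intro Bochner_Integration.integrable_add integrable_mult_right ith)
      have mf: "memory l (f k) r = - (real k * pi)\<^sup>2 * memory l (b k) r + memory l (?t k) r" if r: "r \<in> {0..T}" for k r
        unfolding f_def[abs_def]
        by (simp only: memory_add[OF integrable_mult_right[OF sub[OF ib r]] sub[OF it r]] memory_cmult)
      have mode_le: "(LINT r|?M. b k r * memory l (f k) r) \<le> (LINT r|?M. b k r * memory l (?t k) r)" for k
      proof -
        have "(LINT r|?M. b k r * memory l (f k) r)
            = (LINT r|?M. - (real k * pi)\<^sup>2 * (b k r * memory l (b k) r) + b k r * memory l (?t k) r)"
          by (intro Bochner_Integration.integral_cong) (auto simp: mf algebra_simps)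
        also have "\<dots> = - (real k * pi)\<^sup>2 * (LINT r|?M. b k r * memory l (b k) r) + (LINT r|?M. b k r * memory l (?t k) r)"
          by (subst Bochner_Integration.integral_add[OF integrable_mult_right[OF ib_mem[OF ib]] ib_mem[OF it]]) simp
        also have "\<dots> \<le> (LINT r|?M. b k r * memory l (?t k) r)"
          using mult_nonneg_nonneg[OF zero_le_power2[of "real k * pi"] LINT_times_memory_nonneg[OF T0(1) less_imp_le[OF l] ib[of k]]]
          by simp
        finally show ?thesis .
      qed
      have "(LINT r|?M. X N r) = (\<Sum>k<N. fejer_coeff N k * (LINT r|?M. b k r * memory l (f k) r))"
        unfolding X_def using ib_mem[OF if0] by simp
      also have "\<dots> \<le> (\<Sum>k<N. fejer_coeff N k * (LINT r|?M. b k r * memory l (?t k) r))"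
        by (intro sum_mono mult_left_mono mode_le fejer_coeff_nonneg) auto
      also have "\<dots> = (LINT r|?M. (\<Sum>k<N. fejer_coeff N k * (b k r * memory l (?t k) r)))"
        using ib_mem[OF it] by simp
      also have "\<dots> = (LINT r|?M. memory l th0 r * M N r 0 + memory l th1 r * M N r 1)"
      proof (intro Bochner_Integration.integral_cong refl)
        fix r assume "r \<in> space ?M"
        then have r: "r \<in> {0..T}" by simp
        have mt: "memory l (?t k) r = memory l th0 r + (- 1) ^ k * memory l th1 r" for k
          by (simp only: memory_add[OF sub[OF ith(1) r] integrable_mult_right[OF sub[OF ith(2) r]]] memory_cmult)
        show "(\<Sum>k<N. fejer_coeff N k * (b k r * memory l (?t k) r)) = memory l th0 r * M N r 0 + memory l th1 r * M N r 1"
          unfolding mt M_def by (simp add: sum_distrib_left sum.distrib[symmetric] algebra_simps)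
      qed
      finally show ?thesis .
    qed
    have M_lim: "(\<lambda>N. M N r u) \<longlonglongrightarrow> z r u" and M_bd: "\<bar>M N r u\<bar> \<le> 1" if r: "good r" and u: "u \<in> {0..1}" for r u N
    proof -
      have "M N r u = cos_mean N (z r) u" for N unfolding M_def cos_mean_def z(3)[OF r] ..
      moreover have "AE u in leb 1. \<bar>z r u\<bar> \<le> 1" by (rule AE_I2) (use z(2)[OF r] in auto)
      ultimately show "(\<lambda>N. M N r u) \<longlonglongrightarrow> z r u" "\<bar>M N r u\<bar> \<le> 1"
        using cos_mean_tendsto[OF z(1)[OF r] u] abs_mean_le(1)[OF measurable_continuous_Icc[OF z(1)[OF r]], of 1 N u] by auto
    qed
    have memC: "\<bar>memory l th0 r\<bar> \<le> C" "\<bar>memory l th1 r\<bar> \<le> C" if r: "r \<in> {0..T}" for r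
      by (rule abs_memory_le[OF _ _ sub[OF ith(1) r] AE_Icc_subset[OF thC(1)] C0], use l r in auto)
         (rule abs_memory_le[OF _ _ sub[OF ith(2) r] AE_Icc_subset[OF thC(2)] C0], use l r in auto)
    have lim2: "(\<lambda>N. LINT r|?M. memory l th0 r * M N r 0 + memory l th1 r * M N r 1)
        \<longlonglongrightarrow> (LINT r|?M. memory l th0 r * z r 0 + memory l th1 r * z r 1)"
    proof (rule bounded_convergence_Icc[where B = "2 * C"])
      have Mm: "(\<lambda>r. M N r u) \<in> borel_measurable ?M" for N u
        unfolding M_def[abs_def] by (intro borel_measurable_sum borel_measurable_times borel_measurable_const bm)
      show "(\<lambda>r. memory l th0 r * M N r 0 + memory l th1 r * M N r 1) \<in> borel_measurable ?M" for N
        by (intro borel_measurable_add borel_measurable_times Mm measurable_continuous_Icc[OF continuous_on_memory] ith)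
      show "AE r in ?M. \<bar>memory l th0 r * M N r 0 + memory l th1 r * M N r 1\<bar> \<le> 2 * C" for N
        using AE_good
      proof eventually_elim
        case (elim r)
        then have r: "r \<in> {0..T}" by (simp add: good_def)
        have "\<bar>memory l th0 r * M N r 0\<bar> \<le> C * 1" "\<bar>memory l th1 r * M N r 1\<bar> \<le> C * 1"
          unfolding abs_mult by (intro mult_mono memC[OF r] M_bd[OF elim] C0; simp)+
        then show ?case by linarith
      qed
      show "AE r in ?M. (\<lambda>N. memory l th0 r * M N r 0 + memory l th1 r * M N r 1)
          \<longlonglongrightarrow> memory l th0 r * z r 0 + memory l th1 r * z r 1"
        using AE_good by eventually_elim (intro tendsto_intros M_lim; simp)
    qed
    have "(LINT r|?M. X' r) \<le> (LINT r|?M. memory l th0 r * z r 0 + memory l th1 r * z r 1)"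
      by (rule LIMSEQ_le[OF lim1 lim2]) (use upper in auto)
    with lower show ?thesis by linarith
  qed
  have zm: "(\<lambda>r. z r u) \<in> borel_measurable ?M" if "u \<in> {0..1}" for u
    unfolding z_def by (intro borel_measurable_diff measurable_bdry_pow[OF that] borel_measurable_const)
  have z1: "AE r in ?M. \<bar>z r u\<bar> \<le> 1" if "u \<in> {0..1}" for u
    using AE_good by eventually_elim (rule z(2)[OF _ that])
  have u01: "0 \<in> {0..1::real}" "1 \<in> {0..1::real}" by auto
  have itz: "integrable ?M (\<lambda>r. F r * z r u)" if F: "F \<in> borel_measurable ?M" "AE r in ?M. \<bar>F r\<bar> \<le> C" and u: "u \<in> {0..1}" for F u
  proof (rule integrable_bounded_Icc[where B = "C * 1"])
    show "(\<lambda>r. F r * z r u) \<in> borel_measurable ?M" by (intro borel_measurable_times F zm u)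
    show "AE r in ?M. \<bar>F r * z r u\<bar> \<le> C * 1"
      using F(2) z1[OF u] by eventually_elim (unfold abs_mult, intro mult_mono C0, auto)
  qed
  have imz: "integrable ?M (\<lambda>r. memory l F r * z r u)" if "integrable ?M F" and u: "u \<in> {0..1}" for F u l
    using integrable_bounded_times_continuous[OF zm[OF u] z1[OF u] continuous_on_memory[OF that(1)]]
    by (simp add: mult.commute)
  have "(\<lambda>n. (LINT r|?M. memory (real n) th0 r * z r 0) + (LINT r|?M. memory (real n) th1 r * z r 1))
      \<longlonglongrightarrow> (LINT r|?M. th0 r * z r 0) + (LINT r|?M. th1 r * z r 1)"
    by (intro tendsto_add memory_tendsto_weakly[OF T0(1) th_meas(1) thC(1) C0 zm z1] memory_tendsto_weakly[OF T0(1) th_meas(2) thC(2) C0 zm z1] u01)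
       auto
  then have lim: "(\<lambda>n. LINT r|?M. memory (real n) th0 r * z r 0 + memory (real n) th1 r * z r 1)
      \<longlonglongrightarrow> (LINT r|?M. th0 r * z r 0 + th1 r * z r 1)"
    by (simp only: Bochner_Integration.integral_add imz ith u01 itz th_meas thC)
  have "- 4 \<le> (LINT r|?M. th0 r * z r 0 + th1 r * z r 1)"
    by (rule LIMSEQ_le_const[OF lim]) (use key in \<open>auto intro!: exI[of _ 1]\<close>)
  also have "\<dots> = (LINT r|?M. D * (z r 0 - z r 1) - \<kappa> * ((bdry m (\<rho> r) 0 - \<alpha>) * (bdry_pow m (\<rho> r) 0 - \<alpha> ^ m)
      + (bdry m (\<rho> r) 1 - \<beta>) * (bdry_pow m (\<rho> r) 1 - \<beta> ^ m)))"
  proof -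
    have ze: "bdry_pow m (\<rho> r) 0 - \<alpha> ^ m = z r 0" "bdry_pow m (\<rho> r) 1 - \<beta> ^ m = z r 1" for r
      by (simp_all add: z_def h_def D_def)
    have "th0 r * z r 0 + th1 r * z r 1 = D * (z r 0 - z r 1) - \<kappa> * ((bdry m (\<rho> r) 0 - \<alpha>) * (bdry_pow m (\<rho> r) 0 - \<alpha> ^ m)
      + (bdry m (\<rho> r) 1 - \<beta>) * (bdry_pow m (\<rho> r) 1 - \<beta> ^ m))" for r
      unfolding th0_def th1_def ze by (simp add: algebra_simps)
    then show ?thesis by simp
  qed
  also have "\<dots> = (LINT r|?M. D * (z r 0 - z r 1)) - \<kappa> * (LINT r|?M. (bdry m (\<rho> r) 0 - \<alpha>) * (bdry_pow m (\<rho> r) 0 - \<alpha> ^ m)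
      + (bdry m (\<rho> r) 1 - \<beta>) * (bdry_pow m (\<rho> r) 1 - \<beta> ^ m))"
  proof -
    have iz: "integrable ?M (\<lambda>r. z r u)" if "u \<in> {0..1}" for u
      by (rule integrable_bounded_Icc[OF zm[OF that] z1[OF that]])
    have i: "integrable ?M (\<lambda>r. (bdry m (\<rho> r) u - a) * (bdry_pow m (\<rho> r) u - a ^ m))" if u: "u \<in> {0..1}" and a: "a \<in> {0..1}" for u a
    proof (rule integrable_bounded_Icc[where B = "1 * 1"])
      show "(\<lambda>r. (bdry m (\<rho> r) u - a) * (bdry_pow m (\<rho> r) u - a ^ m)) \<in> borel_measurable ?M"
        by (intro borel_measurable_times borel_measurable_diff borel_measurable_const measurable_bdry measurable_bdry_pow u)
      have am: "0 \<le> a ^ m" "a ^ m \<le> 1" using a by (auto intro: power_le_one)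
      show "AE r in ?M. \<bar>(bdry m (\<rho> r) u - a) * (bdry_pow m (\<rho> r) u - a ^ m)\<bar> \<le> 1 * 1"
        using AE_bdry(1,2)[OF u]
      proof eventually_elim
        case (elim r)
        have "\<bar>bdry m (\<rho> r) u - a\<bar> \<le> 1" "\<bar>bdry_pow m (\<rho> r) u - a ^ m\<bar> \<le> 1"
          using elim a am unfolding atLeastAtMost_iff by linarith+
        then show ?case unfolding abs_mult by (intro mult_mono) auto
      qed
    qed
    show ?thesis
      by (subst Bochner_Integration.integral_diff)
         (auto intro!: integrable_mult_right Bochner_Integration.integrable_diff Bochner_Integration.integrable_add iz i ab)
  qed
  also have "(LINT r|?M. D * (z r 0 - z r 1)) \<le> 2 * T"
  proof -
    have "AE r in ?M. \<bar>D * (z r 0 - z r 1)\<bar> \<le> 1 * 2"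
      using z1[OF u01(1)] z1[OF u01(2)] by eventually_elim (unfold abs_mult, intro mult_mono D1, auto)
    from LINT_abs_le_Icc[OF T0(1) this] show ?thesis by simp
  qed
  finally show ?thesis by simp
qed

end

section \<open>Convergence\<close>

lemma (in pme_profile) robin_boundary_L1_le:
  assumes sol: "robin_weak_solution m T \<alpha> \<beta> \<kappa> g \<rho>" and \<kappa>: "0 < \<kappa>" and d: "0 < d"
    and ab: "\<alpha> \<in> {0..1}" "\<beta> \<in> {0..1}"
  shows "(LINT t|leb T. \<bar>bdry_pow m (\<rho> t) 0 - \<alpha> ^ m\<bar> + \<bar>bdry_pow m (\<rho> t) 1 - \<beta> ^ m\<bar>)
    \<le> 2 * T * d + (real m / d) * ((4 + 2 * T) / \<kappa>)"
proof -
  let ?M = "leb T"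
  let ?P = "\<lambda>u a t. (bdry m (\<rho> t) u - a) * (bdry_pow m (\<rho> t) u - a ^ m)"
  let ?A = "\<lambda>u a t. \<bar>bdry_pow m (\<rho> t) u - a ^ m\<bar>"
  have iP: "integrable ?M (?P u a)" and iA: "integrable ?M (?A u a)" if u: "u \<in> {0..1}" and a: "a \<in> {0..1}" for u a
  proof -
    have am: "0 \<le> a ^ m" "a ^ m \<le> 1" using a by (auto intro: power_le_one)
    have Am: "(\<lambda>t. bdry_pow m (\<rho> t) u - a ^ m) \<in> borel_measurable ?M"
      by (intro borel_measurable_diff borel_measurable_const measurable_bdry_pow u)
    have A1: "AE t in ?M. \<bar>bdry_pow m (\<rho> t) u - a ^ m\<bar> \<le> 1"
      using AE_bdry(1)[OF u] by eventually_elim (use am in \<open>unfold atLeastAtMost_iff, linarith\<close>)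
    show "integrable ?M (?A u a)"
      by (intro integrable_abs integrable_bounded_Icc[OF Am A1])
    show "integrable ?M (?P u a)"
    proof (rule integrable_bounded_Icc[where B = "1 * 1"])
      show "?P u a \<in> borel_measurable ?M"
        by (intro borel_measurable_times borel_measurable_diff borel_measurable_const measurable_bdry measurable_bdry_pow u)
      show "AE t in ?M. \<bar>?P u a t\<bar> \<le> 1 * 1"
        using AE_bdry(2)[OF u] A1 by eventually_elim (unfold abs_mult, intro mult_mono, use a in auto)
    qed
  qed
  have le: "AE t in ?M. ?A u a t \<le> d + (real m / d) * ?P u a t" if u: "u \<in> {0..1}" and a: "a \<in> {0..1}" for u a
    using AE_bdry(2,3)[OF u]
  proof eventually_elim
    case (elim t)
    show ?case using abs_power_diff_le_product[OF elim(1) a d m] unfolding elim(2) .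
  qed
  have u01: "0 \<in> {0..1::real}" "1 \<in> {0..1::real}" by auto
  note i = iP[OF u01(1) ab(1)] iP[OF u01(2) ab(2)] iA[OF u01(1) ab(1)] iA[OF u01(2) ab(2)]
  have iS: "integrable ?M (\<lambda>t. ?P 0 \<alpha> t + ?P 1 \<beta> t)"
    by (intro Bochner_Integration.integrable_add i)
  have "(LINT t|?M. ?A 0 \<alpha> t + ?A 1 \<beta> t) \<le> (LINT t|?M. 2 * d + (real m / d) * (?P 0 \<alpha> t + ?P 1 \<beta> t))"
  proof (rule integral_mono_AE)
    show "AE t in ?M. ?A 0 \<alpha> t + ?A 1 \<beta> t \<le> 2 * d + (real m / d) * (?P 0 \<alpha> t + ?P 1 \<beta> t)"
      using le[OF u01(1) ab(1)] le[OF u01(2) ab(2)]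
    proof eventually_elim
      case (elim t)
      have "2 * d + (real m / d) * (p + q) = (d + (real m / d) * p) + (d + (real m / d) * q)" for p q
        by (simp add: distrib_left)
      then show ?case using add_mono[OF elim] by (simp only:)
    qed
  qed (intro Bochner_Integration.integrable_add integrable_const_Icc integrable_mult_right i)+
  also have "\<dots> = T * (2 * d) + (real m / d) * (LINT t|?M. ?P 0 \<alpha> t + ?P 1 \<beta> t)"
    by (subst Bochner_Integration.integral_add[OF integrable_const_Icc integrable_mult_right[OF iS]])
       (use LINT_const_Icc[of 0 T "2 * d"] T in simp)
  also have "\<dots> \<le> T * (2 * d) + (real m / d) * ((4 + 2 * T) / \<kappa>)"
  proof -
    have "(LINT t|?M. ?P 0 \<alpha> t + ?P 1 \<beta> t) \<le> (4 + 2 * T) / \<kappa>"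
      using robin_energy[OF sol \<kappa> ab] \<kappa> by (simp add: pos_le_divide_eq mult.commute)
    then show ?thesis using d by (intro add_left_mono mult_left_mono) auto
  qed
  finally show ?thesis by (simp add: mult_ac)
qed

text \<open>
  First \<open>d\<close> is chosen with \<open>T d\<^sup>2 = e\<^sup>2/2\<close>; for this \<open>d\<close> the second term is eventually below \<open>e\<^sup>2/2\<close>.
\<close>

lemma tendsto_0_by_interpolation:
  fixes X Y :: "real \<Rightarrow> real"
  assumes X: "\<And>x d. P x \<Longrightarrow> 0 < d \<Longrightarrow> (X x)\<^sup>2 \<le> T * d\<^sup>2 + (1 / d ^ k) * Y x"
    and ev: "eventually P F" and T: "0 < T" and Y: "(Y \<longlongrightarrow> 0) F"
  shows "(X \<longlongrightarrow> 0) F"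
proof (rule tendstoI)
  fix e :: real assume e: "0 < e"
  define d where "d = e / sqrt (2 * T)"
  have d: "0 < d" using e T by (simp add: d_def)
  have Td: "T * d\<^sup>2 = e\<^sup>2 / 2" using T by (simp add: d_def power_divide)
  have "\<forall>\<^sub>F x in F. Y x < d ^ k * (e\<^sup>2 / 2)"
    using Y e d by (intro order_tendstoD) auto
  with ev show "\<forall>\<^sub>F x in F. dist (X x) 0 < e"
  proof eventually_elim
    case (elim x)
    have "(1 / d ^ k) * Y x < (1 / d ^ k) * (d ^ k * (e\<^sup>2 / 2))"
      using elim(2) d by (intro mult_strict_left_mono) auto
    also have "\<dots> = e\<^sup>2 / 2" using d by simp
    finally have "(X x)\<^sup>2 < e\<^sup>2" using X[OF elim(1) d] Td by linarith
    then have "\<bar>X x\<bar> < e"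
      using power2_less_imp_less[of "\<bar>X x\<bar>" e] e by simp
    then show ?case by simp
  qed
qed

theorem theorem2p6:
  fixes \<alpha> \<beta> T :: real and m :: nat and g :: "real \<Rightarrow> real"
    and \<rho> :: "real \<Rightarrow> real \<Rightarrow> real \<Rightarrow> real"
    and \<rho>0 \<rho>inf :: "real \<Rightarrow> real \<Rightarrow> real"
  assumes "\<alpha> \<in> {0<..<1}" and "\<beta> \<in> {0<..<1}" and "m \<ge> 1" and "T > 0"
    and "g \<in> borel_measurable (lebesgue_on {0..1})" and "\<forall>u\<in>{0..1}. g u \<in> {0..1}"
    and "\<And>\<kappa>. \<kappa> > 0 \<Longrightarrow> robin_weak_solution m T \<alpha> \<beta> \<kappa> g (\<rho> \<kappa>)"
    and "neumann_weak_solution m T g \<rho>0"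
    and "dirichlet_weak_solution m T \<alpha> \<beta> g \<rho>inf"
  shows "((\<lambda>\<kappa>. L2_spacetime_dist T (\<rho> \<kappa>) \<rho>0) \<longlongrightarrow> 0) (at_right 0) \<and>
         ((\<lambda>\<kappa>. L2_spacetime_dist T (\<rho> \<kappa>) \<rho>inf) \<longlongrightarrow> 0) at_top"
proof
  have ab: "\<alpha> \<in> {0..1}" "\<beta> \<in> {0..1}" using assms(1,2) by auto
  have prof: "pme_profile m T (\<rho> \<kappa>)" if "0 < \<kappa>" for \<kappa>
    using assms(3,4) assms(7)[OF that] by (simp add: pme_profile_def robin_weak_solution_def)
  have prof0: "pme_profile m T \<rho>0" and profinf: "pme_profile m T \<rho>inf"
    using assms(3,4,8,9) by (simp_all add: pme_profile_def neumann_weak_solution_def dirichlet_weak_solution_def)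
  show "((\<lambda>\<kappa>. L2_spacetime_dist T (\<rho> \<kappa>) \<rho>0) \<longlongrightarrow> 0) (at_right 0)"
  proof (rule tendsto_0_by_interpolation[where P = "\<lambda>\<kappa>. 0 < \<kappa>" and T = T and k = "m - 1" and Y = "\<lambda>\<kappa>. (2 * T\<^sup>2 + 8 * T) * \<kappa>"])
    fix \<kappa> d :: real assume \<kappa>: "0 < \<kappa>" and d: "0 < d"
    interpret pme_profile_pair m T "\<rho> \<kappa>" \<rho>0
      using prof[OF \<kappa>] prof0 by (rule pme_profile_pair.intro)
    have "(1 / d ^ (m - 1)) * (LINT t|leb T. monotone_pairing m (\<rho> \<kappa> t) (\<rho>0 t))
        \<le> (1 / d ^ (m - 1)) * ((2 * T\<^sup>2 + 8 * T) * \<kappa>)"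
      using d \<kappa> by (intro mult_left_mono robin_neumann_pairing_le[OF ab _ assms(7)[OF \<kappa>] neumann_imp_robin_0[OF assms(8)]]) auto
    then show "(L2_spacetime_dist T (\<rho> \<kappa>) \<rho>0)\<^sup>2 \<le> T * d\<^sup>2 + (1 / d ^ (m - 1)) * ((2 * T\<^sup>2 + 8 * T) * \<kappa>)"
      using dist_square_le[OF d] by linarith
  next
    show "\<forall>\<^sub>F \<kappa> in at_right 0. 0 < (\<kappa> :: real)" by (simp add: eventually_at_filter)
    have "((\<lambda>\<kappa>. (2 * T\<^sup>2 + 8 * T) * \<kappa>) \<longlongrightarrow> (2 * T\<^sup>2 + 8 * T) * 0) (at_right 0)"
      by (intro tendsto_intros)
    then show "((\<lambda>\<kappa>. (2 * T\<^sup>2 + 8 * T) * \<kappa>) \<longlongrightarrow> 0) (at_right 0)" by simp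
  qed (rule assms(4))
  \<comment> \<open>The boundary estimate has the form \<open>d + 1 / (d \<kappa>)\<close> up to constants, which \<open>d = 1 / sqrt \<kappa>\<close> balances.\<close>
  let ?Y = "\<lambda>\<kappa>. 2 * T * (1 / sqrt \<kappa>) + (real m / (1 / sqrt \<kappa>)) * ((4 + 2 * T) / \<kappa>)"
  show "((\<lambda>\<kappa>. L2_spacetime_dist T (\<rho> \<kappa>) \<rho>inf) \<longlongrightarrow> 0) at_top"
  proof (rule tendsto_0_by_interpolation[where P = "\<lambda>\<kappa>. 0 < \<kappa>" and T = T and k = "m - 1" and Y = ?Y])
    fix \<kappa> d :: real assume \<kappa>: "0 < \<kappa>" and d: "0 < d"
    interpret pme_profile_pair m T "\<rho> \<kappa>" \<rho>inf
      using prof[OF \<kappa>] profinf by (rule pme_profile_pair.intro)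
    have "(LINT t|leb T. monotone_pairing m (\<rho> \<kappa> t) (\<rho>inf t)) \<le> ?Y \<kappa>"
      using robin_dirichlet_pairing_le[OF assms(7)[OF \<kappa>] assms(9) ab]
        P1.robin_boundary_L1_le[OF assms(7)[OF \<kappa>] \<kappa> _ ab, of "1 / sqrt \<kappa>"] \<kappa> by simp
    then have "(1 / d ^ (m - 1)) * (LINT t|leb T. monotone_pairing m (\<rho> \<kappa> t) (\<rho>inf t)) \<le> (1 / d ^ (m - 1)) * ?Y \<kappa>"
      using d by (intro mult_left_mono) auto
    then show "(L2_spacetime_dist T (\<rho> \<kappa>) \<rho>inf)\<^sup>2 \<le> T * d\<^sup>2 + (1 / d ^ (m - 1)) * ?Y \<kappa>"
      using dist_square_le[OF d] by linarith
  next
    show "\<forall>\<^sub>F \<kappa> in at_top. 0 < (\<kappa> :: real)" by (rule eventually_gt_at_top)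
    have 1: "((\<lambda>\<kappa>::real. 1 / sqrt \<kappa>) \<longlongrightarrow> 0) at_top" by real_asymp
    have "\<forall>\<^sub>F \<kappa> in at_top. (2 * T + real m * (4 + 2 * T)) * (1 / sqrt \<kappa>) = ?Y \<kappa>"
      using eventually_gt_at_top[of 0]
    proof eventually_elim
      case (elim \<kappa>)
      then have "sqrt \<kappa> / \<kappa> = 1 / sqrt \<kappa>" by (simp add: field_simps)
      moreover have "(real m / (1 / sqrt \<kappa>)) * ((4 + 2 * T) / \<kappa>) = real m * (4 + 2 * T) * (sqrt \<kappa> / \<kappa>)"
        by simp
      ultimately have "(real m / (1 / sqrt \<kappa>)) * ((4 + 2 * T) / \<kappa>) = real m * (4 + 2 * T) * (1 / sqrt \<kappa>)"
        by (simp only:)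
      then show ?case by (simp add: algebra_simps)
    qed
    moreover have "((\<lambda>\<kappa>. (2 * T + real m * (4 + 2 * T)) * (1 / sqrt \<kappa>)) \<longlongrightarrow> (2 * T + real m * (4 + 2 * T)) * 0) at_top"
      by (intro tendsto_mult tendsto_const 1)
    ultimately show "(?Y \<longlongrightarrow> 0) at_top"
      by (simp add: Lim_transform_eventually)
  qed (rule assms(4))
qed

end
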